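(* There exist irreducible complex plane sextics $C_1,C_2\subset\mathbb{P}^2$ with simple singularities such that $\pi_1(\mathbb{P}^2\smallsetminus C_1)$ admits an epimorphism onto the dihedral group $\mathbb{D}_{10}$, $\pi_1(\mathbb{P}^2\smallsetminus C_2)$ admits an epimorphism onto the dihedral group $\mathbb{D}_{14}$, and neither $C_1$ nor $C_2$ is of torus type.
   Context: A plane sextic is a curve of degree $6$ in the complex projective plane. A singularity is simple if it is of one of the types $\mathbf{A}_p$ ($p\ge1$), $\mathbf{D}_q$ ($q\ge4$), $\mathbf{E}_6$, $\mathbf{E}_7$, $\mathbf{E}_8$. $\mathbb{D}_{2n}$ denotes the dihedral group of order $2n$. A reduced plane sextic is of torus type if its equation can be written as $p^3+q^2=0$ with $p,q$ homogeneous polynomials in $x_0,x_1,x_2$ of degrees $2$ and $3$, respectively. *)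

theory Defs
  imports
    "HOL-Analysis.Analysis"
    "HOL-Algebra.Group"
    "HOL-Computational_Algebra.Computational_Algebra"
    "HOL-Library.Poly_Mapping"
begin

section \<open>The complex projective plane\<close>

quotient_type proj_plane = "complex ^ 3" /
  partial: "\<lambda>v w. v \<noteq> 0 \<and> w \<noteq> 0 \<and> (\<exists>c. w = c *s v)"
  morphisms rep_proj proj
proof (rule part_equivpI)
  show "\<exists>x :: complex ^ 3. x \<noteq> 0 \<and> x \<noteq> 0 \<and> (\<exists>c. x = c *s x)"
    by (rule exI [of _ "axis 1 1"]) (auto simp: axis_eq_0_iff intro: exI [of _ 1])
  show "symp (\<lambda>v w :: complex ^ 3. v \<noteq> 0 \<and> w \<noteq> 0 \<and> (\<exists>c. w = c *s v))"
  proof (rule sympI, elim conjE exE, intro conjI)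
    fix v w :: "complex ^ 3" and c
    assume "v \<noteq> 0" "w \<noteq> 0" "w = c *s v"
    then show "\<exists>c. v = c *s w"
      by (intro exI [of _ "inverse c"]) (auto simp: vector_smult_assoc)
  qed
  show "transp (\<lambda>v w :: complex ^ 3. v \<noteq> 0 \<and> w \<noteq> 0 \<and> (\<exists>c. w = c *s v))"
    by (rule transpI) (auto simp: vector_smult_assoc)
qed

text \<open>\<open>proj v\<close> is the point with homogeneous coordinates \<open>v\<close>; it is meaningful for \<open>v \<noteq> 0\<close> only.\<close>

lemma proj_eq_iff: "v \<noteq> 0 \<Longrightarrow> w \<noteq> 0 \<Longrightarrow> proj v = proj w \<longleftrightarrow> (\<exists>c. w = c *s v)"
  using Quotient_rel [OF Quotient_proj_plane, of v w] by (auto intro: exI [of _ 1])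

lemma proj_cases: obtains v where "v \<noteq> 0" "P = proj v"
proof -
  have "proj (rep_proj P) = P" "rep_proj P \<noteq> 0"
    using Quotient_abs_rep [OF Quotient_proj_plane, of P]
      Quotient_rep_reflp [OF Quotient_proj_plane, of P] by auto
  then show ?thesis using that by metis
qed

instantiation proj_plane :: topological_space
begin

text \<open>The quotient topology of \<open>\<complex>\<^sup>3 - {0}\<close>.\<close>

definition open_proj_plane :: "proj_plane set \<Rightarrow> bool" where
  "open_proj_plane U \<longleftrightarrow> open {v. v \<noteq> 0 \<and> proj v \<in> U}"

instance
proof
  have "{v :: complex ^ 3. v \<noteq> 0 \<and> proj v \<in> UNIV} = - {0}" by auto
  then show "open (UNIV :: proj_plane set)"
    unfolding open_proj_plane_def by (simp add: open_Compl)
next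
  fix S T :: "proj_plane set" assume "open S" "open T"
  moreover have "{v. v \<noteq> 0 \<and> proj v \<in> S \<inter> T} =
      {v. v \<noteq> 0 \<and> proj v \<in> S} \<inter> {v. v \<noteq> 0 \<and> proj v \<in> T}" by auto
  ultimately show "open (S \<inter> T)"
    unfolding open_proj_plane_def by (simp add: open_Int)
next
  fix K :: "proj_plane set set" assume "\<forall>S\<in>K. open S"
  moreover have "{v. v \<noteq> 0 \<and> proj v \<in> \<Union> K} = (\<Union>S\<in>K. {v. v \<noteq> 0 \<and> proj v \<in> S})" by auto
  ultimately show "open (\<Union> K)"
    unfolding open_proj_plane_def by auto
qed

end


section \<open>Ternary forms and plane curves\<close>

type_synonym ternary_poly = "(3 \<Rightarrow>\<^sub>0 nat) \<Rightarrow>\<^sub>0 complex"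

definition poly_eval :: "ternary_poly \<Rightarrow> complex ^ 3 \<Rightarrow> complex" where
  "poly_eval F v = (\<Sum>m\<in>Poly_Mapping.keys F. Poly_Mapping.lookup F m * (\<Prod>i\<in>UNIV. (v $ i) ^ Poly_Mapping.lookup m i))"

definition homogeneous :: "nat \<Rightarrow> ternary_poly \<Rightarrow> bool" where
  "homogeneous d F \<longleftrightarrow> (\<forall>m\<in>Poly_Mapping.keys F. (\<Sum>i\<in>UNIV. Poly_Mapping.lookup m i) = d)"

text \<open>A plane sextic is given by its equation, a nonzero form of degree 6.\<close>

definition plane_sextic :: "ternary_poly \<Rightarrow> bool" where
  "plane_sextic F \<longleftrightarrow> F \<noteq> 0 \<and> homogeneous 6 F"

definition curve :: "ternary_poly \<Rightarrow> proj_plane set" where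
  "curve F = {P. \<exists>v. v \<noteq> 0 \<and> P = proj v \<and> poly_eval F v = 0}"

text \<open>The factor \<open>c\<close> accounts for the equation of a curve being unique only up to a nonzero constant.\<close>

definition torus_type :: "ternary_poly \<Rightarrow> bool" where
  "torus_type F \<longleftrightarrow> (\<exists>c p q. c \<noteq> 0 \<and> homogeneous 2 p \<and> homogeneous 3 q \<and>
     Poly_Mapping.map ((*) c) F = p ^ 3 + q ^ 2)"

lemma poly_eval_scale:
  assumes "homogeneous d F"
  shows "poly_eval F (c *s v) = c ^ d * poly_eval F v"
  using assms
  by (auto simp: poly_eval_def homogeneous_def power_mult_distrib prod.distrib sum_distrib_left
      simp flip: power_sum intro!: sum.cong)

lemma proj_in_curve_iff:
  assumes "homogeneous d F" "v \<noteq> 0"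
  shows "proj v \<in> curve F \<longleftrightarrow> poly_eval F v = 0"
proof
  assume "proj v \<in> curve F"
  then obtain w where w: "w \<noteq> 0" "proj w = proj v" "poly_eval F w = 0"
    by (auto simp: curve_def)
  then obtain c where "v = c *s w"
    using proj_eq_iff assms(2) by metis
  then show "poly_eval F v = 0"
    using w poly_eval_scale [OF assms(1)] by simp
qed (use assms in \<open>auto simp: curve_def\<close>)

text \<open>The complement of a sextic is nonempty: restrict the equation to \<open>t \<mapsto> (1, t, t\<^sup>7)\<close>.\<close>

lemma sextic_complement_nonempty:
  assumes "plane_sextic F"
  shows "- curve F \<noteq> {}"
proof -
  have F: "F \<noteq> 0" "homogeneous 6 F"
    using assms by (auto simp: plane_sextic_def)
  define e :: "(3 \<Rightarrow>\<^sub>0 nat) \<Rightarrow> nat" where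
    "e m = Poly_Mapping.lookup m 2 + 7 * Poly_Mapping.lookup m 3" for m
  have deg: "Poly_Mapping.lookup m 1 + Poly_Mapping.lookup m 2 + Poly_Mapping.lookup m 3 = 6"
    if "m \<in> Poly_Mapping.keys F" for m
    using F(2) that unfolding homogeneous_def sum_3 by blast
  have inj: "inj_on e (Poly_Mapping.keys F)"
  proof (rule inj_onI)
    fix m n assume mn: "m \<in> Poly_Mapping.keys F" "n \<in> Poly_Mapping.keys F" "e m = e n"
    have 3: "Poly_Mapping.lookup k 3 = e k div 7" if "k \<in> Poly_Mapping.keys F" for k
      using deg [OF that] unfolding e_def by (subst div_mult_self2) auto
    have eq3: "Poly_Mapping.lookup m 3 = Poly_Mapping.lookup n 3"
      by (simp only: 3 mn)
    then have eq2: "Poly_Mapping.lookup m 2 = Poly_Mapping.lookup n 2"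
      using mn(3) unfolding e_def by linarith
    then have eq1: "Poly_Mapping.lookup m 1 = Poly_Mapping.lookup n 1"
      using deg [OF mn(1)] deg [OF mn(2)] eq3 by linarith
    show "m = n"
    proof (rule poly_mapping_eqI)
      show "Poly_Mapping.lookup m i = Poly_Mapping.lookup n i" for i
        using exhaust_3 [of i] eq1 eq2 eq3 by metis
    qed
  qed
  define p where "p = (\<Sum>m\<in>Poly_Mapping.keys F. monom (Poly_Mapping.lookup F m) (e m))"
  obtain m0 where m0: "m0 \<in> Poly_Mapping.keys F"
    using F(1) by (metis all_not_in_conv keys_eq_empty)
  have "coeff p (e m0) = (\<Sum>m\<in>Poly_Mapping.keys F. if m = m0 then Poly_Mapping.lookup F m else 0)"
    unfolding p_def coeff_sum coeff_monom
    using inj m0 by (intro sum.cong) (auto dest: inj_onD)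
  also have "\<dots> \<noteq> 0"
    using m0 by (simp add: in_keys_iff)
  finally have "p \<noteq> 0" by auto
  then obtain t where t: "poly p t \<noteq> 0"
    using poly_all_0_iff_0 by blast
  define v :: "complex ^ 3" where "v = vector [1, t, t ^ 7]"
  have "v $ 1 = 1" by (simp add: v_def)
  then have v: "v \<noteq> 0" by auto
  have prod_3: "(\<Prod>i\<in>UNIV. g i) = g 1 * g 2 * g 3" for g :: "3 \<Rightarrow> complex"
    unfolding UNIV_3 by (simp add: mult.assoc)
  have "poly_eval F v = poly p t"
    unfolding poly_eval_def p_def poly_sum poly_monom
    by (intro sum.cong) (auto simp: v_def prod_3 e_def power_add simp flip: power_mult)
  then have "proj v \<notin> curve F"
    using t v F(2) by (simp add: proj_in_curve_iff)
  then show ?thesis by blast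
qed


section \<open>Simple singularities\<close>

definition holomorphic_fun_on :: "(complex ^ 'n \<Rightarrow> complex) \<Rightarrow> (complex ^ 'n) set \<Rightarrow> bool" where
  "holomorphic_fun_on f U \<longleftrightarrow> open U \<and>
     (\<forall>x\<in>U. \<exists>D. (f has_derivative D) (at x) \<and> (\<forall>c h. D (c *s h) = c * D h))"

definition biholomorphic_between ::
    "(complex ^ 'n \<Rightarrow> complex ^ 'n) \<Rightarrow> (complex ^ 'n) set \<Rightarrow> (complex ^ 'n) set \<Rightarrow> bool" where
  "biholomorphic_between \<phi> U V \<longleftrightarrow> (\<exists>\<psi>. homeomorphism U V \<phi> \<psi> \<and>
     (\<forall>i. holomorphic_fun_on (\<lambda>x. \<phi> x $ i) U) \<and> (\<forall>i. holomorphic_fun_on (\<lambda>y. \<psi> y $ i) V))"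

text \<open>
  Analytic equivalence at the origin of the plane curve germs \<open>f = 0\<close> and \<open>g = 0\<close>: up to a change of
  coordinates, the equations differ by an invertible factor.
\<close>

definition equivalent_germs :: "(complex ^ 2 \<Rightarrow> complex) \<Rightarrow> (complex ^ 2 \<Rightarrow> complex) \<Rightarrow> bool" where
  "equivalent_germs f g \<longleftrightarrow> (\<exists>U V \<phi> u. 0 \<in> U \<and> biholomorphic_between \<phi> U V \<and> \<phi> 0 = 0 \<and>
     holomorphic_fun_on u U \<and> (\<forall>x\<in>U. u x \<noteq> 0) \<and> (\<forall>x\<in>U. f (\<phi> x) = u x * g x))"

datatype simple_type = A_type nat | D_type nat | E6_type | E7_type | E8_type

fun valid_type :: "simple_type \<Rightarrow> bool" where
  "valid_type (A_type p) \<longleftrightarrow> p \<ge> 1"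
| "valid_type (D_type q) \<longleftrightarrow> q \<ge> 4"
| "valid_type _ \<longleftrightarrow> True"

fun normal_form :: "simple_type \<Rightarrow> complex ^ 2 \<Rightarrow> complex" where
  "normal_form (A_type p) z = (z $ 1) ^ 2 + (z $ 2) ^ (p + 1)"
| "normal_form (D_type q) z = (z $ 1) ^ 2 * z $ 2 + (z $ 2) ^ (q - 1)"
| "normal_form E6_type z = (z $ 1) ^ 3 + (z $ 2) ^ 4"
| "normal_form E7_type z = (z $ 1) ^ 3 + z $ 1 * (z $ 2) ^ 3"
| "normal_form E8_type z = (z $ 1) ^ 3 + (z $ 2) ^ 5"

text \<open>
  For a basis \<open>v, a, b\<close> of \<open>\<complex>\<^sup>3\<close>, the map \<open>z \<mapsto> proj (v + z\<^sub>1 a + z\<^sub>2 b)\<close> is an affine chart of the plane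
  centred at \<open>proj v\<close>. The type does not depend on the chart.
\<close>

definition has_singularity_type :: "ternary_poly \<Rightarrow> proj_plane \<Rightarrow> simple_type \<Rightarrow> bool" where
  "has_singularity_type F P T \<longleftrightarrow> (\<exists>v a b. v \<noteq> 0 \<and> P = proj v \<and> vec.span {v, a, b} = UNIV \<and>
     equivalent_germs (\<lambda>z. poly_eval F (v + z $ 1 *s a + z $ 2 *s b)) (normal_form T))"

definition singular_point :: "ternary_poly \<Rightarrow> proj_plane \<Rightarrow> bool" where
  "singular_point F P \<longleftrightarrow> (\<exists>v. v \<noteq> 0 \<and> P = proj v \<and> poly_eval F v = 0 \<and>
     (poly_eval F has_derivative (\<lambda>_. 0)) (at v))"

definition simple_singularities :: "ternary_poly \<Rightarrow> bool" where
  "simple_singularities F \<longleftrightarrow>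
     (\<forall>P. singular_point F P \<longrightarrow> (\<exists>T. valid_type T \<and> has_singularity_type F P T))"


section \<open>The fundamental group\<close>

definition loops_at :: "'a::topological_space set \<Rightarrow> 'a \<Rightarrow> (real \<Rightarrow> 'a) set" where
  "loops_at S b = {p. path p \<and> path_image p \<subseteq> S \<and> pathstart p = b \<and> pathfinish p = b}"

definition loop_homotopy :: "'a::topological_space set \<Rightarrow> 'a \<Rightarrow> ((real \<Rightarrow> 'a) \<times> (real \<Rightarrow> 'a)) set" where
  "loop_homotopy S b = {(p, q). p \<in> loops_at S b \<and> q \<in> loops_at S b \<and> homotopic_paths S p q}"

definition fundamental_group :: "'a::topological_space set \<Rightarrow> 'a \<Rightarrow> (real \<Rightarrow> 'a) set monoid" where
  "fundamental_group S b =
    \<lparr>carrier = loops_at S b // loop_homotopy S b,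
     mult = (\<lambda>X Y. \<Union>p\<in>X. \<Union>q\<in>Y. loop_homotopy S b `` {p +++ q}),
     one = loop_homotopy S b `` {\<lambda>_. b}\<rparr>"

lemma equiv_loop_homotopy: "equiv (loops_at S b) (loop_homotopy S b)"
  by (rule equivI)
    (auto simp: refl_on_def sym_def trans_def loop_homotopy_def loops_at_def
      intro: homotopic_paths_sym homotopic_paths_trans)

lemma joinpaths_in_loops_at:
  "p \<in> loops_at S b \<Longrightarrow> q \<in> loops_at S b \<Longrightarrow> p +++ q \<in> loops_at S b"
  by (auto simp: loops_at_def path_image_join)

lemma fundamental_group_mult:
  assumes "p \<in> loops_at S b" "q \<in> loops_at S b"
  shows "loop_homotopy S b `` {p} \<otimes>\<^bsub>fundamental_group S b\<^esub> loop_homotopy S b `` {q} =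
    loop_homotopy S b `` {p +++ q}"
proof -
  have "congruent2 (loop_homotopy S b) (loop_homotopy S b)
      (\<lambda>p q. loop_homotopy S b `` {p +++ q})"
  proof (rule congruent2I')
    fix p p' q q'
    assume "(p, p') \<in> loop_homotopy S b" "(q, q') \<in> loop_homotopy S b"
    then have "(p +++ q, p' +++ q') \<in> loop_homotopy S b"
      using joinpaths_in_loops_at [of p S b q] joinpaths_in_loops_at [of p' S b q']
      by (auto simp: loop_homotopy_def loops_at_def intro: homotopic_paths_join)
    then show "loop_homotopy S b `` {p +++ q} = loop_homotopy S b `` {p' +++ q'}"
      by (rule equiv_class_eq [OF equiv_loop_homotopy])
  qed
  from UN_equiv_class2 [OF equiv_loop_homotopy equiv_loop_homotopy this assms]
  show ?thesis by (simp add: fundamental_group_def)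
qed

lemma homotopic_paths_const_join:
  assumes "p \<in> loops_at S b"
  shows "homotopic_paths S ((\<lambda>_. b) +++ p) p"
proof (rule homotopic_paths_sym,
    rule homotopic_paths_reparametrize [where f = "\<lambda>t. max 0 (2 * t - 1)"])
  show "((\<lambda>_. b) +++ p) t = p (max 0 (2 * t - 1))" if "t \<in> {0..1}" for t
    using assms that
    by (cases "2 * t = 1") (auto simp: joinpaths_def loops_at_def pathstart_def max_def)
qed (use assms in \<open>auto simp: loops_at_def intro!: continuous_intros\<close>)

lemma homotopic_paths_reverse_join:
  assumes "p \<in> loops_at S b"
  shows "homotopic_paths S (reversepath p +++ p) (\<lambda>_. b)"
proof -
  let ?i = "linepath 0 (1::real)"
  have "homotopic_paths {0..1} (reversepath ?i +++ ?i) (linepath 1 1)"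
    using homotopic_paths_linv [of ?i "{0..1}"] by (simp add: path_image_linepath closed_segment_eq_real_ivl)
  then have "homotopic_paths S (p \<circ> (reversepath ?i +++ ?i)) (p \<circ> linepath 1 1)"
    using assms by (intro homotopic_paths_continuous_image)
      (auto simp: loops_at_def path_def path_image_def)
  moreover have "p \<circ> (reversepath ?i +++ ?i) = reversepath p +++ p"
    by (auto simp: fun_eq_iff joinpaths_def reversepath_def linepath_def)
  moreover have "p \<circ> linepath 1 1 = (\<lambda>_. b)"
    using assms by (auto simp: fun_eq_iff linepath_def loops_at_def pathfinish_def)
  ultimately show ?thesis by simp
qed

lemma group_fundamental_group:
  assumes "b \<in> S"
  shows "group (fundamental_group S b)"
proof -
  let ?G = "fundamental_group S b" and ?c = "\<lambda>p. loop_homotopy S b `` {p}"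
  have carrier: "carrier ?G = ?c ` loops_at S b"
    by (auto simp: fundamental_group_def quotient_def)
  have const: "(\<lambda>_. b) \<in> loops_at S b"
    using assms by (auto simp: loops_at_def path_def path_image_def pathstart_def pathfinish_def)
  have rev: "reversepath p \<in> loops_at S b" if "p \<in> loops_at S b" for p
    using that by (auto simp: loops_at_def)
  have one: "\<one>\<^bsub>?G\<^esub> = ?c (\<lambda>_. b)"
    by (simp add: fundamental_group_def)
  have eqI: "?c p = ?c q" if "p \<in> loops_at S b" "q \<in> loops_at S b" "homotopic_paths S p q" for p q
    using that by (intro equiv_class_eq [OF equiv_loop_homotopy]) (simp add: loop_homotopy_def)
  note mult = fundamental_group_mult and join = joinpaths_in_loops_at
  show ?thesis
  proof (rule groupI)
    fix x y assume "x \<in> carrier ?G" "y \<in> carrier ?G"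
    then show "x \<otimes>\<^bsub>?G\<^esub> y \<in> carrier ?G"
      by (auto simp: carrier mult join)
  next
    show "\<one>\<^bsub>?G\<^esub> \<in> carrier ?G"
      using const by (auto simp: carrier one)
  next
    fix x y z assume "x \<in> carrier ?G" "y \<in> carrier ?G" "z \<in> carrier ?G"
    then obtain p q r where *: "p \<in> loops_at S b" "q \<in> loops_at S b" "r \<in> loops_at S b"
      "x = ?c p" "y = ?c q" "z = ?c r"
      by (auto simp: carrier)
    then have "homotopic_paths S (p +++ (q +++ r)) ((p +++ q) +++ r)"
      by (intro homotopic_paths_assoc) (auto simp: loops_at_def)
    then have "?c (p +++ (q +++ r)) = ?c ((p +++ q) +++ r)"
      using * by (intro eqI join)
    then show "x \<otimes>\<^bsub>?G\<^esub> y \<otimes>\<^bsub>?G\<^esub> z = x \<otimes>\<^bsub>?G\<^esub> (y \<otimes>\<^bsub>?G\<^esub> z)"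
      using * by (simp add: mult join)
  next
    fix x assume "x \<in> carrier ?G"
    then obtain p where p: "p \<in> loops_at S b" "x = ?c p"
      by (auto simp: carrier)
    then show "\<one>\<^bsub>?G\<^esub> \<otimes>\<^bsub>?G\<^esub> x = x"
      by (simp add: one mult const eqI join homotopic_paths_const_join)
    have "?c (reversepath p) \<otimes>\<^bsub>?G\<^esub> x = \<one>\<^bsub>?G\<^esub>"
      using p by (simp add: one mult const rev eqI join homotopic_paths_reverse_join)
    then show "\<exists>y\<in>carrier ?G. y \<otimes>\<^bsub>?G\<^esub> x = \<one>\<^bsub>?G\<^esub>"
      using rev p by (auto simp: carrier)
  qed
qed


section \<open>Dihedral groups\<close>

text \<open>
  The dihedral group of order \<open>2n\<close>: \<open>(a, False)\<close> is the rotation \<open>r\<^sup>a\<close> and \<open>(a, True)\<close> the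
  reflection \<open>r\<^sup>a s\<close>, where \<open>s r s = r\<^sup>-\<^sup>1\<close>.
\<close>

definition dihedral_group :: "nat \<Rightarrow> (int \<times> bool) monoid" where
  "dihedral_group n =
    \<lparr>carrier = {0..<int n} \<times> UNIV,
     mult = (\<lambda>(a, s) (b, t). ((if s then a - b else a + b) mod int n, s \<noteq> t)),
     one = (0, False)\<rparr>"

lemma group_dihedral_group:
  assumes "n > 0"
  shows "group (dihedral_group n)"
proof (rule groupI)
  fix x assume "x \<in> carrier (dihedral_group n)"
  moreover obtain a s where "x = (a, s)" by fastforce
  ultimately show "\<exists>y\<in>carrier (dihedral_group n). y \<otimes>\<^bsub>dihedral_group n\<^esub> x = \<one>\<^bsub>dihedral_group n\<^esub>"
    using assms
    by (intro bexI [of _ "(if s then a else (- a) mod int n, s)"])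
      (auto simp: dihedral_group_def mod_simps)
qed (use assms in \<open>auto simp: dihedral_group_def mod_simps algebra_simps\<close>)

lemma order_dihedral_group: "card (carrier (dihedral_group n)) = 2 * n"
  by (simp add: dihedral_group_def card_cartesian_product)

end

theory Submission
  imports Defs
begin

text \<open>
  The idea is to look for sextics with an identity \<open>A\<^sup>2 - B\<^sup>2 F = H\<^sup>n\<close>, where \<open>H\<close> is a conic and
  \<open>n = 5, 7\<close>. On the Milnor fibre \<open>F = 1\<close> it reads \<open>(A + B)(A - B) = H\<^sup>n\<close>, and adjoining
  \<open>n\<close>-th roots \<open>z, z'\<close> of the two factors with \<open>z z' = H\<close> yields a covering of the complement of
  \<open>F = 0\<close>, on which the dihedral group of order \<open>2n\<close> acts by \<open>(v, z, z') \<mapsto> (v, \<zeta> z, \<zeta>\<^sup>-\<^sup>1 z')\<close> and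
  \<open>(v, z, z') \<mapsto> (- v, - z', - z)\<close>. A loop around a simple zero of \<open>F\<close> has a reflection as its
  monodromy, and a loop in a line through a common zero of \<open>A\<close> and \<open>H\<close> with \<open>B \<noteq> 0\<close> has a
  rotation. At such a point, \<open>(A, -H)\<close> are local coordinates showing that the singularity is of type
  \<open>A\<^bsub>n-1\<^esub>\<close>.

  The two sextics below have no other singular points than four \<open>A\<^sub>4\<close> or three \<open>A\<^sub>6\<close> points,
  respectively. These are unibranch and cannot be written locally as \<open>p\<^sup>3 + q\<^sup>2\<close> with
  \<open>p = q = 0\<close> at the point. As a conic meets every curve, this excludes both the torus type and a
  factor of degree at most 2; a cubic factor is excluded by a tangent at a singular point.
\<close>

text \<open>A dihedral covering branched along \<open>F = 0\<close> is a cyclic covering of degree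
  \<open>n\<close> of the double plane \<open>w^2 = F\<close>, on which the involution
  \<open>w -> - w\<close> inverts the cyclic group. The n-th root of a function
  \<open>A + B w\<close> whose norm is an n-th power produces one; this is the origin of the
  identity. It is homogeneous if \<open>A\<close>, \<open>B\<close>, \<open>H\<close> have degrees
  \<open>n\<close>, \<open>n - 3\<close>, \<open>2\<close>. On \<open>F = 1\<close> the root
  \<open>w\<close> is constant, and \<open>v -> - v\<close> takes the part of the involution,
  because the degrees of \<open>A\<close> and \<open>B\<close> have different parity.

  Keeping both roots \<open>z\<close> and \<open>z'\<close> preserves freeness of the action where
  one factor vanishes. Both factors vanish exactly where \<open>B = H = 0\<close>, so these two
  curves may meet only on the sextic.

  A point of the complement has six representatives with \<open>F = 1\<close>. The group that acts
  is therefore the product of the dihedral group with the cube roots of unity, and the second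
  component of the monodromy is discarded. The covering lies over a subset of a vector space of
  dimension 9, where properness can be checked by norms; forms of degree 6 map the complement there
  continuously, which is enough to lift loops.\<close>

no_notation fps_nth (infixl "$" 75)


section \<open>Evaluation of ternary polynomials\<close>

text \<open>The target ring is left open because four instances occur: values at a point,
  restrictions to a line in \<open>complex poly\<close>, substitution of germs in
  \<open>complex poly poly\<close>, and the grading in \<open>ternary_poly poly\<close>.\<close>

definition insertion :: "(complex \<Rightarrow> 'a::comm_ring_1) \<Rightarrow> (3 \<Rightarrow> 'a) \<Rightarrow> ternary_poly \<Rightarrow> 'a" where
  "insertion c g F = (\<Sum>m\<in>Poly_Mapping.keys F.
     c (Poly_Mapping.lookup F m) * (\<Prod>i\<in>UNIV. g i ^ Poly_Mapping.lookup m i))"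

lemma poly_eval_insertion: "poly_eval F v = insertion (\<lambda>c. c) (\<lambda>i. v $ i) F"
  by (simp add: poly_eval_def insertion_def)

definition const3 :: "complex \<Rightarrow> ternary_poly" where "const3 a = Poly_Mapping.single 0 a"
definition var3 :: "3 \<Rightarrow> ternary_poly" where "var3 i = Poly_Mapping.single (Poly_Mapping.single i 1) 1"

definition coeff_hom :: "(complex \<Rightarrow> 'a::comm_ring_1) \<Rightarrow> bool" where
  "coeff_hom c \<longleftrightarrow> c 1 = 1 \<and> (\<forall>a b. c (a + b) = c a + c b) \<and> (\<forall>a b. c (a * b) = c a * c b)"

lemma coeff_hom_0: "coeff_hom c \<Longrightarrow> c 0 = 0"
  unfolding coeff_hom_def by (metis add_cancel_right_right)

lemma insertion_superset:
  assumes "coeff_hom c" "finite S" "Poly_Mapping.keys F \<subseteq> S"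
  shows "insertion c g F = (\<Sum>m\<in>S. c (Poly_Mapping.lookup F m) * (\<Prod>i\<in>UNIV. g i ^ Poly_Mapping.lookup m i))"
  unfolding insertion_def using assms coeff_hom_0 [OF assms(1)]
  by (intro sum.mono_neutral_left) (auto simp: in_keys_iff)

lemma insertion_0 [simp]: "insertion c g 0 = 0"
  by (simp add: insertion_def)

lemma insertion_add:
  assumes c: "coeff_hom c"
  shows "insertion c g (F + G) = insertion c g F + insertion c g G"
proof -
  let ?S = "Poly_Mapping.keys F \<union> Poly_Mapping.keys G"
  have "insertion c g H = (\<Sum>m\<in>?S. c (Poly_Mapping.lookup H m) * (\<Prod>i\<in>UNIV. g i ^ Poly_Mapping.lookup m i))"
    if "H \<in> {F, G, F + G}" for H
    using that keys_add [of F G] by (intro insertion_superset [OF c]) auto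
  moreover have "c (a + b) = c a + c b" for a b
    using c by (simp add: coeff_hom_def)
  ultimately show ?thesis
    by (simp add: lookup_add distrib_right sum.distrib)
qed

lemma insertion_sum: "coeff_hom c \<Longrightarrow> insertion c g (\<Sum>x\<in>S. f x) = (\<Sum>x\<in>S. insertion c g (f x))"
  by (induction S rule: infinite_finite_induct) (auto simp: insertion_add)

lemma insertion_single:
  "coeff_hom c \<Longrightarrow> insertion c g (Poly_Mapping.single m a) = c a * (\<Prod>i\<in>UNIV. g i ^ Poly_Mapping.lookup m i)"
  by (subst insertion_superset [where S = "{m}"]) (auto simp: lookup_single)

lemma sum_of_singles: "(\<Sum>m\<in>Poly_Mapping.keys F. Poly_Mapping.single m (Poly_Mapping.lookup F m)) = F"
  by (rule poly_mapping_eqI) (auto simp: lookup_sum lookup_single when_def in_keys_iff)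

lemma insertion_mult:
  assumes c: "coeff_hom c"
  shows "insertion c g (F * G) = insertion c g F * insertion c g G"
proof -
  let ?s = Poly_Mapping.single and ?l = Poly_Mapping.lookup and ?K = Poly_Mapping.keys
  have 1: "insertion c g (?s m a * ?s n b) = insertion c g (?s m a) * insertion c g (?s n b)" for m n a b
    using c by (simp add: mult_single insertion_single lookup_add power_add prod.distrib coeff_hom_def)
  have "insertion c g (F * G) = insertion c g ((\<Sum>m\<in>?K F. ?s m (?l F m)) * (\<Sum>n\<in>?K G. ?s n (?l G n)))"
    by (simp only: sum_of_singles)
  also have "\<dots> = (\<Sum>m\<in>?K F. insertion c g (?s m (?l F m))) * (\<Sum>n\<in>?K G. insertion c g (?s n (?l G n)))"
    by (simp add: sum_product insertion_sum c 1)
  also have "\<dots> = insertion c g F * insertion c g G"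
    by (simp only: sum_of_singles flip: insertion_sum [OF c])
  finally show ?thesis .
qed

lemma const3_hom: "const3 (a + b) = const3 a + const3 b" "const3 (a * b) = const3 a * const3 b"
  "const3 1 = 1" "const3 0 = 0"
  by (auto simp: const3_def single_add mult_single)

lemma insertion_const3: "coeff_hom c \<Longrightarrow> insertion c g (const3 a) = c a"
  by (simp add: const3_def insertion_single)

lemma insertion_var3: "coeff_hom c \<Longrightarrow> insertion c g (var3 i) = g i"
proof -
  assume c: "coeff_hom c"
  have "(\<Prod>j\<in>UNIV. g j ^ Poly_Mapping.lookup (Poly_Mapping.single i (1::nat)) j) = (\<Prod>j\<in>UNIV. if j = i then g j else 1)"
    by (intro prod.cong) (auto simp: lookup_single)
  also have "\<dots> = g i" by simp
  finally show ?thesis using c by (simp add: var3_def insertion_single coeff_hom_def)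
qed

lemma insertion_1: "coeff_hom c \<Longrightarrow> insertion c g 1 = 1"
  by (metis insertion_const3 const3_hom(3) coeff_hom_def)

lemma insertion_uminus: "coeff_hom c \<Longrightarrow> insertion c g (- F) = - insertion c g F"
  by (metis add.right_inverse add_eq_0_iff insertion_0 insertion_add)

lemma insertion_diff: "coeff_hom c \<Longrightarrow> insertion c g (F - G) = insertion c g F - insertion c g G"
  using insertion_add [of c g F "- G"] by (simp add: insertion_uminus)

lemma insertion_power: "coeff_hom c \<Longrightarrow> insertion c g (F ^ n) = insertion c g F ^ n"
  by (induction n) (auto simp: insertion_1 insertion_mult)

lemma insertion_of_nat: "coeff_hom c \<Longrightarrow> insertion c g (of_nat n) = of_nat n"
  by (induction n) (auto simp: insertion_1 insertion_add)

lemma insertion_numeral: "coeff_hom c \<Longrightarrow> insertion c g (numeral n) = numeral n"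
  using insertion_of_nat [of c g "numeral n"] by simp

lemmas insertion_simps = insertion_add insertion_mult insertion_diff insertion_uminus insertion_power
  insertion_numeral insertion_1 insertion_var3 insertion_const3

lemma map_times_const3: "c \<noteq> 0 \<Longrightarrow> Poly_Mapping.map ((*) c) F = const3 c * F"
proof -
  assume "c \<noteq> 0"
  let ?s = Poly_Mapping.single and ?l = Poly_Mapping.lookup and ?K = Poly_Mapping.keys
  have "const3 c * F = const3 c * (\<Sum>m\<in>?K F. ?s m (?l F m))" by (simp only: sum_of_singles)
  also have "\<dots> = (\<Sum>m\<in>?K F. ?s m (c * ?l F m))"
    by (simp add: sum_distrib_left const3_def mult_single)
  also have "\<dots> = Poly_Mapping.map ((*) c) F"
    by (rule poly_mapping_eqI)
      (auto simp: lookup_sum lookup_single when_def in_keys_iff Poly_Mapping.map.rep_eq)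
  finally show ?thesis ..
qed

lemma coeff_hom_id: "coeff_hom (\<lambda>c. c)"
  by (simp add: coeff_hom_def)

lemmas poly_eval_simps = insertion_simps [OF coeff_hom_id, where g = "\<lambda>i. v $ i" for v :: "complex ^ 3", folded poly_eval_insertion]

lemma ternary_induct [case_names const var add mult]:
  assumes "\<And>a. P (const3 a)" "\<And>i. P (var3 i)"
    and "\<And>F G. P F \<Longrightarrow> P G \<Longrightarrow> P (F + G)" "\<And>F G. P F \<Longrightarrow> P G \<Longrightarrow> P (F * G)"
  shows "P F"
proof -
  have pow: "P (var3 i ^ k)" for i k
    using assms(1) [of 1] by (induction k) (auto simp: const3_hom intro: assms)
  have var_pow: "var3 i ^ k = Poly_Mapping.single (Poly_Mapping.single i k) 1" for i k
    by (induction k) (auto simp: var3_def mult_single simp flip: single_add)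
  have single: "P (Poly_Mapping.single m a)" for m a
  proof -
    have "m = Poly_Mapping.single 1 (Poly_Mapping.lookup m 1) + (Poly_Mapping.single 2 (Poly_Mapping.lookup m 2)
       + Poly_Mapping.single 3 (Poly_Mapping.lookup m 3))" (is "m = ?m")
    proof (rule poly_mapping_eqI)
      show "Poly_Mapping.lookup m i = Poly_Mapping.lookup ?m i" for i
        using exhaust_3 [of i] by (auto simp: lookup_add lookup_single)
    qed
    then have "Poly_Mapping.single m a = const3 a * (var3 1 ^ Poly_Mapping.lookup m 1 *
       (var3 2 ^ Poly_Mapping.lookup m 2 * var3 3 ^ Poly_Mapping.lookup m 3))"
      unfolding var_pow const3_def mult_single by simp
    then show ?thesis
      by (auto intro: assms pow)
  qed
  have "P (\<Sum>m\<in>S. Poly_Mapping.single m (f m))" if "finite S" for S f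
    using that assms(1) [of 0] by (induction S) (auto simp: const3_hom intro: single assms)
  then show ?thesis
    using sum_of_singles [of F] by (metis finite_keys)
qed

text \<open>Both sides are ring homomorphisms in \<open>F\<close>, so agreement on constants and
  variables suffices. With an evaluation for \<open>h\<close> this translates between identities of
  polynomials and of values.\<close>

lemma insertion_hom_comp:
  assumes "coeff_hom c" "coeff_hom d" "\<And>a. h (c a) = d a"
    "\<And>a b. h (a + b) = h a + h b" "\<And>a b. h (a * b) = h a * h b"
  shows "h (insertion c g F) = insertion d (\<lambda>i. h (g i)) F"
  by (induction F rule: ternary_induct) (simp_all add: insertion_simps assms)

section \<open>Homogeneity of sums, products and powers\<close>

lemma homogeneous_add: "homogeneous d F \<Longrightarrow> homogeneous d G \<Longrightarrow> homogeneous d (F + G)"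
  unfolding homogeneous_def using keys_add [of F G] by blast

lemma homogeneous_uminus: "homogeneous d F \<Longrightarrow> homogeneous d (- F)"
  unfolding homogeneous_def by simp

lemma homogeneous_diff: "homogeneous d F \<Longrightarrow> homogeneous d G \<Longrightarrow> homogeneous d (F - G)"
  using homogeneous_add [of d F "- G"] homogeneous_uminus by simp

lemma homogeneous_mult: "homogeneous d F \<Longrightarrow> homogeneous e G \<Longrightarrow> d + e = f \<Longrightarrow> homogeneous f (F * G)"
  unfolding homogeneous_def using keys_mult [of F G] by (fastforce simp: lookup_add sum.distrib)

lemma homogeneous_const3: "homogeneous 0 (const3 a)"
  by (auto simp: homogeneous_def const3_def split: if_splits)

lemma homogeneous_var3: "homogeneous 1 (var3 i)"
proof -
  have "(\<Sum>j\<in>UNIV. Poly_Mapping.lookup (Poly_Mapping.single i (1::nat)) j) = (\<Sum>j\<in>UNIV. if j = i then 1 else 0)"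
    by (intro sum.cong) (auto simp: lookup_single)
  then show ?thesis by (simp add: homogeneous_def var3_def)
qed

lemma homogeneous_power: "homogeneous d F \<Longrightarrow> d * k = e \<Longrightarrow> homogeneous e (F ^ k)"
proof (induction k arbitrary: e)
  case 0
  then show ?case using homogeneous_const3 [of 1] by (simp add: const3_hom)
next
  case (Suc k)
  then show ?case by (auto intro!: homogeneous_mult)
qed

lemma numeral_const3: "numeral n = const3 (numeral n)"
proof -
  have "of_nat k = const3 (of_nat k)" for k
    by (induction k) (auto simp: const3_hom)
  from this [of "numeral n"] show ?thesis by simp
qed

lemma homogeneous_numeral_mult: "homogeneous d F \<Longrightarrow> homogeneous d (numeral n * F)"
  by (auto simp: numeral_const3 intro!: homogeneous_mult homogeneous_const3)

lemma homogeneous_0_const3: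
  assumes "homogeneous 0 F" obtains a where "F = const3 a"
proof
  have m: "m = 0" if "m \<in> Poly_Mapping.keys F" for m
    using assms that by (auto simp: homogeneous_def intro!: poly_mapping_eqI)
  show "F = const3 (Poly_Mapping.lookup F 0)"
  proof (rule poly_mapping_eqI)
    show "Poly_Mapping.lookup F k = Poly_Mapping.lookup (const3 (Poly_Mapping.lookup F 0)) k" for k
      using m [of k] by (auto simp: const3_def lookup_single when_def in_keys_iff)
  qed
qed

section \<open>Factors of forms\<close>

text \<open>The variable is prime, so it divides one of the factors and can be cancelled until the
  product is a constant.\<close>

lemma monom_eq_mult:
  fixes p q :: "'a::idom poly"
  assumes "p * q = monom c n" "c \<noteq> 0"
  shows "\<exists>a i b j. p = monom a i \<and> q = monom b j \<and> i + j = n"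
  using assms(1)
proof (induction n arbitrary: p q)
  case 0
  then have "degree (p * q) = 0" by (simp add: monom_0)
  moreover have "p \<noteq> 0" "q \<noteq> 0" using 0 assms(2) by auto
  ultimately have "degree p = 0" "degree q = 0" by (auto simp: degree_mult_eq)
  then show ?case by (metis add.right_neutral degree_0_id monom_0)
next
  case (Suc n)
  have *: "\<exists>a i b j. p = monom a i \<and> q = monom b j \<and> i + j = Suc n"
    if pq: "p * q = monom c (Suc n)" and p0: "coeff p 0 = 0" for p q :: "'a poly"
  proof -
    obtain p' where p: "p = pCons 0 p'" using p0 by (cases p) auto
    then have "p' * q = monom c n" using pq by (simp add: monom_Suc)
    then obtain a i b j where "p' = monom a i" "q = monom b j" "i + j = n" using Suc.IH by blast
    then have "p = monom a (Suc i)" using p by (simp add: monom_Suc)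
    then show ?thesis using \<open>q = _\<close> \<open>i + j = n\<close> by (metis add_Suc)
  qed
  have "coeff p 0 * coeff q 0 = 0" using Suc.prems by (metis coeff_mult_0 coeff_monom nat.distinct(1))
  then show ?case
    using * [OF Suc.prems] * [of q p] Suc.prems by (metis add.commute mult.commute mult_eq_0_iff)
qed

text \<open>The coefficients of \<open>grading F\<close> are the homogeneous components of \<open>F\<close>.\<close>

definition grading :: "ternary_poly \<Rightarrow> ternary_poly poly" where
  "grading = insertion (\<lambda>a. [:const3 a:]) (\<lambda>i. [:0, var3 i:])"

lemma coeff_hom_grading: "coeff_hom (\<lambda>a. [:const3 a:])"
  by (simp add: coeff_hom_def const3_hom)

lemma grading_mult: "grading (F * G) = grading F * grading G"
  unfolding grading_def by (rule insertion_mult [OF coeff_hom_grading])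

lemma grading_sum:
  "grading F = (\<Sum>m\<in>Poly_Mapping.keys F.
     monom (Poly_Mapping.single m (Poly_Mapping.lookup F m)) (\<Sum>i\<in>UNIV. Poly_Mapping.lookup m i))"
proof -
  have pw: "[:0, var3 i:] ^ k = monom (Poly_Mapping.single (Poly_Mapping.single i k) 1) k" for i k
    by (induction k) (auto simp: var3_def mult_single monom_Suc one_pCons monom_0 smult_monom simp flip: single_add)
  have "[:const3 (Poly_Mapping.lookup F m):] * (\<Prod>i\<in>UNIV. [:0, var3 i:] ^ Poly_Mapping.lookup m i) =
     monom (Poly_Mapping.single m (Poly_Mapping.lookup F m)) (\<Sum>i\<in>UNIV. Poly_Mapping.lookup m i)" for m
  proof -
    have "m = Poly_Mapping.single 1 (Poly_Mapping.lookup m 1) + (Poly_Mapping.single 2 (Poly_Mapping.lookup m 2)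
       + Poly_Mapping.single 3 (Poly_Mapping.lookup m 3))" (is "m = ?m")
    proof (rule poly_mapping_eqI)
      show "Poly_Mapping.lookup m i = Poly_Mapping.lookup ?m i" for i
        using exhaust_3 [of i] by (auto simp: lookup_add lookup_single)
    qed
    then have m: "?m = m" by simp
    have 1: "(\<Prod>i\<in>UNIV. f i) = f 1 * (f 2 * f 3)" for f :: "3 \<Rightarrow> ternary_poly poly"
      unfolding UNIV_3 by simp
    have 2: "(\<Sum>i\<in>UNIV. f i) = f 1 + (f 2 + f 3)" for f :: "3 \<Rightarrow> nat"
      unfolding UNIV_3 by simp
    have 3: "[:const3 a:] = monom (Poly_Mapping.single 0 a) 0" for a
      by (simp add: const3_def monom_0)
    show ?thesis
      unfolding 1 2 3 pw mult_monom mult_single by (simp add: m)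
  qed
  then show ?thesis by (simp add: grading_def insertion_def)
qed

lemma grading_homogeneous: "homogeneous d F \<Longrightarrow> grading F = monom F d"
proof -
  assume "homogeneous d F"
  then have "grading F = (\<Sum>m\<in>Poly_Mapping.keys F. monom (Poly_Mapping.single m (Poly_Mapping.lookup F m)) d)"
    unfolding grading_sum homogeneous_def by (intro sum.cong) auto
  also have "\<dots> = monom (\<Sum>m\<in>Poly_Mapping.keys F. Poly_Mapping.single m (Poly_Mapping.lookup F m)) d"
    by (simp add: poly_eq_iff coeff_sum)
  finally show ?thesis by (simp add: sum_of_singles)
qed

lemma homogeneous_grading:
  assumes "grading F = monom G d"
  shows "homogeneous d F"
  unfolding homogeneous_def
proof
  let ?t = "\<lambda>m :: 3 \<Rightarrow>\<^sub>0 nat. \<Sum>i\<in>UNIV. Poly_Mapping.lookup m i"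
  fix m assume m: "m \<in> Poly_Mapping.keys F"
  show "?t m = d"
  proof (rule ccontr)
    assume "?t m \<noteq> d"
    then have "0 = Poly_Mapping.lookup (coeff (grading F) (?t m)) m" by (simp add: assms)
    also have "\<dots> = (\<Sum>k\<in>Poly_Mapping.keys F. if k = m then Poly_Mapping.lookup F m else 0)"
      unfolding grading_sum coeff_sum lookup_sum
      by (intro sum.cong) (auto simp: lookup_single when_def)
    also have "\<dots> = Poly_Mapping.lookup F m" using m by simp
    finally show False using m by (simp add: in_keys_iff)
  qed
qed

text \<open>The grading sends a form to a single monomial over a domain, and factors of a monomial
  are monomials.\<close>

lemma homogeneous_factors:
  assumes "homogeneous d F" "F \<noteq> 0" "F = G * K"
  shows "\<exists>i j. homogeneous i G \<and> homogeneous j K \<and> i + j = d"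
proof -
  have "grading G * grading K = monom F d"
    using assms by (metis grading_mult grading_homogeneous)
  then show ?thesis using monom_eq_mult [OF _ assms(2)] homogeneous_grading by blast
qed

section \<open>Derivatives of polynomials\<close>

text \<open>The derivative depends polynomially on the point; the resulting continuity is what the
  inverse function theorem asks for later.\<close>

lemma poly_eval_has_derivative_ex:
  "\<exists>D. \<forall>v. (poly_eval F has_derivative (\<lambda>h. \<Sum>i\<in>UNIV. h $ i * poly_eval (D i) v)) (at v)"
proof (induction F rule: ternary_induct)
  case (const a)
  have "poly_eval (const3 a) = (\<lambda>v. a)" by (simp add: poly_eval_simps fun_eq_iff)
  then show ?case
    by (intro exI [of _ "\<lambda>i. 0"]) (simp add: poly_eval_insertion)
next
  case (var i)
  have "poly_eval (var3 i) = (\<lambda>v. v $ i)" by (simp add: poly_eval_simps fun_eq_iff)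
  moreover have "((\<lambda>v. v $ i) has_derivative (\<lambda>h. h $ i)) (at v)" for v :: "complex ^ 3"
    by (intro bounded_linear_imp_has_derivative bounded_linear_vec_nth)
  moreover have "(\<Sum>j\<in>UNIV. h $ j * poly_eval (if j = i then 1 else 0) v) = h $ i" for h v
    by (subst sum.mono_neutral_right [of UNIV "{i}"]) (auto simp: poly_eval_insertion insertion_1 coeff_hom_id)
  ultimately show ?case
    by (intro exI [of _ "\<lambda>j. if j = i then 1 else 0"]) simp
next
  case (add F G)
  then obtain D E where
    "\<forall>v. (poly_eval F has_derivative (\<lambda>h. \<Sum>i\<in>UNIV. h $ i * poly_eval (D i) v)) (at v)"
    "\<forall>v. (poly_eval G has_derivative (\<lambda>h. \<Sum>i\<in>UNIV. h $ i * poly_eval (E i) v)) (at v)" by blast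
  then have "((\<lambda>v. poly_eval F v + poly_eval G v) has_derivative
      (\<lambda>h. \<Sum>i\<in>UNIV. h $ i * poly_eval (D i + E i) v)) (at v)" for v
    by (auto intro!: derivative_eq_intros simp: poly_eval_simps distrib_left sum.distrib)
  then show ?case by (intro exI [of _ "\<lambda>i. D i + E i"]) (simp add: poly_eval_simps)
next
  case (mult F G)
  then obtain D E where
    "\<forall>v. (poly_eval F has_derivative (\<lambda>h. \<Sum>i\<in>UNIV. h $ i * poly_eval (D i) v)) (at v)"
    "\<forall>v. (poly_eval G has_derivative (\<lambda>h. \<Sum>i\<in>UNIV. h $ i * poly_eval (E i) v)) (at v)" by blast
  then have "((\<lambda>v. poly_eval F v * poly_eval G v) has_derivative
      (\<lambda>h. poly_eval F v * (\<Sum>i\<in>UNIV. h $ i * poly_eval (E i) v) +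
        (\<Sum>i\<in>UNIV. h $ i * poly_eval (D i) v) * poly_eval G v)) (at v)" for v
    by (intro has_derivative_mult) auto
  moreover have "poly_eval F v * (\<Sum>i\<in>UNIV. h $ i * poly_eval (E i) v) +
        (\<Sum>i\<in>UNIV. h $ i * poly_eval (D i) v) * poly_eval G v =
      (\<Sum>i\<in>UNIV. h $ i * poly_eval (D i * G + F * E i) v)" for h v
    unfolding sum_distrib_left sum_distrib_right sum.distrib [symmetric] poly_eval_simps
    by (intro sum.cong) (simp_all add: algebra_simps)
  ultimately have "((\<lambda>v. poly_eval F v * poly_eval G v) has_derivative
      (\<lambda>h. \<Sum>i\<in>UNIV. h $ i * poly_eval (D i * G + F * E i) v)) (at v)" for v
    by simp
  then show ?case by (intro exI [of _ "\<lambda>i. D i * G + F * E i"]) (simp add: poly_eval_simps)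
qed

definition partial3 :: "ternary_poly \<Rightarrow> 3 \<Rightarrow> ternary_poly" where
  "partial3 F = (SOME D. \<forall>v. (poly_eval F has_derivative (\<lambda>h. \<Sum>i\<in>UNIV. h $ i * poly_eval (D i) v)) (at v))"

lemma poly_eval_has_derivative:
  "(poly_eval F has_derivative (\<lambda>h. \<Sum>i\<in>UNIV. h $ i * poly_eval (partial3 F i) v)) (at v)"
  using someI_ex [OF poly_eval_has_derivative_ex] unfolding partial3_def by blast

lemma continuous_on_poly_eval: "continuous_on S (poly_eval F)"
  by (rule has_derivative_continuous_on [OF has_derivative_at_withinI [OF poly_eval_has_derivative]])

lemma poly_insertion:
  "poly (insertion (\<lambda>c. [:c:]) g F) t = poly_eval F (\<chi> i. poly (g i) t)"
proof -
  have "poly (insertion (\<lambda>c. [:c:]) g F) t = insertion (\<lambda>c. c) (\<lambda>i. poly (g i) t) F"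
    by (rule insertion_hom_comp) (auto simp: coeff_hom_def)
  then show ?thesis by (simp add: poly_eval_insertion)
qed

section \<open>Common zeros of forms\<close>

text \<open>The two polynomials describe \<open>f\<close> in two affine charts. If \<open>p\<close>
  has no zero, it is constant by the fundamental theorem of algebra; homogeneity then makes
  \<open>q\<close> a multiple of \<open>s ^ d\<close>, and the zero lies at
  \<open>(1, 0)\<close>.\<close>

lemma binary_form_zero:
  fixes f :: "complex \<Rightarrow> complex \<Rightarrow> complex"
  assumes "\<And>t. f t 1 = poly p t" "\<And>s. f 1 s = poly q s"
    and hom: "\<And>c a b. f (c * a) (c * b) = c ^ d * f a b" and "d \<ge> 1"
  obtains a b where "(a, b) \<noteq> (0, 0)" "f a b = 0"
proof (cases "\<exists>t. poly p t = 0")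
  case True
  then show ?thesis using that [of _ 1] assms(1) by auto
next
  case False
  then have "constant (poly p)" using fundamental_theorem_of_algebra by blast
  then obtain c where c: "\<And>t. poly p t = c" by (metis constant_def)
  have "poly q s = poly (monom c d) s" if "s \<noteq> 0" for s
  proof -
    have "f 1 s = s ^ d * f (1 / s) 1" using hom [of s "1 / s" 1] that by simp
    then show ?thesis using assms(1,2) c by (simp add: poly_monom mult.commute)
  qed
  then have "- {0} \<subseteq> {s. poly (q - monom c d) s = 0}" by auto
  moreover have "infinite (- {0 :: complex})"
    by (simp add: Compl_eq_Diff_UNIV infinite_UNIV_char_0)
  ultimately have "q - monom c d = 0" using poly_roots_finite infinite_super by blast
  then have "f 1 0 = 0" using assms(2) \<open>d \<ge> 1\<close> by (simp add: poly_monom)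
  then show ?thesis using that [of 1 0] by simp
qed

lemma form_zero_on_line:
  assumes "homogeneous d q" "d \<ge> 1"
  obtains a b where "(a, b) \<noteq> (0, 0)" "poly_eval q (a *s u + b *s w) = 0"
proof (rule binary_form_zero)
  let ?f = "\<lambda>a b. poly_eval q (a *s u + b *s w)"
  show "?f t 1 = poly (insertion (\<lambda>c. [:c:]) (\<lambda>i. [:w $ i, u $ i:]) q) t" for t
    unfolding poly_insertion by (rule arg_cong [of _ _ "poly_eval q"]) (simp add: vec_eq_iff)
  show "?f 1 s = poly (insertion (\<lambda>c. [:c:]) (\<lambda>i. [:u $ i, w $ i:]) q) s" for s
    unfolding poly_insertion by (rule arg_cong [of _ _ "poly_eval q"]) (simp add: vec_eq_iff)
  show "?f (c * a) (c * b) = c ^ d * ?f a b" for a b c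
    by (subst poly_eval_scale [OF assms(1), symmetric])
      (rule arg_cong [of _ _ "poly_eval q"], simp add: vec_eq_iff algebra_simps)
qed (use assms that in auto)

text \<open>The parameter \<open>\<kappa>\<close> embeds the coefficients, so that the bilinear form
  applies to vectors of numbers and of polynomials alike.\<close>

definition quadric :: "(3 \<Rightarrow> 3 \<Rightarrow> complex) \<Rightarrow> (3 \<Rightarrow> 'a) \<Rightarrow> (complex \<Rightarrow> 'a) \<Rightarrow> (3 \<Rightarrow> 'a) \<Rightarrow> 'a::comm_ring_1" where
  "quadric c v \<kappa> w = (\<Sum>i\<in>UNIV. \<Sum>j\<in>UNIV. \<kappa> (c i j) * v i * w j)"

lemma quadratic_form_coeffs:
  assumes "homogeneous 2 p"
  obtains c where "\<And>v. poly_eval p v = quadric c (($) v) (\<lambda>c. c) (($) v)"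
proof -
  have mon: "\<exists>a b. \<forall>v :: complex ^ 3. (\<Prod>i\<in>UNIV. v $ i ^ Poly_Mapping.lookup m i) = v $ a * v $ b"
    if m: "(\<Sum>i\<in>UNIV. Poly_Mapping.lookup m i) = 2" for m :: "3 \<Rightarrow>\<^sub>0 nat"
  proof -
    let ?l = "Poly_Mapping.lookup m"
    have 1: "?l 1 + ?l 2 + ?l 3 = 2" using m by (simp add: sum_3)
    then have "?l 1 = 0 \<or> ?l 1 = 1 \<or> ?l 1 = 2" "?l 2 = 0 \<or> ?l 2 = 1 \<or> ?l 2 = 2" by linarith+
    then have "(?l 1 = 2 \<and> ?l 2 = 0 \<and> ?l 3 = 0) \<or> (?l 1 = 0 \<and> ?l 2 = 2 \<and> ?l 3 = 0) \<or> (?l 1 = 0 \<and> ?l 2 = 0 \<and> ?l 3 = 2)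
      \<or> (?l 1 = 1 \<and> ?l 2 = 1 \<and> ?l 3 = 0) \<or> (?l 1 = 1 \<and> ?l 2 = 0 \<and> ?l 3 = 1) \<or> (?l 1 = 0 \<and> ?l 2 = 1 \<and> ?l 3 = 1)"
      using 1 by (elim disjE) simp_all
    moreover have "(\<Prod>i\<in>UNIV. f i) = f 1 * (f 2 * f 3)" for f :: "3 \<Rightarrow> complex"
      unfolding UNIV_3 by simp
    ultimately show ?thesis
      by (elim disjE) (simp_all add: power2_eq_square, blast+)
  qed
  then obtain a b where ab: "\<And>m v. (\<Sum>i\<in>UNIV. Poly_Mapping.lookup m i) = 2 \<Longrightarrow>
      (\<Prod>i\<in>UNIV. (v :: complex ^ 3) $ i ^ Poly_Mapping.lookup m i) = v $ a m * v $ b m"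
    by metis
  \<comment> \<open>Each monomial of degree 2 contributes to the one ordered pair of indices chosen
    for it.\<close>
  define c where "c i j = (\<Sum>m\<in>Poly_Mapping.keys p. if a m = i \<and> b m = j then Poly_Mapping.lookup p m else 0)" for i j
  have "poly_eval p v = quadric c (($) v) (\<lambda>c. c) (($) v)" for v
  proof -
    have "quadric c (($) v) (\<lambda>c. c) (($) v) = (\<Sum>i\<in>UNIV. \<Sum>j\<in>UNIV. \<Sum>m\<in>Poly_Mapping.keys p.
       (if a m = i \<and> b m = j then Poly_Mapping.lookup p m * v $ i * v $ j else 0))"
      unfolding quadric_def c_def sum_distrib_right by (intro sum.cong) auto
    also have "\<dots> = (\<Sum>m\<in>Poly_Mapping.keys p. \<Sum>i\<in>UNIV. \<Sum>j\<in>UNIV.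
       (if a m = i \<and> b m = j then Poly_Mapping.lookup p m * v $ i * v $ j else 0))"
      by (subst sum.swap, subst (2) sum.swap) (rule refl)
    also have "\<dots> = (\<Sum>m\<in>Poly_Mapping.keys p. Poly_Mapping.lookup p m * v $ a m * v $ b m)"
    proof (rule sum.cong [OF refl])
      fix m
      have "(\<Sum>j\<in>UNIV. if a m = i \<and> b m = j then Poly_Mapping.lookup p m * v $ i * v $ j else 0)
         = (if a m = i then Poly_Mapping.lookup p m * v $ i * v $ b m else 0)" for i
        by simp
      then show "(\<Sum>i\<in>UNIV. \<Sum>j\<in>UNIV. if a m = i \<and> b m = j then Poly_Mapping.lookup p m * v $ i * v $ j else 0)
         = Poly_Mapping.lookup p m * v $ a m * v $ b m"
        by simp
    qed
    also have "\<dots> = poly_eval p v"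
      unfolding poly_eval_def using assms ab
      by (intro sum.cong) (auto simp: homogeneous_def mult.assoc)
    finally show ?thesis ..
  qed
  then show ?thesis using that by blast
qed

lemma quadric_linear:
  "quadric c (\<lambda>i. a * u i + b * w i) \<kappa> v = a * quadric c u \<kappa> v + b * quadric c w \<kappa> v"
  "quadric c v \<kappa> (\<lambda>i. a * u i + b * w i) = a * quadric c v \<kappa> u + b * quadric c v \<kappa> w"
  "quadric c (\<lambda>i. a * u i - b * w i) \<kappa> v = a * quadric c u \<kappa> v - b * quadric c w \<kappa> v"
  "quadric c v \<kappa> (\<lambda>i. a * u i - b * w i) = a * quadric c v \<kappa> u - b * quadric c v \<kappa> w"
  unfolding quadric_def
  by (simp_all add: sum_distrib_left sum.distrib sum_subtractf algebra_simps)

lemma quadric_scale: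
  "quadric c (\<lambda>i. a * u i) \<kappa> v = a * quadric c u \<kappa> v"
  "quadric c v \<kappa> (\<lambda>i. a * u i) = a * quadric c v \<kappa> u"
  using quadric_linear(1,2) [where b = 0 and a = a and u = u and w = u and v = v and c = c and \<kappa> = \<kappa>] by simp_all

lemma poly_quadric:
  "poly (quadric c u (\<lambda>c. [:c:]) w) t = quadric c (\<lambda>i. poly (u i) t) (\<lambda>c. c) (\<lambda>i. poly (w i) t)"
  by (simp add: quadric_def poly_sum mult.assoc)

text \<open>
  The conic \<open>p = 0\<close> is parametrized by the lines through one of its points \<open>P\<close>; the parametrization
  breaks down only along a line contained in the conic.
\<close>

lemma conic_meets_curve:
  assumes p: "homogeneous 2 p" and q: "homogeneous d q" "d \<ge> 1"
  obtains v where "v \<noteq> 0" "poly_eval p v = 0" "poly_eval q v = 0"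
proof -
  obtain c where c: "\<And>v. poly_eval p v = quadric c (($) v) (\<lambda>c. c) (($) v)"
    using quadratic_form_coeffs [OF p] by blast
  obtain r s where rs: "(r, s) \<noteq> (0, 0)" "poly_eval p (r *s axis 1 1 + s *s axis 2 1) = 0"
    using form_zero_on_line [OF p, of "axis 1 1" "axis 2 1"] by auto
  define P :: "complex ^ 3" where "P = r *s axis 1 1 + s *s axis 2 1"
  have "P $ 1 = r" "P $ 2 = s" by (simp_all add: P_def axis_def)
  then obtain k where k: "P $ k \<noteq> 0" using rs(1) by force
  have P: "poly_eval p P = 0" using rs(2) by (simp add: P_def)
  \<comment> \<open>The directions span a complement of \<open>P\<close>, so each line through
    \<open>P\<close> has one of them, up to scaling.\<close>
  obtain u w :: "complex ^ 3" where uw: "u $ k = 0" "w $ k = 0"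
    "\<And>a b. a *s u + b *s w = 0 \<Longrightarrow> a = 0 \<and> b = 0"
  proof -
    obtain i j where ij: "i \<noteq> k" "j \<noteq> k" "i \<noteq> j"
      using exhaust_3 [of k] by (elim disjE) (use that [of 2 3] that [of 1 3] that [of 1 2] in auto)
    show ?thesis
    proof (rule that [of "axis i 1" "axis j 1"])
      show "a = 0 \<and> b = 0" if "a *s axis i 1 + b *s axis j (1::complex) = 0" for a b
      proof -
        have "(a *s axis i 1 + b *s axis j (1::complex)) $ i = a" "(a *s axis i 1 + b *s axis j (1::complex)) $ j = b"
          using ij by (auto simp: axis_def)
        then show ?thesis unfolding that by simp
      qed
    qed (use ij in \<open>auto simp: axis_def\<close>)
  qed
  define D where "D a b = a *s u + b *s w" for a b
  define L where "L a b = quadric c (($) P) (\<lambda>c. c) (($) (D a b)) + quadric c (($) (D a b)) (\<lambda>c. c) (($) P)" for a b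
  define M where "M a b = quadric c (($) (D a b)) (\<lambda>c. c) (($) (D a b))" for a b
  \<comment> \<open>Restricted to the line, \<open>p\<close> is \<open>x (x M + y L)\<close>; the
    zero other than \<open>P\<close> is at \<open>x = L\<close>, \<open>y = - M\<close>.\<close>
  define \<Phi> where "\<Phi> a b = L a b *s D a b - M a b *s P" for a b
  have span: "poly_eval p (x *s D a b + y *s P) = x\<^sup>2 * M a b + x * y * L a b" for x y a b
  proof -
    have "(($) (x *s D a b + y *s P)) = (\<lambda>i. x * D a b $ i + y * P $ i)" by (auto simp: fun_eq_iff)
    then show ?thesis using P
      unfolding c by (simp add: quadric_linear L_def M_def algebra_simps power2_eq_square)
  qed
  have \<Phi>0: "poly_eval p (\<Phi> a b) = 0" for a b
  proof -
    have "\<Phi> a b = L a b *s D a b + (- M a b) *s P" by (simp add: \<Phi>_def vec_eq_iff)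
    then show ?thesis by (simp only: span) (simp add: power2_eq_square algebra_simps)
  qed
  have hom: "\<Phi> (x * a) (x * b) = x ^ 2 *s \<Phi> a b" for x a b
  proof -
    have D: "D (x * a) (x * b) = x *s D a b"
      by (simp add: D_def vec_eq_iff algebra_simps)
    have D': "($) (x *s D a b) = (\<lambda>i. x * D a b $ i)"
      by (simp add: fun_eq_iff)
    have L: "L (x * a) (x * b) = x * L a b"
      unfolding L_def D D' quadric_scale by (simp add: distrib_left)
    have M: "M (x * a) (x * b) = x\<^sup>2 * M a b"
      unfolding M_def D D' quadric_scale by (simp add: power2_eq_square)
    show ?thesis
      unfolding \<Phi>_def L M D by (simp add: vec_eq_iff power2_eq_square algebra_simps)
  qed
  obtain a b where ab: "(a, b) \<noteq> (0, 0)" "poly_eval q (\<Phi> a b) = 0"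
  proof (rule binary_form_zero)
    define \<phi> where "\<phi> D = (let L = quadric c (\<lambda>i. [:P $ i:]) (\<lambda>c. [:c:]) D + quadric c D (\<lambda>c. [:c:]) (\<lambda>i. [:P $ i:]);
       M = quadric c D (\<lambda>c. [:c:]) D in (\<lambda>i. L * D i - M * [:P $ i:]))" for D :: "3 \<Rightarrow> complex poly"
    have \<phi>: "(\<chi> i. poly (\<phi> E i) t) = \<Phi> x y" if "\<And>i. poly (E i) t = D x y $ i" for E t x y
      unfolding \<phi>_def Let_def \<Phi>_def L_def M_def by (simp add: vec_eq_iff poly_quadric that distrib_right)
    show "poly_eval q (\<Phi> t 1) = poly (insertion (\<lambda>c. [:c:]) (\<phi> (\<lambda>i. [:w $ i, u $ i:])) q) t" for t
      unfolding poly_insertion by (subst \<phi> [of _ _ t 1]) (auto simp: D_def)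
    show "poly_eval q (\<Phi> 1 t) = poly (insertion (\<lambda>c. [:c:]) (\<phi> (\<lambda>i. [:u $ i, w $ i:])) q) t" for t
      unfolding poly_insertion by (subst \<phi> [of _ _ 1 t]) (auto simp: D_def)
    show "poly_eval q (\<Phi> (x * a) (x * b)) = x ^ (2 * d) * poly_eval q (\<Phi> a b)" for x a b
      unfolding hom poly_eval_scale [OF q(1)] by (simp add: power_mult)
  qed (use q in auto)
  have indep: "x = 0 \<and> y = 0" if "x *s D a b = y *s P" for x y
  proof -
    have "(x *s D a b) $ k = 0" using uw by (simp add: D_def)
    then have "y = 0" using that k by simp
    then have "(x * a) *s u + (x * b) *s w = 0"
      using that by (simp add: D_def vec_eq_iff algebra_simps)
    then show ?thesis using uw(3) ab(1) \<open>y = 0\<close> by fastforce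
  qed
  show ?thesis
  proof (cases "\<Phi> a b = 0")
    case False
    then show ?thesis using that ab \<Phi>0 by blast
  next
    case True
    then have LM: "L a b = 0" "M a b = 0" using indep by (auto simp: \<Phi>_def)
    obtain x y where xy: "(x, y) \<noteq> (0, 0)" "poly_eval q (x *s D a b + y *s P) = 0"
      using form_zero_on_line [OF q] by blast
    have "x *s D a b + y *s P \<noteq> 0"
    proof
      assume "x *s D a b + y *s P = 0"
      then have "x *s D a b = (- y) *s P" by (simp add: vec_eq_iff add_eq_0_iff)
      then show False using indep xy(1) by fastforce
    qed
    then show ?thesis using that xy span LM by simp
  qed
qed

section \<open>Cuspidal points\<close>

lemma order_decomp_0:
  fixes p :: "complex poly"
  assumes "p \<noteq> 0"
  obtains k r where "p = monom 1 k * r" "poly r 0 \<noteq> 0"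
proof -
  obtain r where "p = [:- 0, 1:] ^ order 0 p * r" "\<not> [:- 0, 1:] dvd r"
    using order_decomp [OF assms, of 0] by blast
  then show ?thesis using that [of "order 0 p" r] by (simp add: monom_altdef dvd_iff_poly_eq_0)
qed

lemma monom_mult_unique:
  fixes r s :: "complex poly"
  assumes "monom 1 k * r = monom 1 l * s" "poly r 0 \<noteq> 0" "poly s 0 \<noteq> 0"
  shows "k = l"
proof -
  have *: "\<not> k < l" if "monom 1 k * r = monom 1 l * s" "poly r 0 \<noteq> 0" for k l and r s :: "complex poly"
  proof
    assume "k < l"
    then have "monom 1 l = monom 1 k * monom 1 (l - k) * (1 :: complex poly)"
      by (simp add: mult_monom)
    then have "monom 1 k * r = monom 1 k * (monom 1 (l - k) * s)"
      using that(1) by simp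
    then have "r = monom 1 (l - k) * s" by simp
    then show False using that(2) \<open>k < l\<close> by (simp add: poly_monom)
  qed
  show ?thesis using * [of k r l s] * [of l s k r] assms by auto
qed

text \<open>The quadratic coefficient forces \<open>p1\<close> and \<open>q1\<close> to be nonzero
  at 0. If \<open>p0\<close> and \<open>q0\<close> have orders \<open>a\<close> and
  \<open>b\<close>, then \<open>a + b = n\<close> is odd, hence \<open>a \<noteq> b\<close>, and
  \<open>p0 q1 + p1 q0\<close> has order exactly \<open>min a b\<close>. This is less than
  \<open>m\<close> because \<open>n < 2 m\<close>.\<close>

lemma cuspidal_not_product:
  fixes p q :: "complex poly poly"
  assumes c: "coeff (p * q) 0 = monom 1 n * W" "poly W 0 \<noteq> 0"
    "coeff (p * q) 1 = monom 1 m * V" "poly (coeff (p * q) 2) 0 \<noteq> 0"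
    and n: "odd n" "n < 2 * m"
    and z: "poly (coeff p 0) 0 = 0" "poly (coeff q 0) 0 = 0"
  shows False
proof -
  define p0 p1 p2 q0 q1 q2 where "p0 = coeff p 0" "p1 = coeff p 1" "p2 = coeff p 2"
    "q0 = coeff q 0" "q1 = coeff q 1" "q2 = coeff q 2"
  note defs = this
  have e0: "p0 * q0 = monom 1 n * W"
    using c(1) by (simp add: coeff_mult defs)
  have e1: "p0 * q1 + p1 * q0 = monom 1 m * V"
    using c(3) by (simp add: coeff_mult defs)
  have "{..2::nat} = {0, 1, 2}" by auto
  then have "coeff (p * q) 2 = p0 * q2 + p1 * q1 + p2 * q0"
    by (simp add: coeff_mult defs numeral_2_eq_2)
  then have "poly p1 0 * poly q1 0 \<noteq> 0" using c(4) z by (simp add: defs)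
  then have u: "poly p1 0 \<noteq> 0" "poly q1 0 \<noteq> 0" by auto
  have "p0 \<noteq> 0" "q0 \<noteq> 0" using e0 c(2) by auto
  then obtain a b p' q' where p': "p0 = monom 1 a * p'" "poly p' 0 \<noteq> 0"
    and q': "q0 = monom 1 b * q'" "poly q' 0 \<noteq> 0"
    by (metis order_decomp_0)
  have "monom 1 (a + b) * (p' * q') = monom 1 n * W"
    using e0 unfolding p'(1) q'(1) by (metis (no_types, lifting) mult.assoc mult.left_commute mult_monom mult_1)
  then have "a + b = n" using monom_mult_unique p' q' c(2) by simp
  have *: False if "x < y" "x + y < 2 * m" "monom 1 x * r * v + w * (monom 1 y * s) = monom 1 m * V" "poly r 0 \<noteq> 0" "poly v 0 \<noteq> 0"
    for x y r s v w
  proof -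
    have "x < m" using that by simp
    have "monom 1 y = monom 1 x * (monom 1 (y - x) :: complex poly)" "monom 1 m = monom 1 x * (monom 1 (m - x) :: complex poly)"
      using \<open>x < m\<close> that(1) by (simp_all add: mult_monom)
    then have "monom 1 x * (r * v + w * (monom 1 (y - x) * s)) = monom 1 x * (monom 1 (m - x) * V)"
      using that(3) by (simp add: algebra_simps)
    then have "r * v + w * (monom 1 (y - x) * s) = monom 1 (m - x) * V" by simp
    then have "poly (r * v + w * (monom 1 (y - x) * s)) 0 = poly (monom 1 (m - x) * V) 0" by simp
    then show False using that \<open>x < m\<close> by (simp add: poly_monom power_0_left)
  qed
  consider "a < b" | "b < a" using \<open>a + b = n\<close> n(1) by (metis even_add linorder_neqE_nat)
  then show False
  proof cases
    case 1
    then show False using * [of a b p' q1 p1 q'] e1 p' q' u \<open>a + b = n\<close> n(2) by simp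
  next
    case 2
    then show False using * [of b a q' p1 q1 p'] e1 p' q' u \<open>a + b = n\<close> n(2)
      by (simp add: algebra_simps)
  qed
qed

text \<open>Comparing orders in the constant coefficient shows that the square of \<open>T\<close>
  divides \<open>p0\<close>. As \<open>q1\<close> does not vanish at 0, the linear coefficient then
  makes \<open>q0\<close> divisible by the m-th power, \<open>m\<close> being at most 4. So the
  order of \<open>q0^2\<close> exceeds \<open>n\<close>, and \<open>p0^3\<close> must have order
  exactly \<open>n\<close>, which is not a multiple of 3. The pairs \<open>n = 5, m = 3\<close> and
  \<open>n = 7, m = 4\<close> occur.\<close>

lemma cuspidal_not_torus:
  fixes p q f :: "complex poly poly"
  assumes c: "coeff f 0 = monom 1 n * W" "poly W 0 \<noteq> 0"
    "coeff f 1 = monom 1 m * V" "poly (coeff f 2) 0 \<noteq> 0"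
    and n: "\<not> 3 dvd n" "n < 2 * m" "4 \<le> n" "m \<le> 4"
    and f: "p ^ 3 + q ^ 2 = f"
    and z: "poly (coeff p 0) 0 = 0" "poly (coeff q 0) 0 = 0"
  shows False
proof -
  define p0 p1 p2 q0 q1 q2 where "p0 = coeff p 0" "p1 = coeff p 1" "p2 = coeff p 2"
    "q0 = coeff q 0" "q1 = coeff q 1" "q2 = coeff q 2"
  note defs = this
  have 2: "{..2::nat} = {0, 1, 2}" by auto
  have e0: "p0 ^ 3 + q0 ^ 2 = monom 1 n * W"
    using c(1) unfolding f [symmetric] by (simp add: coeff_mult defs power3_eq_cube power2_eq_square)
  have e1: "3 * p0\<^sup>2 * p1 + 2 * q0 * q1 = monom 1 m * V"
    using c(3) unfolding f [symmetric]
    by (simp add: coeff_mult defs power3_eq_cube power2_eq_square algebra_simps)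
  have e2: "coeff f 2 = 3 * p0\<^sup>2 * p2 + 3 * p0 * p1\<^sup>2 + q1\<^sup>2 + 2 * q0 * q2"
    unfolding f [symmetric]
    by (simp add: coeff_mult defs power3_eq_cube power2_eq_square numeral_2_eq_2 algebra_simps)
  have "poly q1 0 \<noteq> 0" using c(4) z unfolding e2 by (auto simp: defs)
  have X_dvd: "\<exists>r. g = monom 1 1 * r" if "poly g 0 = 0" for g :: "complex poly"
    using that by (metis dvd_def minus_zero monom_altdef poly_eq_0_iff_dvd power_one_right smult_1_left)
  obtain p' q' where p': "p0 = monom 1 1 * p'" and q': "q0 = monom 1 1 * q'"
    using X_dvd z by (metis defs(1,4))
  have mon: "monom 1 n = monom 1 1 ^ 4 * (monom 1 (n - 4) :: complex poly)"
    using n(3) by (simp only: monom_power mult_monom mult_1 power_one le_add_diff_inverse)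
  have "monom 1 1 ^ 2 * (monom 1 1 * p' ^ 3 + q'\<^sup>2) = monom 1 1 ^ 2 * (monom 1 1 * (monom 1 1 * monom 1 (n - 4)) * W)"
    if "(t * p') ^ 3 + (t * q') ^ 2 = t ^ 4 * N * W" "t = monom 1 1" "N = monom 1 (n - 4)" for t N
  proof -
    have "t ^ 2 * (t * p' ^ 3 + q'\<^sup>2) = (t * p') ^ 3 + (t * q') ^ 2"
      by (simp add: algebra_simps power2_eq_square power3_eq_cube)
    also have "\<dots> = t ^ 2 * (t * (t * N) * W)"
      unfolding that(1) by (simp add: algebra_simps power2_eq_square power4_eq_xxxx)
    finally show ?thesis by (simp only: that(2,3))
  qed
  from this [OF e0 [unfolded p' q' mon] refl refl]
  have 3: "monom 1 1 * p' ^ 3 + q'\<^sup>2 = monom 1 1 * (monom 1 1 * monom 1 (n - 4)) * W"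
    by (rule mult_left_cancel [THEN iffD1, rotated]) simp
  then have "poly (monom 1 1 * p' ^ 3 + q'\<^sup>2) 0 = 0" by (simp add: poly_monom)
  then have "poly q' 0 = 0" by (simp add: poly_monom)
  then obtain q'' where q'': "q' = monom 1 1 * q''" using X_dvd by blast
  have "monom 1 1 * (p' ^ 3 + monom 1 1 * q''\<^sup>2) = monom 1 1 * (monom 1 1 * (monom 1 (n - 4) * W))"
    using 3 unfolding q'' by (simp add: algebra_simps power2_eq_square)
  then have "p' ^ 3 + monom 1 1 * q''\<^sup>2 = monom 1 1 * (monom 1 (n - 4) * W)" by simp
  then have "poly (p' ^ 3 + monom 1 1 * q''\<^sup>2) 0 = poly (monom 1 1 * (monom 1 (n - 4) * W)) 0" by simp
  then have "poly p' 0 = 0" by (simp add: poly_monom)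
  then obtain p'' where "p' = monom 1 1 * p''" using X_dvd by blast
  then have p'': "p0 = monom 1 2 * p''" using p' by (simp add: mult_monom numeral_2_eq_2 flip: mult.assoc)
  obtain q3 where q3: "q0 = monom 1 m * q3"
  proof (cases "q0 = 0")
    case False
    then obtain b r where r: "q0 = monom 1 b * r" "poly r 0 \<noteq> 0" by (rule order_decomp_0)
    have "m \<le> b"
    proof (rule ccontr)
      assume "\<not> m \<le> b"
      then have "monom 1 m = monom 1 b * (monom 1 (m - b) :: complex poly)"
        "p0\<^sup>2 = monom 1 b * (monom 1 (4 - b) * p''\<^sup>2)"
        using n(4) by (simp_all add: mult_monom p'' power_mult_distrib monom_power flip: mult.assoc)
      then have "monom 1 b * (3 * (monom 1 (4 - b) * p''\<^sup>2) * p1 + 2 * r * q1) = monom 1 b * (monom 1 (m - b) * V)"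
        using e1 r(1) by (simp add: algebra_simps)
      then have "3 * (monom 1 (4 - b) * p''\<^sup>2) * p1 + 2 * r * q1 = monom 1 (m - b) * V" by simp
      then have "poly (3 * (monom 1 (4 - b) * p''\<^sup>2) * p1 + 2 * r * q1) 0 = poly (monom 1 (m - b) * V) 0" by simp
      then show False using \<open>\<not> m \<le> b\<close> n(4) r(2) \<open>poly q1 0 \<noteq> 0\<close> by (simp add: poly_monom power_0_left)
    qed
    then have "q0 = monom 1 m * (monom 1 (b - m) * r)" using r by (simp add: mult_monom flip: mult.assoc)
    then show ?thesis using that by blast
  qed (use that [of 0] in simp)
  have "q0\<^sup>2 = monom 1 n * (monom 1 (2 * m - n) * q3\<^sup>2)"
    using n(2) by (simp add: q3 power_mult_distrib monom_power mult_monom mult.commute flip: mult.assoc)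
  then have 4: "p0 ^ 3 = monom 1 n * (W - monom 1 (2 * m - n) * q3\<^sup>2)"
    using e0 by (simp add: algebra_simps eq_diff_eq)
  have 5: "poly (W - monom 1 (2 * m - n) * q3\<^sup>2) 0 \<noteq> 0" using c(2) n(2) by (simp add: poly_monom power_0_left)
  then have "p0 \<noteq> 0" using 4 by auto
  then obtain a r where r: "p0 = monom 1 a * r" "poly r 0 \<noteq> 0" by (rule order_decomp_0)
  then have "monom 1 (3 * a) * r ^ 3 = monom 1 n * (W - monom 1 (2 * m - n) * q3\<^sup>2)"
    using 4 by (simp add: power_mult_distrib monom_power mult.commute)
  then have "3 * a = n" using monom_mult_unique 5 r(2) by simp
  then show False using n(1) by auto
qed

abbreviation bivariate :: "complex \<Rightarrow> complex poly poly" where "bivariate c \<equiv> [:[:c:]:]"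

lemma coeff_hom_bivariate: "coeff_hom bivariate"
  by (simp add: coeff_hom_def one_pCons)

text \<open>
  In local coordinates \<open>X, T\<close> the equation is \<open>X\<^sup>2 U + X T\<^bsup>(n+1)/2\<^esup> V(T) + T\<^sup>n W(T)\<close> with \<open>U, W\<close> invertible;
  for odd \<open>n\<close> this means a singularity of type \<open>A\<^bsub>n-1\<^esub>\<close>.
\<close>

definition cuspidal_at :: "nat \<Rightarrow> ternary_poly \<Rightarrow> complex ^ 3 \<Rightarrow> bool" where
  "cuspidal_at n F v \<longleftrightarrow> (\<exists>\<Gamma> W V. (\<forall>i. poly (coeff (\<Gamma> i) 0) 0 = v $ i) \<and>
     coeff (insertion bivariate \<Gamma> F) 0 = monom 1 n * W \<and> poly W 0 \<noteq> 0 \<and>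
     coeff (insertion bivariate \<Gamma> F) 1 = monom 1 ((n + 1) div 2) * V \<and>
     poly (coeff (insertion bivariate \<Gamma> F) 2) 0 \<noteq> 0)"

lemma insertion_bivariate_eval:
  assumes "\<And>i. poly (coeff (\<Gamma> i) 0) 0 = v $ i"
  shows "poly (coeff (insertion bivariate \<Gamma> G) 0) 0 = poly_eval G v"
proof -
  have "poly (coeff (insertion bivariate \<Gamma> G) 0) 0 = insertion (\<lambda>c. c) (\<lambda>i. poly (coeff (\<Gamma> i) 0) 0) G"
    by (rule insertion_hom_comp) (auto simp: coeff_hom_bivariate coeff_hom_id coeff_mult_0)
  then show ?thesis by (simp add: assms poly_eval_insertion)
qed

lemma cuspidal_at_product:
  assumes "cuspidal_at n (G * K) v" "odd n"
  shows "\<not> (poly_eval G v = 0 \<and> poly_eval K v = 0)"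
proof
  assume GK: "poly_eval G v = 0 \<and> poly_eval K v = 0"
  obtain \<Gamma> W V where \<Gamma>: "\<And>i. poly (coeff (\<Gamma> i) 0) 0 = v $ i"
    "coeff (insertion bivariate \<Gamma> (G * K)) 0 = monom 1 n * W" "poly W 0 \<noteq> 0"
    "coeff (insertion bivariate \<Gamma> (G * K)) 1 = monom 1 ((n + 1) div 2) * V"
    "poly (coeff (insertion bivariate \<Gamma> (G * K)) 2) 0 \<noteq> 0"
    using assms(1) unfolding cuspidal_at_def by auto
  have "n < 2 * ((n + 1) div 2)" using assms(2) by (auto elim: oddE)
  then show False
    using cuspidal_not_product [OF \<Gamma>(2-5) [unfolded insertion_mult [OF coeff_hom_bivariate]]] assms(2) GK \<Gamma>(1)
    by (simp add: insertion_bivariate_eval)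
qed

lemma cuspidal_at_torus:
  assumes "cuspidal_at n F v" "n = 5 \<or> n = 7" "c \<noteq> 0" "const3 c * F = p ^ 3 + q ^ 2"
  shows "\<not> (poly_eval p v = 0 \<and> poly_eval q v = 0)"
proof
  assume pq: "poly_eval p v = 0 \<and> poly_eval q v = 0"
  obtain \<Gamma> W V where \<Gamma>: "\<And>i. poly (coeff (\<Gamma> i) 0) 0 = v $ i"
    and F: "coeff (insertion bivariate \<Gamma> F) 0 = monom 1 n * W" "poly W 0 \<noteq> 0"
    "coeff (insertion bivariate \<Gamma> F) 1 = monom 1 ((n + 1) div 2) * V"
    "poly (coeff (insertion bivariate \<Gamma> F) 2) 0 \<noteq> 0"
    using assms(1) unfolding cuspidal_at_def by auto
  note ch = coeff_hom_bivariate
  have i: "insertion bivariate \<Gamma> (const3 c * F) = smult [:c:] (insertion bivariate \<Gamma> F)"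
    by (simp add: insertion_simps ch)
  show False
  proof (rule cuspidal_not_torus)
    show "insertion bivariate \<Gamma> p ^ 3 + insertion bivariate \<Gamma> q ^ 2 = insertion bivariate \<Gamma> (const3 c * F)"
      unfolding assms(4) by (simp add: insertion_simps ch)
    show "coeff (insertion bivariate \<Gamma> (const3 c * F)) 0 = monom 1 n * (smult c W)"
      "coeff (insertion bivariate \<Gamma> (const3 c * F)) 1 = monom 1 ((n + 1) div 2) * (smult c V)"
      unfolding i coeff_smult F by simp_all
  qed (use assms(2,3) F i pq \<Gamma> in \<open>auto simp: insertion_bivariate_eval\<close>)
qed

lemma insertion_scale:
  assumes "coeff_hom c" "homogeneous d F"
  shows "insertion c (\<lambda>i. a * g i) F = a ^ d * insertion c g F"
  using assms(2)
  by (auto simp: insertion_def homogeneous_def power_mult_distrib prod.distrib sum_distrib_left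
      simp flip: power_sum intro!: sum.cong)

lemma cuspidal_at_scale:
  assumes "cuspidal_at n F v" "homogeneous d F" "a \<noteq> 0"
  shows "cuspidal_at n F (a *s v)"
proof -
  obtain \<Gamma> W V where \<Gamma>: "\<And>i. poly (coeff (\<Gamma> i) 0) 0 = v $ i"
    and F: "coeff (insertion bivariate \<Gamma> F) 0 = monom 1 n * W" "poly W 0 \<noteq> 0"
    "coeff (insertion bivariate \<Gamma> F) 1 = monom 1 ((n + 1) div 2) * V"
    "poly (coeff (insertion bivariate \<Gamma> F) 2) 0 \<noteq> 0"
    using assms(1) unfolding cuspidal_at_def by auto
  have pw: "bivariate a ^ k = bivariate (a ^ k)" for k
    by (induction k) (simp_all add: one_pCons)
  have i: "insertion bivariate (\<lambda>i. bivariate a * \<Gamma> i) F = smult [:a ^ d:] (insertion bivariate \<Gamma> F)"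
    unfolding insertion_scale [OF coeff_hom_bivariate assms(2)] pw by simp
  show ?thesis
    unfolding cuspidal_at_def
    by (rule exI [of _ "\<lambda>i. bivariate a * \<Gamma> i"], rule exI [of _ "smult (a ^ d) W"], rule exI [of _ "smult (a ^ d) V"])
      (simp only: i coeff_smult F(1,3), use F(2,4) \<Gamma> assms(3) in simp)
qed

section \<open>Irreducibility and non-torus criteria\<close>

lemma degree_insertion_line:
  assumes "homogeneous d G"
  shows "degree (insertion (\<lambda>c. [:c:]) (\<lambda>i. [:a $ i, b $ i:]) G) \<le> d"
  unfolding insertion_def
proof (rule degree_sum_le)
  fix m assume m: "m \<in> Poly_Mapping.keys G"
  let ?l = "Poly_Mapping.lookup m"
  have "degree ([:a $ i, b $ i:] ^ k) \<le> k" for i k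
    using degree_power_le [of "[:a $ i, b $ i:]" k] by (simp split: if_splits)
  then have "(\<Sum>i\<in>UNIV. degree ([:a $ i, b $ i:] ^ ?l i)) \<le> (\<Sum>i\<in>UNIV. ?l i)"
    by (intro sum_mono) auto
  moreover have "degree (\<Prod>i\<in>UNIV. [:a $ i, b $ i:] ^ ?l i) \<le> (\<Sum>i\<in>UNIV. degree ([:a $ i, b $ i:] ^ ?l i))"
    using degree_prod_sum_le [of UNIV "\<lambda>i. [:a $ i, b $ i:] ^ ?l i"] by (simp add: comp_def)
  moreover have "(\<Sum>i\<in>UNIV. ?l i) = d" using m assms by (simp add: homogeneous_def)
  ultimately show "degree ([:Poly_Mapping.lookup G m:] * (\<Prod>i\<in>UNIV. [:a $ i, b $ i:] ^ ?l i)) \<le> d"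
    using degree_mult_le [of "[:Poly_Mapping.lookup G m:]" "\<Prod>i\<in>UNIV. [:a $ i, b $ i:] ^ ?l i"] by simp
qed simp

text \<open>
  The line \<open>P + s d\<close> is tangent to the curve at the cuspidal point \<open>P\<close>. Only one factor passes through
  \<open>P\<close>, so it has degree at least 4; the other one, being at most a conic, meets it in a singular point.
\<close>

lemma irreducible_sexticI:
  assumes F: "homogeneous 6 F" "F \<noteq> 0" and "odd n"
    and sing: "\<And>v. v \<noteq> 0 \<Longrightarrow> poly_eval F v = 0 \<Longrightarrow> (poly_eval F has_derivative (\<lambda>_. 0)) (at v) \<Longrightarrow> cuspidal_at n F v"
    and P: "cuspidal_at n F P"
    and tangent: "\<And>s. poly_eval F (P + s *s d) = s ^ 4 * poly g s" "g \<noteq> 0"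
  shows "irreducible F"
proof -
  have const_dvd: "const3 a dvd 1" if "a \<noteq> 0" for a
  proof -
    have "1 = const3 a * const3 (1 / a)" using that by (simp flip: const3_hom)
    then show ?thesis by (rule dvdI)
  qed
  have "\<not> F dvd 1"
  proof
    assume "F dvd 1"
    then obtain G where "1 = F * G" by (elim dvdE)
    then obtain i j where "homogeneous 0 (1 :: ternary_poly)" "homogeneous i F" "i + j = 0"
      using homogeneous_factors [of 0 1 F G] homogeneous_const3 [of 1] by (auto simp: const3_hom)
    then obtain a where "F = const3 a" by (metis add_eq_0_iff_both_eq_0 homogeneous_0_const3)
    have "m = 0" if "m \<in> Poly_Mapping.keys F" for m
      using that \<open>F = const3 a\<close> by (auto simp: const3_def split: if_splits)
    moreover obtain m where "m \<in> Poly_Mapping.keys F"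
      using F(2) by (metis all_not_in_conv keys_eq_empty)
    ultimately have "0 \<in> Poly_Mapping.keys F" by metis
    then show False using F(1) by (auto simp: homogeneous_def)
  qed
  moreover have "G dvd 1 \<or> K dvd 1" if GK: "F = G * K" for G K
  proof (rule ccontr)
    assume nu: "\<not> (G dvd 1 \<or> K dvd 1)"
    \<comment> \<open>The product is singular at a common zero, hence cuspidal there, which
      contradicts the factorization.\<close>
    have no_common: "\<not> (poly_eval G v = 0 \<and> poly_eval K v = 0)" if "v \<noteq> 0" for v
    proof
      assume z: "poly_eval G v = 0 \<and> poly_eval K v = 0"
      have "((\<lambda>v. poly_eval G v * poly_eval K v) has_derivative (\<lambda>_. 0)) (at v)"
        by (rule has_derivative_eq_rhs [OF has_derivative_mult [OF poly_eval_has_derivative poly_eval_has_derivative]])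
          (simp add: z)
      moreover have "poly_eval F = (\<lambda>v. poly_eval G v * poly_eval K v)" by (simp add: GK poly_eval_simps fun_eq_iff)
      ultimately have "cuspidal_at n F v" using sing [OF that] z by simp
      then show False using cuspidal_at_product GK \<open>odd n\<close> z by blast
    qed
    have *: False if GK: "F = G * K" "\<not> G dvd 1" "\<not> K dvd 1" "poly_eval K P \<noteq> 0"
      and no_common: "\<And>v. v \<noteq> 0 \<Longrightarrow> \<not> (poly_eval G v = 0 \<and> poly_eval K v = 0)" for G K
    proof -
      obtain i j where ij: "homogeneous i G" "homogeneous j K" "i + j = 6"
        using homogeneous_factors F GK(1) by blast
      define l where "l = insertion (\<lambda>c. [:c:]) (\<lambda>i. [:P $ i, d $ i:])"
      have l: "poly (l H) s = poly_eval H (P + s *s d)" for H s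
        unfolding l_def poly_insertion by (rule arg_cong [of _ _ "poly_eval H"]) (simp add: vec_eq_iff)
      have "coeff_hom (\<lambda>c :: complex. [:c:])" by (simp add: coeff_hom_def one_pCons)
      then have "l G * l K = l F" by (simp add: GK(1) l_def insertion_mult)
      also have "\<dots> = [:- 0, 1:] ^ 4 * g"
        using tangent by (simp add: poly_eq_poly_eq_iff [symmetric] fun_eq_iff l)
      finally have eq: "l G * l K = [:- 0, 1:] ^ 4 * g" .
      then have nz: "l G * l K \<noteq> 0" using tangent(2) by simp
      then have "order 0 (l G) + order 0 (l K) = order 0 ([:- 0, 1:] ^ 4 * g)"
        using eq by (metis order_mult)
      also have "\<dots> \<ge> 4" using nz unfolding eq
        using order_divides [of 0 4 "[:- 0, 1:] ^ 4 * g"] by simp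
      finally have "order 0 (l G) + order 0 (l K) \<ge> 4" .
      moreover have "poly (l K) 0 \<noteq> 0" using GK(4) by (simp add: l)
      then have "order 0 (l K) = 0" using order_root by blast
      moreover have "order 0 (l G) \<le> degree (l G)" using nz by (intro order_degree) auto
      moreover have "degree (l G) \<le> i" unfolding l_def by (rule degree_insertion_line [OF ij(1)])
      ultimately have i: "i \<ge> 4" by simp
      have "j \<noteq> 0"
      proof
        assume "j = 0"
        then obtain a where "K = const3 a" using ij(2) homogeneous_0_const3 by blast
        then show False using GK(3) const_dvd F(2) GK(1) by (metis const3_hom(4) mult_zero_right)
      qed
      then consider "j = 1" | "j = 2" using ij i by linarith
      \<comment> \<open>A linear factor is squared, which gives a conic with the same zeros.\<close>
      then have "\<exists>k\<in>{1, 2 :: nat}. homogeneous 2 (K ^ k)"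
      proof cases
        case 1
        then have "homogeneous 2 (K ^ 2)" using ij(2) by (auto intro!: homogeneous_power)
        then show ?thesis by blast
      qed (use ij in auto)
      then obtain k where k: "homogeneous 2 (K ^ k)" by blast
      obtain v where "v \<noteq> 0" "poly_eval (K ^ k) v = 0" "poly_eval G v = 0"
        using conic_meets_curve [OF k ij(1)] i by auto
      then show False using no_common by (simp add: poly_eval_simps)
    qed
    have "poly_eval G P \<noteq> 0 \<or> poly_eval K P \<noteq> 0" using P GK \<open>odd n\<close> cuspidal_at_product by blast
    then show False
      using * [of G K] * [of K G] no_common GK nu by (auto simp: mult.commute)
  qed
  ultimately show ?thesis using F(2) by (auto intro!: irreducibleI)
qed

lemma not_torus_typeI:
  assumes sing: "\<And>v. v \<noteq> 0 \<Longrightarrow> poly_eval F v = 0 \<Longrightarrow> (poly_eval F has_derivative (\<lambda>_. 0)) (at v) \<Longrightarrow> cuspidal_at n F v"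
    and n: "n = 5 \<or> n = 7"
  shows "\<not> torus_type F"
proof
  assume "torus_type F"
  then obtain c p q where c: "c \<noteq> 0" "homogeneous 2 p" "homogeneous 3 q" "const3 c * F = p ^ 3 + q ^ 2"
    unfolding torus_type_def by (auto simp: map_times_const3)
  obtain v where v: "v \<noteq> 0" "poly_eval p v = 0" "poly_eval q v = 0"
    using conic_meets_curve [OF c(2,3)] by auto
  have "poly_eval (const3 c * F) w = poly_eval (p ^ 3 + q ^ 2) w" for w by (simp add: c(4))
  then have F: "poly_eval F = (\<lambda>w. (1 / c) * (poly_eval p w ^ 3 + poly_eval q w ^ 2))"
    using c(1) by (simp add: poly_eval_simps fun_eq_iff field_simps)
  have "(poly_eval F has_derivative (\<lambda>_. 0)) (at v)"
    unfolding F
    by (rule derivative_eq_intros poly_eval_has_derivative refl)+ (simp add: v fun_eq_iff)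
  then have "cuspidal_at n F v" using sing [OF v(1)] v by (simp add: F)
  then show False using cuspidal_at_torus n c v by blast
qed

section \<open>Coverings from free actions of finite groups\<close>

text \<open>By \<open>closed\<close>, the complement of a saturated open set has a closed image, so
  \<open>p\<close> is open. A neighbourhood that is small compared with the distances within an
  orbit has disjoint translates, and these are the sheets.\<close>

lemma covering_space_finite_action:
  fixes p :: "'a::metric_space \<Rightarrow> 'b::topological_space" and act :: "'i \<Rightarrow> 'a \<Rightarrow> 'a"
  assumes cont: "continuous_on N p" and img: "p ` N = Y" and fin: "finite I"
    and act: "\<And>i. i \<in> I \<Longrightarrow> continuous_on N (act i)" "\<And>i x. i \<in> I \<Longrightarrow> x \<in> N \<Longrightarrow> act i x \<in> N"
    and unit: "e \<in> I" "\<And>x. x \<in> N \<Longrightarrow> act e x = x"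
    and inv: "\<And>i. i \<in> I \<Longrightarrow> \<exists>j\<in>I. \<forall>x\<in>N. act j (act i x) = x \<and> act i (act j x) = x"
    and free: "\<And>i j x. i \<in> I \<Longrightarrow> j \<in> I \<Longrightarrow> x \<in> N \<Longrightarrow> act i x = act j x \<Longrightarrow> i = j"
    and fibre: "\<And>x y. x \<in> N \<Longrightarrow> y \<in> N \<Longrightarrow> p x = p y \<longleftrightarrow> (\<exists>i\<in>I. y = act i x)"
    and closed: "\<And>K. closedin (top_of_set N) K \<Longrightarrow> closedin (top_of_set Y) (p ` K)"
  shows "covering_space N p Y"
proof (rule covering_spaceI [OF cont img])
  have act_open: "openin (top_of_set N) (act i ` U)" if U0: "openin (top_of_set N) U" and i0: "i \<in> I" for i U
  proof -
    obtain j where j: "j \<in> I" "\<And>x. x \<in> N \<Longrightarrow> act j (act i x) = x \<and> act i (act j x) = x"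
      using inv i0 by blast
    have U: "U \<subseteq> N" using U0 openin_imp_subset by blast
    have "act i ` U = N \<inter> act j -` U"
    proof
      show "act i ` U \<subseteq> N \<inter> act j -` U" using U j act(2) i0 by auto
      show "N \<inter> act j -` U \<subseteq> act i ` U" using j(2) by force
    qed
    then show ?thesis
      using continuous_openin_preimage [OF act(1) [OF j(1)] _ U0] act(2) [OF j(1)] by auto
  qed
  have sat: "N \<inter> p -` (p ` U) = (\<Union>i\<in>I. act i ` U)" if "U \<subseteq> N" for U
    using that fibre act(2) by (auto simp: image_iff) (metis subsetD)+
  have p_open: "openin (top_of_set Y) (p ` U)" if U: "openin (top_of_set N) U" for U
  proof -
    have UN: "U \<subseteq> N" using U openin_imp_subset by blast
    have "openin (top_of_set N) (N \<inter> p -` (p ` U))"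
      unfolding sat [OF UN] using act_open U by blast
    then have "closedin (top_of_set N) (N - (N \<inter> p -` (p ` U)))"
      by (simp add: closedin_def Diff_Diff_Int)
    then have "closedin (top_of_set Y) (p ` (N - (N \<inter> p -` (p ` U))))" by (rule closed)
    moreover have "p ` (N - (N \<inter> p -` (p ` U))) = Y - p ` U" using img by auto
    moreover have "p ` U \<subseteq> Y" using UN img by auto
    ultimately show ?thesis by (simp add: openin_closedin_eq)
  qed
  fix y assume "y \<in> Y"
  then obtain x where x: "x \<in> N" "p x = y" using img by auto
  \<comment> \<open>The element 1 keeps the set nonempty when the group is trivial.\<close>
  define D where "D = insert 1 {dist (act i x) (act j x) | i j. i \<in> I \<and> j \<in> I \<and> i \<noteq> j}"
  have "D \<subseteq> insert 1 ((\<lambda>(i, j). dist (act i x) (act j x)) ` (I \<times> I))" by (auto simp: D_def)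
  then have "finite D" using fin by (meson finite.insertI finite_SigmaI finite_imageI finite_subset)
  moreover have "0 < d" if "d \<in> D" for d using that free x by (auto simp: D_def)
  ultimately have "Min D > 0" by (subst Min_gr_iff) (auto simp: D_def)
  define \<delta> where "\<delta> = Min D / 2"
  have \<delta>: "\<delta> > 0" using \<open>Min D > 0\<close> by (simp add: \<delta>_def)
  have sep: "ball (act i x) \<delta> \<inter> ball (act j x) \<delta> = {}" if "i \<in> I" "j \<in> I" "i \<noteq> j" for i j
  proof -
    have "Min D \<le> dist (act i x) (act j x)" using \<open>finite D\<close> that by (intro Min_le) (auto simp: D_def)
    then show ?thesis by (intro disjoint_ballI) (simp add: \<delta>_def)
  qed
  \<comment> \<open>All translates are controlled at once: \<open>act i\<close> maps
    \<open>U\<close> into the ball around the corresponding orbit point, and these balls are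
    disjoint.\<close>
  define U where "U = (\<Inter>i\<in>I. N \<inter> act i -` ball (act i x) \<delta>)"
  have "openin (top_of_set N) (N \<inter> act i -` ball (act i x) \<delta>)" if "i \<in> I" for i
    using continuous_openin_preimage_gen [OF act(1) [OF that]] by simp
  then have U: "openin (top_of_set N) U"
    unfolding U_def using fin unit(1) by (intro openin_INT2) auto
  have UN: "U \<subseteq> N" using unit(1) by (auto simp: U_def)
  have UW: "act i u \<in> ball (act i x) \<delta>" if "i \<in> I" "u \<in> U" for i u using that unfolding U_def by blast
  have "x \<in> U" using x \<delta> by (auto simp: U_def)
  have disj: "act i ` U \<inter> act j ` U = {}" if "i \<in> I" "j \<in> I" "i \<noteq> j" for i j
  proof -
    have "act i ` U \<subseteq> ball (act i x) \<delta>" "act j ` U \<subseteq> ball (act j x) \<delta>"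
      using UW that by (simp_all only: image_subset_iff) simp_all
    then show ?thesis using sep [OF that] by blast
  qed
  show "\<exists>T. y \<in> T \<and> openin (top_of_set Y) T \<and> (\<exists>v. \<Union> v = N \<inter> p -` T \<and>
      (\<forall>u\<in>v. openin (top_of_set N) u) \<and> pairwise disjnt v \<and> (\<forall>u\<in>v. \<exists>q. homeomorphism u T p q))"
  proof (intro exI [of _ "p ` U"] exI [of _ "(\<lambda>i. act i ` U) ` I"] conjI ballI)
    show "y \<in> p ` U" using \<open>x \<in> U\<close> x by auto
    show "openin (top_of_set Y) (p ` U)" using U by (rule p_open)
    show "\<Union> ((\<lambda>i. act i ` U) ` I) = N \<inter> p -` p ` U" by (simp add: sat [OF UN])
    show "pairwise disjnt ((\<lambda>i. act i ` U) ` I)"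
      using disj unfolding pairwise_def disjnt_def by blast
    fix u assume "u \<in> (\<lambda>i. act i ` U) ` I"
    then obtain i where i: "i \<in> I" "u = act i ` U" by blast
    show u: "openin (top_of_set N) u" using act_open U i by blast
    have p_act: "p (act i a) = p a" if "a \<in> U" for a
    proof -
      have "a \<in> N" "act i a \<in> N" using that UN i act(2) by auto
      then show ?thesis using fibre i(1) by metis
    qed
    show "\<exists>q. homeomorphism u (p ` U) p q"
    proof (rule homeomorphism_injective_open_map [of u p "p ` U"])
      show "continuous_on u p" using cont u continuous_on_subset openin_imp_subset by blast
      show "p ` u = p ` U" using p_act unfolding i image_image by (intro image_cong) auto
      show "inj_on p u"
      proof (rule inj_onI)
        fix a' b' assume "a' \<in> u" "b' \<in> u" "p a' = p b'"
        then obtain a b where ab: "a \<in> U" "b \<in> U" "a' = act i a" "b' = act i b" "p a = p b"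
          using p_act unfolding i by auto
        then obtain k where k: "k \<in> I" "b = act k a" using fibre UN by blast
        have "b = act e b" using unit ab UN by auto
        then have "k = e" using disj [OF k(1) unit(1)] k ab by blast
        then show "a' = b'" using k ab unit UN by auto
      qed
      show "openin (top_of_set (p ` U)) (p ` W)" if "openin (top_of_set u) W" for W
      proof -
        have "openin (top_of_set N) W" using that u openin_trans by blast
        then have "openin (top_of_set Y) (p ` W)" by (rule p_open)
        moreover have "p ` W \<subseteq> p ` U" using \<open>p ` u = p ` U\<close> openin_imp_subset [OF that] by blast
        moreover have "p ` U \<subseteq> Y" using UN img by auto
        ultimately show ?thesis using openin_subset_trans by blast
      qed
    qed blast
  qed
qed

section \<open>Singularities of type A\<close>

lemma has_derivative_vec_lambda:
  fixes f :: "'n::finite \<Rightarrow> 'a::real_normed_vector \<Rightarrow> 'b::euclidean_space"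
  assumes "\<And>i. (f i has_derivative f' i) (at x)"
  shows "((\<lambda>x. \<chi> i. f i x) has_derivative (\<lambda>h. \<chi> i. f' i h)) (at x)"
proof (rule has_derivative_componentwise_within [THEN iffD2], rule ballI)
  fix b :: "'b ^ 'n" assume "b \<in> Basis"
  then obtain i u where "b = axis i u" by (auto simp: Basis_vec_def)
  then show "((\<lambda>x. (\<chi> i. f i x) \<bullet> b) has_derivative (\<lambda>h. (\<chi> i. f' i h) \<bullet> b)) (at x)"
    by (simp add: inner_axis) (rule has_derivative_inner_left [OF assms])
qed

text \<open>
  Where \<open>B \<noteq> 0\<close>, the identity \<open>A\<^sup>2 - B\<^sup>2 F = H\<^sup>n\<close> becomes the normal form of \<open>A\<^bsub>n-1\<^esub>\<close> in the local
  coordinates \<open>(A, -H)\<close>.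
\<close>

lemma has_singularity_type_A:
  fixes v a b :: "complex ^ 3"
  assumes id: "\<And>w. (poly_eval A w)\<^sup>2 - (poly_eval B w)\<^sup>2 * poly_eval F w = poly_eval H w ^ n" and "odd n"
    and v: "v \<noteq> 0" "vec.span {v, a, b} = UNIV"
    and z: "poly_eval A v = 0" "poly_eval H v = 0" "poly_eval B v \<noteq> 0"
    and DA: "((\<lambda>t. poly_eval A (v + t *s a)) has_field_derivative \<alpha>) (at 0)"
      "((\<lambda>t. poly_eval A (v + t *s b)) has_field_derivative \<beta>) (at 0)"
    and DH: "((\<lambda>t. poly_eval H (v + t *s a)) has_field_derivative \<gamma>) (at 0)"
      "((\<lambda>t. poly_eval H (v + t *s b)) has_field_derivative \<delta>) (at 0)"
    and det: "\<alpha> * \<delta> \<noteq> \<beta> * \<gamma>"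
  shows "has_singularity_type F (proj v) (A_type (n - 1))"
proof -
  define L where "L z = v + z $ 1 *s a + z $ 2 *s b" for z :: "complex ^ 2"
  define d where "d G z h = (\<Sum>i\<in>UNIV. (h $ 1 * a $ i + h $ 2 * b $ i) * poly_eval (partial3 G i) (L z))"
    for G and z h :: "complex ^ 2"
  have L: "(L has_derivative (\<lambda>h. h $ 1 *s a + h $ 2 *s b)) (at z)" for z
  proof -
    have "((\<lambda>z. \<chi> i. v $ i + z $ 1 * a $ i + z $ 2 * b $ i) has_derivative (\<lambda>h. \<chi> i. h $ 1 * a $ i + h $ 2 * b $ i)) (at z)"
      by (rule has_derivative_vec_lambda)
        (auto intro!: derivative_eq_intros bounded_linear.has_derivative [OF bounded_linear_vec_nth])
    moreover have "L = (\<lambda>z. \<chi> i. v $ i + z $ 1 * a $ i + z $ 2 * b $ i)" by (simp add: L_def fun_eq_iff vec_eq_iff)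
    moreover have "(\<lambda>h :: complex ^ 2. h $ 1 *s a + h $ 2 *s b) = (\<lambda>h. \<chi> i. h $ 1 * a $ i + h $ 2 * b $ i)"
      by (simp add: fun_eq_iff vec_eq_iff)
    ultimately show ?thesis by simp
  qed
  have d: "((\<lambda>z. poly_eval G (L z)) has_derivative d G z) (at z)" for G z
    using has_derivative_compose [OF L [of z] poly_eval_has_derivative [of G "L z"]] by (simp add: d_def [abs_def])
  have d_scale: "d G z (c *s h) = c * d G z h" for G z c h
    unfolding d_def sum_distrib_left by (intro sum.cong) (simp_all add: algebra_simps)
  have d_cont: "continuous_on UNIV (\<lambda>z. d G z h)" for G h
  proof -
    have "continuous_on UNIV L" by (rule has_derivative_continuous_on [OF has_derivative_at_withinI [OF L]])
    then have "continuous_on UNIV (\<lambda>z. poly_eval K (L z))" for K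
      using continuous_on_compose2 [OF continuous_on_poly_eval [of UNIV K]] by blast
    then show ?thesis unfolding d_def by (intro continuous_intros)
  qed
  \<comment> \<open>As \<open>n\<close> is odd, the sign turns \<open>A^2 - H^n\<close> into the sum
    in the normal form.\<close>
  define f where "f z = (\<chi> i :: 2. if i = 1 then poly_eval A (L z) else - poly_eval H (L z))" for z
  define f' where "f' z h = (\<chi> i :: 2. if i = 1 then d A z h else - d H z h)" for z h
  have f: "(f has_derivative f' z) (at z)" for z
    unfolding f_def [abs_def] f'_def [abs_def]
  proof (rule has_derivative_vec_lambda)
    show "((\<lambda>z. if i = 1 then poly_eval A (L z) else - poly_eval H (L z)) has_derivative
      (\<lambda>h. if i = 1 then d A z h else - d H z h)) (at z)" for i :: 2
      by (cases "i = 1") (auto intro!: d has_derivative_minus)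
  qed
  then have bl: "bounded_linear (f' z)" for z by (rule has_derivative_bounded_linear)
  have f'_scale: "f' z (c *s h) = c *s f' z h" for z c h
    by (simp add: f'_def d_scale vec_eq_iff)
  have L0: "L 0 = v" by (simp add: L_def)
  have "f 0 = 0" by (simp add: f_def L0 z vec_eq_iff)
  have d0: "d G 0 h = h $ 1 * d1 + h $ 2 * d2"
    if "((\<lambda>t. poly_eval G (v + t *s a)) has_field_derivative d1) (at 0)"
      "((\<lambda>t. poly_eval G (v + t *s b)) has_field_derivative d2) (at 0)" for G h d1 d2
  proof -
    let ?p = "\<lambda>c. \<Sum>i\<in>UNIV. c $ i * poly_eval (partial3 G i) v"
    have "((\<lambda>t. poly_eval G (v + t *s c)) has_field_derivative ?p c) (at 0)" for c
    proof -
      have "((\<lambda>t. \<chi> i. v $ i + t * c $ i) has_derivative (\<lambda>t. \<chi> i. t * c $ i)) (at 0)"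
        by (rule has_derivative_vec_lambda) (auto intro!: derivative_eq_intros)
      moreover have "(\<lambda>t. v + t *s c) = (\<lambda>t. \<chi> i. v $ i + t * c $ i)" by (simp add: fun_eq_iff vec_eq_iff)
      ultimately have 1: "((\<lambda>t. v + t *s c) has_derivative (\<lambda>t. \<chi> i. t * c $ i)) (at 0)" by simp
      have "((\<lambda>t. poly_eval G (v + t *s c)) has_derivative
        (\<lambda>t. \<Sum>i\<in>UNIV. (\<chi> i. t * c $ i) $ i * poly_eval (partial3 G i) (v + 0 *s c))) (at 0)"
        by (rule has_derivative_compose [OF 1 poly_eval_has_derivative])
      then show ?thesis
        by (simp add: has_field_derivative_def sum_distrib_left [symmetric] mult.assoc mult_commute_abs)
    qed
    then have "d1 = ?p a" "d2 = ?p b" using that DERIV_unique by blast+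
    then show ?thesis
      unfolding d_def L0 by (simp add: sum_distrib_left sum.distrib distrib_right mult.assoc)
  qed
  have inj: "h = 0" if "f' 0 h = 0" for h
  proof -
    have "f' 0 h $ 1 = 0" "f' 0 h $ 2 = 0" using that by simp_all
    then have "h $ 1 * \<alpha> + h $ 2 * \<beta> = 0" "h $ 1 * \<gamma> + h $ 2 * \<delta> = 0"
      by (simp_all add: f'_def d0 [OF DA] d0 [OF DH]) (metis add.right_inverse)
    then have "h $ 1 * (\<alpha> * \<delta> - \<beta> * \<gamma>) = 0" "h $ 2 * (\<alpha> * \<delta> - \<beta> * \<gamma>) = 0" by algebra+
    then show ?thesis using det by (simp add: vec_eq_iff forall_2)
  qed
  have lin: "linear (f' 0)" using bl bounded_linear.linear by blast
  then have "inj (f' 0)" using inj linear_injective_0 by blast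
  then obtain k where k: "linear k" "k \<circ> f' 0 = id" using linear_injective_left_inverse lin by blast
  have blk: "bounded_linear k" using k(1) linear_conv_bounded_linear by blast
  define f'' where "f'' z = Blinfun (f' z)" for z
  have f'': "blinfun_apply (f'' z) = f' z" for z by (simp add: f''_def bounded_linear_Blinfun_apply bl)
  define W where "W = {z. poly_eval B (L z) \<noteq> 0}"
  have contBL: "continuous_on UNIV (\<lambda>z. poly_eval B (L z))"
    by (rule has_derivative_continuous_on [OF has_derivative_at_withinI [OF d]])
  have "open W" unfolding W_def
    using open_Collect_neq [OF contBL continuous_on_const] by simp
  have "0 \<in> W" by (simp add: W_def L0 z)
  have c'': "continuous_on W f''"
  proof (rule continuous_on_blinfun_componentwise)
    fix i :: "complex ^ 2"
    have "continuous_on W (\<lambda>z. if j = 1 then d A z i else - d H z i)" for j :: 2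
      by (cases "j = 1") (auto intro!: continuous_intros continuous_on_subset [OF d_cont])
    then have "continuous_on W (\<lambda>z. f' z i)"
      unfolding f'_def by (rule continuous_on_vec_lambda)
    then show "continuous_on W (\<lambda>z. f'' z i)" by (simp add: f'')
  qed
  have inv0: "Blinfun k o\<^sub>L f'' 0 = id_blinfun"
  proof (rule blinfun_eqI)
    show "(Blinfun k o\<^sub>L f'' 0) i = id_blinfun i" for i
      using fun_cong [OF k(2), of i] by (simp add: f'' bounded_linear_Blinfun_apply blk)
  qed
  have der: "\<And>z. z \<in> W \<Longrightarrow> (f has_derivative blinfun_apply (f'' z)) (at z)"
    by (simp add: f'' f)
  obtain U V g g' where UV: "open U" "U \<subseteq> W" "0 \<in> U" "open V" "f 0 \<in> V" "homeomorphism U V f g"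
    "\<And>y. y \<in> V \<Longrightarrow> (g has_derivative g' y) (at y)"
    "\<And>y. y \<in> V \<Longrightarrow> g' y = inv_into UNIV (blinfun_apply (f'' (g y)))"
    "\<And>y. y \<in> V \<Longrightarrow> bij (blinfun_apply (f'' (g y)))"
  proof (rule inverse_function_theorem [OF \<open>open W\<close> der c'' \<open>0 \<in> W\<close> inv0])
    fix U V g g'
    assume *: "open U" "U \<subseteq> W" "0 \<in> U" "open V" "f 0 \<in> V" "homeomorphism U V f g"
      "\<And>y. y \<in> V \<Longrightarrow> (g has_derivative g' y) (at y)"
      "\<And>y. y \<in> V \<Longrightarrow> g' y = inv_into UNIV (blinfun_apply (f'' (g y)))"
      "\<And>y. y \<in> V \<Longrightarrow> bij (blinfun_apply (f'' (g y)))"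
    show thesis by (rule that [OF *])
  qed
  \<comment> \<open>The inverse function theorem speaks of real derivatives; the inverse of a
    complex linear bijection is again complex linear.\<close>
  have g'_scale: "g' y (c *s h) = c *s g' y h" if "y \<in> V" for y c h
  proof -
    have b: "bij (f' (g y))" and g': "g' y = inv_into UNIV (f' (g y))" using UV(8,9) that by (simp_all add: f'')
    have "f' (g y) (c *s g' y h) = c *s h"
      using b by (simp add: f'_scale g' bij_is_surj surj_f_inv_f)
    then show ?thesis using b g' by (metis bij_inv_eq_iff)
  qed
  have g_in: "g y \<in> U" "f (g y) = y" if "y \<in> V" for y
    using UV(6) that by (auto simp: homeomorphism_def)
  have hol: "holomorphic_fun_on (\<lambda>y. g y $ i) V" for i
    unfolding holomorphic_fun_on_def
  proof (intro conjI ballI exI)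
    show "open V" by fact
    fix y assume y: "y \<in> V"
    show "((\<lambda>y. g y $ i) has_derivative (\<lambda>h. g' y h $ i)) (at y)"
      by (intro bounded_linear.has_derivative [OF bounded_linear_vec_nth] UV(7) y)
    show "\<forall>c h. g' y (c *s h) $ i = c * g' y h $ i" by (simp add: g'_scale y)
  qed
  have "holomorphic_fun_on (\<lambda>z. f z $ i) U" for i
    unfolding holomorphic_fun_on_def
  proof (intro conjI ballI exI)
    show "open U" by fact
    show "((\<lambda>z. f z $ i) has_derivative (\<lambda>h. f' z h $ i)) (at z)" for z
      by (intro bounded_linear.has_derivative [OF bounded_linear_vec_nth] f)
    show "\<forall>c h. f' z (c *s h) $ i = c * f' z h $ i" for z by (simp add: f'_scale)
  qed
  then have bihol: "biholomorphic_between g V U"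
    unfolding biholomorphic_between_def using hol UV(6) homeomorphism_sym by blast
  have "g 0 = 0" using UV(3,6) \<open>f 0 = 0\<close> by (metis homeomorphism_def)
  have B0: "poly_eval B (L (g y)) \<noteq> 0" if "y \<in> V" for y
    using g_in(1) [OF that] UV(2) by (auto simp: W_def)
  define u where "u y = inverse ((poly_eval B (L (g y)))\<^sup>2)" for y
  have u_hol: "holomorphic_fun_on u V"
    unfolding holomorphic_fun_on_def
  proof (intro conjI ballI)
    show "open V" by fact
    fix y assume y: "y \<in> V"
    have 1: "((\<lambda>y. poly_eval B (L (g y))) has_derivative (\<lambda>h. d B (g y) (g' y h))) (at y)"
      by (rule has_derivative_compose [OF UV(7) [OF y] d])
    have 2: "(u has_derivative (\<lambda>h. - (inverse ((poly_eval B (L (g y)))\<^sup>2) *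
        (of_nat 2 * d B (g y) (g' y h) * poly_eval B (L (g y)) ^ (2 - 1)) * inverse ((poly_eval B (L (g y)))\<^sup>2)))) (at y)"
      unfolding u_def [abs_def]
      by (rule Deriv.has_derivative_inverse [OF _ has_derivative_power [OF 1]]) (simp add: B0 [OF y])
    show "\<exists>D. (u has_derivative D) (at y) \<and> (\<forall>c h. D (c *s h) = c * D h)"
      by (rule exI, rule conjI, rule 2) (simp add: g'_scale y d_scale)
  qed
  have germ: "poly_eval F (L (g y)) = u y * normal_form (A_type (n - 1)) y" if "y \<in> V" for y
  proof -
    have y: "f (g y) = y" using g_in(2) that .
    have "y $ 1 = poly_eval A (L (g y))" "y $ 2 = - poly_eval H (L (g y))"
      by (subst y [symmetric], simp add: f_def)+
    moreover have "n - 1 + 1 = n" using \<open>odd n\<close> by (cases n) auto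
    ultimately have "normal_form (A_type (n - 1)) y = (poly_eval A (L (g y)))\<^sup>2 - poly_eval H (L (g y)) ^ n"
      using \<open>odd n\<close> by simp
    also have "\<dots> = (poly_eval B (L (g y)))\<^sup>2 * poly_eval F (L (g y))" using id [of "L (g y)"] by (simp add: algebra_simps)
    finally show ?thesis using B0 [OF that] by (simp add: u_def)
  qed
  have "equivalent_germs (\<lambda>z. poly_eval F (L z)) (normal_form (A_type (n - 1)))"
    unfolding equivalent_germs_def
    using UV(5) \<open>f 0 = 0\<close> bihol \<open>g 0 = 0\<close> u_hol germ B0
    by (intro exI [of _ V] exI [of _ U] exI [of _ g] exI [of _ u]) (auto simp: u_def)
  then show ?thesis
    unfolding has_singularity_type_def L_def using v by blast
qed

section \<open>The dihedral covering\<close>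

definition unit_root :: "nat \<Rightarrow> int \<Rightarrow> complex" where
  "unit_root n a = cis (2 * pi * of_int a / of_nat n)"

lemma unit_root_add: "unit_root n (a + b) = unit_root n a * unit_root n b"
  by (simp add: unit_root_def cis_mult ring_distribs add_divide_distrib)

lemma unit_root_0 [simp]: "unit_root n 0 = 1"
  by (simp add: unit_root_def)

lemma unit_root_neq_0 [simp]: "unit_root n a \<noteq> 0"
  by (simp add: unit_root_def)

lemma unit_root_inverse [simp]: "unit_root n a * unit_root n (- a) = 1" "unit_root n (- a) * unit_root n a = 1"
  by (simp_all flip: unit_root_add)

lemma unit_root_power: "n > 0 \<Longrightarrow> unit_root n a ^ n = 1"
proof -
  assume "n > 0"
  have "unit_root n a ^ n = cis (real n * (2 * pi * of_int a / of_nat n))"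
    unfolding unit_root_def by (rule Complex.DeMoivre)
  also have "\<dots> = cis (2 * pi * of_int a)" using \<open>n > 0\<close> by simp
  finally show ?thesis by (simp only: cis_multiple_2pi Ints_of_int)
qed

lemma unit_root_period: "n > 0 \<Longrightarrow> unit_root n (int n * k) = 1"
proof -
  assume "n > 0"
  then have "2 * pi * of_int (int n * k) / of_nat n = 2 * pi * of_int k" by simp
  then have "unit_root n (int n * k) = cis (2 * pi * of_int k)" by (simp only: unit_root_def)
  then show ?thesis by (simp only: cis_multiple_2pi Ints_of_int)
qed

lemma unit_root_mod: "n > 0 \<Longrightarrow> unit_root n (a mod int n) = unit_root n a"
  by (metis mult_div_mod_eq mult_1 unit_root_add unit_root_period)

lemma unit_root_neg_mod: "n > 0 \<Longrightarrow> unit_root n (- (a mod int n)) = unit_root n (- a)"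
  by (metis mod_minus_eq unit_root_mod)

lemma unit_root_inj:
  assumes "unit_root n a = unit_root n b" "a \<in> {0..<int n}" "b \<in> {0..<int n}"
  shows "a = b"
proof -
  obtain k l where kl: "a = int k" "b = int l" "k < n" "l < n"
    using assms(2,3) by (metis atLeastLessThan_iff nat_0_le zless_nat_eq_int_zless of_nat_less_iff)
  then show ?thesis
    using bij_betw_imp_inj_on [OF Complex.bij_betw_roots_unity [of n]] assms(1)
    by (auto simp: unit_root_def inj_on_def)
qed

lemma unit_root_surj:
  assumes "z ^ n = 1" "n > 0" obtains a where "a \<in> {0..<int n}" "z = unit_root n a"
proof -
  have "z \<in> (\<lambda>k. cis (2 * pi * real k / real n)) ` {..<n}"
    using bij_betw_imp_surj_on [OF Complex.bij_betw_roots_unity [of n]] assms by simp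
  then obtain k where "k < n" "z = cis (2 * pi * real k / real n)" by auto
  then show ?thesis using that [of "int k"] by (simp add: unit_root_def)
qed

text \<open>These forms of degree 6 separate vectors up to sixth roots of unity:
  \<open>v $ i ^ 6\<close> fixes a nonzero coordinate up to such a root, and
  \<open>v $ i ^ 5 * v $ j\<close> fixes the ratios to it. Divided by a sextic form they are
  functions on the complement.\<close>

definition sextic_coords :: "complex ^ 3 \<Rightarrow> complex ^ 3 ^ 3" where
  "sextic_coords v = (\<chi> i j. v $ i ^ 5 * v $ j)"

lemma sextic_coords_scale: "sextic_coords (c *s v) = (\<chi> i j. c ^ 6 * sextic_coords v $ i $ j)"
  by (simp add: sextic_coords_def vec_eq_iff power_mult_distrib eval_nat_numeral algebra_simps)

lemma sextic_coords_eq: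
  assumes "sextic_coords v = sextic_coords w" "v \<noteq> 0"
  obtains c where "c ^ 6 = 1" "w = c *s v"
proof -
  have eq: "v $ i ^ 5 * v $ j = w $ i ^ 5 * w $ j" for i j
    using assms(1) by (auto simp: sextic_coords_def vec_eq_iff)
  obtain i where i: "v $ i \<noteq> 0" using assms(2) by (auto simp: vec_eq_iff)
  then have wi: "w $ i \<noteq> 0" using eq [of i i] by auto
  define c where "c = w $ i / v $ i"
  have c: "c ^ 6 = 1" using eq [of i i] i wi by (simp add: c_def power_divide eval_nat_numeral mult_ac)
  have "w $ j = c * v $ j" for j
  proof -
    have "w $ i ^ 5 * w $ j = v $ i ^ 5 * v $ j" using eq by simp
    also have "\<dots> = (c ^ 6 * v $ i ^ 5) * v $ j" using c by simp
    also have "\<dots> = w $ i ^ 5 * (c * v $ j)" using i by (simp add: c_def field_simps eval_nat_numeral)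
    finally show ?thesis using wi by simp
  qed
  then show ?thesis using that c by (simp add: vec_eq_iff)
qed

lemma continuous_on_vscale [continuous_intros]:
  fixes g :: "'a::topological_space \<Rightarrow> complex ^ 'n"
  assumes "continuous_on S f" "continuous_on S g"
  shows "continuous_on S (\<lambda>x. f x *s g x)"
  unfolding vector_scalar_mult_def by (intro continuous_intros assms)

lemma continuous_on_sextic_coords: "continuous_on S sextic_coords"
  unfolding sextic_coords_def [abs_def] by (intro continuous_intros)

lemma power_6_eq_1:
  fixes u :: "'a::idom"
  assumes "u ^ 3 = 1 \<or> u ^ 3 = - 1" shows "u ^ 6 = 1"
proof -
  have "(u ^ 3)\<^sup>2 = 1" using assms by (simp only: power2_eq_1_iff)
  then show ?thesis by (simp flip: power_mult)
qed

lemma power_bound: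
  fixes t K :: real
  assumes "0 \<le> t" "t ^ n \<le> K" "n > 0"
  shows "t \<le> K + 1"
proof (cases "t \<le> 1")
  case True
  have "0 \<le> K" using assms by (meson order_trans zero_le_power)
  then show ?thesis using True by simp
next
  case False
  then have "t \<le> t ^ n" using assms(3) by (intro self_le_power) auto
  then show ?thesis using assms(2) by simp
qed

text \<open>
  The scaling by cube roots of unity reflects that \<open>F = 1\<close> determines a representative of a point
  only up to sixth roots of unity.
\<close>

definition dihedral_act :: "nat \<Rightarrow> (int \<times> bool) \<times> int \<Rightarrow>
    (complex ^ 3) \<times> complex \<times> complex \<Rightarrow> (complex ^ 3) \<times> complex \<times> complex" where
  "dihedral_act n = (\<lambda>((a, s), j) (v, z, z').
     let u = (if s then - unit_root 3 j else unit_root 3 j)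
     in (u *s v, u * unit_root n a * (if s then z' else z), u * unit_root n (- a) * (if s then z else z')))"

locale dihedral_cover =
  fixes n :: nat and F A B H :: "complex ^ 3 \<Rightarrow> complex"
  assumes n3: "3 \<le> n"
    and cont: "continuous_on UNIV F" "continuous_on UNIV A" "continuous_on UNIV B" "continuous_on UNIV H"
    and hom: "\<And>c v. F (c *s v) = c ^ 6 * F v" "\<And>c v. A (c *s v) = c ^ n * A v"
      "\<And>c v. B (c *s v) = c ^ (n - 3) * B v" "\<And>c v. H (c *s v) = c ^ 2 * H v"
    and identity: "\<And>v. (A v)\<^sup>2 - (B v)\<^sup>2 * F v = H v ^ n"
    and no_common_zero: "\<And>v. B v = 0 \<Longrightarrow> H v = 0 \<Longrightarrow> F v = 0"
begin

abbreviation "D \<equiv> dihedral_group n"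
abbreviation "act \<equiv> dihedral_act n"

definition cover :: "((complex ^ 3) \<times> complex \<times> complex) set" where
  "cover = {(v, z, z'). F v = 1 \<and> z ^ n = A v + B v \<and> z' ^ n = A v - B v \<and> z * z' = H v}"

definition p :: "(complex ^ 3) \<times> complex \<times> complex \<Rightarrow> complex ^ 3 ^ 3" where
  "p x = sextic_coords (fst x)"

definition base :: "(complex ^ 3 ^ 3) set" where "base = p ` cover"

abbreviation indices :: "((int \<times> bool) \<times> int) set" where
  "indices \<equiv> carrier D \<times> {0..<3}"

lemma carrier_D: "carrier D = {0..<int n} \<times> UNIV"
  by (simp add: dihedral_group_def)

lemma mult_D: "(a, s) \<otimes>\<^bsub>D\<^esub> (b, t) = ((if s then a - b else a + b) mod int n, s \<noteq> t)"
  by (simp add: dihedral_group_def)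

lemma group_D: "group D" using n3 by (intro group_dihedral_group) simp

lemma n_pos: "n > 0" using n3 by simp

section \<open>The action on the covering space and its orbits\<close>

lemma cover_nonzero:
  assumes "(v, z, z') \<in> cover"
  shows "v \<noteq> 0" "z \<noteq> 0 \<or> z' \<noteq> 0"
proof -
  have "F 0 = 0" using hom(1) [of 0 0] by simp
  then show "v \<noteq> 0" using assms by (auto simp: cover_def)
  show "z \<noteq> 0 \<or> z' \<noteq> 0"
  proof (rule ccontr)
    assume "\<not> (z \<noteq> 0 \<or> z' \<noteq> 0)"
    then have "A v + B v = 0" "A v - B v = 0" "H v = 0" "F v = 1"
      using assms n_pos by (auto simp: cover_def power_0_left)
    then have "2 * B v = 0" by algebra
    then show False using no_common_zero [of v] \<open>H v = 0\<close> \<open>F v = 1\<close> by simp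
  qed
qed

text \<open>As the degrees of \<open>A\<close> and \<open>B\<close> differ by 3, scaling by
  \<open>u\<close> keeps the factors \<open>A + B\<close> and \<open>A - B\<close> up to
  \<open>u ^ n\<close> if \<open>u ^ 3 = 1\<close>, and exchanges them if
  \<open>u ^ 3 = - 1\<close>.\<close>

lemma scaled:
  assumes "u ^ 3 = 1 \<or> u ^ 3 = - 1" "F v = 1"
  shows "F (u *s v) = 1" "A (u *s v) = u ^ n * A v" "B (u *s v) = u ^ 3 * u ^ n * B v"
    "H (u *s v) = u\<^sup>2 * H v"
proof -
  have u6: "u ^ 6 = 1" using assms(1) by (rule power_6_eq_1)
  then show "F (u *s v) = 1" using hom(1) assms(2) by simp
  have "u ^ 3 * u ^ n = u ^ 6 * u ^ (n - 3)"
    using n3 by (simp flip: power_add)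
  then show "B (u *s v) = u ^ 3 * u ^ n * B v" using u6 hom(3) by simp
qed (simp_all add: hom)

lemma unit_root_3: "unit_root 3 j ^ 3 = 1" "(- unit_root 3 j) ^ 3 = - 1"
  using unit_root_power [of 3 j] by (simp_all add: power_minus_odd)

lemma act_in_cover: "x \<in> cover \<Longrightarrow> act i x \<in> cover"
proof -
  assume x: "x \<in> cover"
  obtain v z z' where xv: "x = (v, z, z')" by (cases x)
  obtain a s j where i: "i = ((a, s), j)" by (metis surj_pair)
  define u where "u = (if s then - unit_root 3 j else unit_root 3 j)"
  have u: "u ^ 3 = (if s then - 1 else 1)" using unit_root_3 by (simp add: u_def)
  have cov: "F v = 1" "z ^ n = A v + B v" "z' ^ n = A v - B v" "z * z' = H v"
    using x by (auto simp: xv cover_def)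
  have "u ^ 3 = 1 \<or> u ^ 3 = - 1" using u by simp
  note sc = scaled [OF this cov(1)]
  have ac: "act i x = (u *s v, u * unit_root n a * (if s then z' else z), u * unit_root n (- a) * (if s then z else z'))"
    by (simp add: i xv dihedral_act_def u_def Let_def)
  have "(u * unit_root n a * (if s then z' else z)) * (u * unit_root n (- a) * (if s then z else z')) =
      (unit_root n a * unit_root n (- a)) * u\<^sup>2 * (z * z')"
    by (simp add: power2_eq_square mult_ac)
  then have "(u * unit_root n a * (if s then z' else z)) * (u * unit_root n (- a) * (if s then z else z')) = H (u *s v)"
    using sc(4) u cov by simp
  moreover have pw: "(u * unit_root n a * w) ^ n = u ^ n * w ^ n" for a w
    by (simp add: power_mult_distrib unit_root_power n_pos)
  have "(u * unit_root n a * (if s then z' else z)) ^ n = A (u *s v) + B (u *s v)"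
    "(u * unit_root n (- a) * (if s then z else z')) ^ n = A (u *s v) - B (u *s v)"
    unfolding pw sc(2,3) u by (cases s; simp add: cov(2,3) algebra_simps)+
  ultimately show ?thesis
    unfolding ac cover_def using sc(1) by simp
qed

text \<open>Scalings by cube roots of unity commute with the rest, so the indices multiply as in the
  product of \<open>D\<close> with the integers modulo 3, acting from the left.\<close>

lemma act_act:
  "act (d, j) (act (d', j') x) = act (d \<otimes>\<^bsub>D\<^esub> d', (j + j') mod 3) x"
proof -
  obtain v z z' where xv: "x = (v, z, z')" by (cases x)
  obtain a s b t where d: "d = (a, s)" "d' = (b, t)" by (metis surj_pair)
  have e: "unit_root n (c mod int n) = unit_root n c" "unit_root n (- (c mod int n)) = unit_root n (- c)" for c
    using n_pos by (simp_all add: unit_root_mod unit_root_neg_mod)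
  have w: "unit_root 3 ((j + j') mod 3) = unit_root 3 j * unit_root 3 j'"
    using unit_root_mod [of 3 "j + j'"] by (simp add: unit_root_add)
  have m: "unit_root n (a - b) = unit_root n a * unit_root n (- b)"
    "unit_root n (b - a) = unit_root n (- a) * unit_root n b"
    "unit_root n (- a - b) = unit_root n (- a) * unit_root n (- b)"
    by (simp_all flip: unit_root_add)
  show ?thesis
    by (simp add: xv d mult_D dihedral_act_def Let_def w e m unit_root_add vector_smult_assoc mult_ac)
qed

lemma act_one: "act ((0, False), 0) x = x"
  by (cases x) (simp add: dihedral_act_def)

lemma one_D: "\<one>\<^bsub>D\<^esub> = (0, False)" by (simp add: dihedral_group_def)

lemma act_inverse:
  assumes "i \<in> indices"
  shows "\<exists>k\<in>indices. \<forall>x. act k (act i x) = x \<and> act i (act k x) = x"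
proof -
  interpret group D by (rule group_D)
  obtain d j where i: "i = (d, j)" "d \<in> carrier D" "j \<in> {0..<3}" using assms by auto
  have "(inv\<^bsub>D\<^esub> d, (- j) mod 3) \<in> indices" using i by auto
  moreover have "act (inv\<^bsub>D\<^esub> d, (- j) mod 3) (act i x) = x \<and> act i (act (inv\<^bsub>D\<^esub> d, (- j) mod 3) x) = x" for x
    using i(2) act_one [of x] by (simp add: i(1) act_act one_D mod_simps)
  ultimately show ?thesis by blast
qed

lemma continuous_act: "continuous_on S (act i)"
proof -
  obtain a s j where i: "i = ((a, s), j)" by (metis surj_pair)
  define u where "u = (if s then - unit_root 3 j else unit_root 3 j)"
  have "act i = (\<lambda>x. (u *s fst x, u * unit_root n a * (if s then snd (snd x) else fst (snd x)),
      u * unit_root n (- a) * (if s then fst (snd x) else snd (snd x))))"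
    by (auto simp: i dihedral_act_def u_def fun_eq_iff Let_def)
  then show ?thesis by (cases s) (auto intro!: continuous_intros)
qed

text \<open>The vector \<open>v\<close> is nonzero and determines the scalar \<open>u\<close>, whose
  cube determines \<open>s\<close>. The rotation is read off from whichever of \<open>z\<close>,
  \<open>z'\<close> is nonzero.\<close>

lemma act_free:
  assumes x: "x \<in> cover" and i: "i \<in> indices" "k \<in> indices" and eq: "act i x = act k x"
  shows "i = k"
proof -
  obtain v z z' where xv: "x = (v, z, z')" by (cases x)
  obtain a s j where i': "i = ((a, s), j)" by (metis surj_pair)
  obtain b t l where k': "k = ((b, t), l)" by (metis surj_pair)
  have rng: "a \<in> {0..<int n}" "b \<in> {0..<int n}" "j \<in> {0..<3}" "l \<in> {0..<3}"
    using i by (auto simp: i' k' carrier_D)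
  define u where "u s j = (if s then - unit_root 3 j else unit_root 3 j)" for s j
  note nz = cover_nonzero [OF x [unfolded xv]]
  have "u s j *s v = u t l *s v" using eq by (simp add: i' k' xv dihedral_act_def Let_def u_def)
  then have u: "u s j = u t l" using nz(1) by simp
  have "u s j ^ 3 = (if s then - 1 else 1)" "u t l ^ 3 = (if t then - 1 else 1)"
    using unit_root_3 by (simp_all add: u_def)
  then have st: "s = t" using u by (auto split: if_splits)
  then have "unit_root 3 j = unit_root 3 l" using u by (auto simp: u_def split: if_splits)
  then have jl: "j = l" using rng unit_root_inj [of 3 j l] by simp
  have "u s j \<noteq> 0" by (simp add: u_def)
  then have 1: "unit_root n a * (if s then z' else z) = unit_root n b * (if s then z' else z)"
    and 2: "unit_root n (- a) * (if s then z else z') = unit_root n (- b) * (if s then z else z')"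
    using eq unfolding st jl by (simp_all add: i' k' xv dihedral_act_def Let_def u_def jl st split: if_splits)
  have "unit_root n a = unit_root n b"
  proof (cases "(if s then z' else z) = 0")
    case False
    then show ?thesis using 1 by simp
  next
    case True
    then have "(if s then z else z') \<noteq> 0" using nz(2) by auto
    then have "unit_root n (- a) = unit_root n (- b)" using 2 by simp
    then show ?thesis by (metis add.inverse_inverse mult.commute mult_1 mult.assoc unit_root_inverse(1))
  qed
  then show ?thesis using unit_root_inj rng st jl by (simp add: i' k')
qed

text \<open>The vectors differ by a sixth root of unity \<open>u\<close>. Once \<open>u\<close> is
  taken into account, both pairs consist of n-th roots of the same two factors with the same
  product, hence differ by a root of unity and its inverse.\<close>

lemma cover_fibre:
  assumes x: "x \<in> cover" and y: "y \<in> cover" and eq: "p x = p y"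
  shows "\<exists>i\<in>indices. y = act i x"
proof -
  obtain v z1 z1' where xv: "x = (v, z1, z1')" by (cases x)
  obtain v2 z2 z2' where yv: "y = (v2, z2, z2')" by (cases y)
  have cx: "F v = 1" "z1 ^ n = A v + B v" "z1' ^ n = A v - B v" "z1 * z1' = H v"
    using x by (auto simp: xv cover_def)
  have cy: "F v2 = 1" "z2 ^ n = A v2 + B v2" "z2' ^ n = A v2 - B v2" "z2 * z2' = H v2"
    using y by (auto simp: yv cover_def)
  obtain u where u: "u ^ 6 = 1" "v2 = u *s v"
    using sextic_coords_eq [of v v2] eq cover_nonzero(1) [OF x [unfolded xv]] by (auto simp: p_def xv yv)
  have "(u ^ 3) ^ 2 = 1" using u(1) by (simp flip: power_mult)
  then have u3: "u ^ 3 = 1 \<or> u ^ 3 = - 1" by (simp only: power2_eq_1_iff)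
  define s where "s \<longleftrightarrow> u ^ 3 = - 1"
  have us: "u ^ 3 = (if s then - 1 else 1)" using u3 by (auto simp: s_def)
  have "((if s then - u else u)) ^ 3 = 1" using us by (simp add: power_minus_odd)
  then obtain j where j: "j \<in> {0..<3}" "(if s then - u else u) = unit_root 3 j"
    by (rule unit_root_surj [of "if s then - u else u" 3]) auto
  have uj: "u = (if s then - unit_root 3 j else unit_root 3 j)"
    using j(2) by (cases s) (simp_all, metis minus_minus)
  define w w' where "w = (if s then z1' else z1)" and "w' = (if s then z1 else z1')"
  have "w \<noteq> 0 \<or> w' \<noteq> 0" using cover_nonzero(2) [OF x [unfolded xv]] by (auto simp: w_def w'_def)
  have "u \<noteq> 0" using u(1) by auto
  note sc = scaled [OF u3 cx(1)]
  have z2: "z2 ^ n = (u * w) ^ n" "z2' ^ n = (u * w') ^ n"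
    unfolding power_mult_distrib cy(2,3) u(2) sc(2,3) us w_def w'_def
    by (cases s; simp add: cx(2,3) algebra_simps)+
  have z3: "z2 * z2' = (u * w) * (u * w')"
    unfolding cy(4) u(2) sc(4) cx(4) [symmetric] w_def w'_def by (cases s) (simp_all add: power2_eq_square)
  note z2 = z2 z3
  obtain a where a: "a \<in> {0..<int n}" "z2 = u * unit_root n a * w" "z2' = u * unit_root n (- a) * w'"
  proof (cases "w = 0")
    case False
    then have "(z2 / (u * w)) ^ n = 1" using z2(1) \<open>u \<noteq> 0\<close> by (simp add: power_divide)
    then obtain a where a: "a \<in> {0..<int n}" "z2 / (u * w) = unit_root n a"
      using unit_root_surj n_pos by metis
    then have z: "z2 = u * unit_root n a * w" using False \<open>u \<noteq> 0\<close> by (simp add: field_simps)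
    have "(u * unit_root n a * w) * z2' = (u * w) * (u * w')"
      using z2(3) unfolding z .
    also have "\<dots> = (unit_root n a * unit_root n (- a)) * ((u * w) * (u * w'))" by simp
    also have "\<dots> = (u * unit_root n a * w) * (u * unit_root n (- a) * w')" by (simp only: mult_ac)
    finally have "(u * unit_root n a * w) * z2' = (u * unit_root n a * w) * (u * unit_root n (- a) * w')" .
    then have "z2' = u * unit_root n (- a) * w'" using False \<open>u \<noteq> 0\<close> by simp
    then show ?thesis using that a(1) z by blast
  next
    case True
    then have "w' \<noteq> 0" using \<open>w \<noteq> 0 \<or> w' \<noteq> 0\<close> by simp
    then have "(z2' / (u * w')) ^ n = 1" using z2(2) \<open>u \<noteq> 0\<close> by (simp add: power_divide)
    then obtain b where b: "b \<in> {0..<int n}" "z2' / (u * w') = unit_root n b"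
      using unit_root_surj n_pos by metis
    \<comment> \<open>Here the root of unity is found on the second component, where the rotation
      acts by the inverse.\<close>
    have "z2' = u * unit_root n (- ((- b) mod int n)) * w'"
      using b(2) \<open>w' \<noteq> 0\<close> \<open>u \<noteq> 0\<close> by (simp add: unit_root_neg_mod n_pos field_simps)
    moreover have "z2 = 0" using z2(1) True n_pos by (simp add: power_0_left)
    ultimately show ?thesis using that [of "(- b) mod int n"] True n_pos by simp
  qed
  have "y = act ((a, s), j) x"
    using a(2,3) by (simp add: yv xv u(2) dihedral_act_def Let_def w_def w'_def flip: uj)
  moreover have "((a, s), j) \<in> indices" using a(1) j(1) by (simp add: carrier_D)
  ultimately show ?thesis by blast
qed

lemma p_act: "p (act i x) = p x" 
proof -
  obtain v z z' where xv: "x = (v, z, z')" by (cases x)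
  obtain a s j where i: "i = ((a, s), j)" by (metis surj_pair)
  define u where "u = (if s then - unit_root 3 j else unit_root 3 j)"
  have "u ^ 3 = 1 \<or> u ^ 3 = - 1" using unit_root_3 by (simp add: u_def)
  then have "u ^ 6 = 1" by (rule power_6_eq_1)
  moreover have "p (act i x) = sextic_coords (u *s v)" by (simp add: i xv dihedral_act_def Let_def p_def u_def)
  ultimately show ?thesis by (simp add: sextic_coords_scale p_def xv)
qed

section \<open>Properness of the projection and the covering property\<close>

lemma continuous_p: "continuous_on S p"
  unfolding p_def [abs_def]
  by (intro continuous_on_compose2 [OF continuous_on_sextic_coords [of UNIV]] continuous_intros) auto

lemma cover_over:
  assumes "F v = 1"
  obtains z z' where "(v, z, z') \<in> cover"
proof -
  have root: "\<exists>z :: complex. z ^ n = c" for c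
  proof -
    obtain w where "c = w ^ n" by (rule exists_complex_root [of n c]) (use n_pos in simp)
    then show ?thesis by blast
  qed
  show ?thesis
  proof (cases "A v + B v = 0")
    case False
    obtain z where z: "z ^ n = A v + B v" using root by blast
    then have "z \<noteq> 0" using False n_pos by (auto simp: power_0_left)
    have "H v ^ n = (A v + B v) * (A v - B v)" using identity [of v] assms
      by (simp add: algebra_simps power2_eq_square)
    then have "(H v / z) ^ n = A v - B v" using False by (simp add: power_divide z)
    then show ?thesis using that [of z "H v / z"] \<open>z \<noteq> 0\<close> z assms by (simp add: cover_def)
  next
    case True
    obtain z where z: "z ^ n = A v - B v" using root by blast
    have "H v ^ n = (A v + B v) * (A v - B v)" using identity [of v] assms
      by (simp add: algebra_simps power2_eq_square)
    then have "H v = 0" using True by simp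
    then show ?thesis using that [of 0 z] z assms True n_pos by (simp add: cover_def)
  qed
qed

lemma closed_cover: "closed cover"
proof -
  have c: "continuous_on UNIV (\<lambda>x :: (complex ^ 3) \<times> complex \<times> complex. G (fst x))"
    if "continuous_on UNIV G" for G :: "complex ^ 3 \<Rightarrow> complex"
    by (intro continuous_on_compose2 [OF that] continuous_intros) auto
  have "cover = {x. F (fst x) = 1} \<inter> {x. fst (snd x) ^ n = A (fst x) + B (fst x)} \<inter>
      {x. snd (snd x) ^ n = A (fst x) - B (fst x)} \<inter> {x. fst (snd x) * snd (snd x) = H (fst x)}"
    by (auto simp: cover_def)
  then show ?thesis
    by (auto intro!: closed_Int closed_Collect_eq continuous_intros c cont)
qed

text \<open>The diagonal entries of \<open>p x\<close> are the sixth powers of the coordinates, so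
  they bound \<open>v\<close>; the equations for \<open>z ^ n\<close> and \<open>z' ^ n\<close> then
  bound the roots.\<close>

lemma compact_preimage:
  assumes "compact U"
  shows "compact (cover \<inter> p -` U)"
proof -
  obtain K where K: "\<And>y. y \<in> U \<Longrightarrow> norm y \<le> K" using compact_imp_bounded [OF assms] bounded_iff by metis
  \<comment> \<open>Each of the three coordinates is bounded by \<open>K + 1\<close>, and the norm
    by their sum.\<close>
  define R where "R = 3 * (K + 1)"
  have bound: "\<exists>M. \<forall>v\<in>cball 0 R. norm (G v) \<le> M" if "continuous_on UNIV G" for G :: "complex ^ 3 \<Rightarrow> complex"
  proof -
    have "compact (G ` cball 0 R)" using that by (intro compact_continuous_image continuous_on_subset [OF that]) auto
    then show ?thesis using compact_imp_bounded bounded_iff by (metis imageI)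
  qed
  obtain M where M: "\<And>v. v \<in> cball 0 R \<Longrightarrow> norm (A v + B v) \<le> M"
    using bound [OF continuous_on_add [OF cont(2,3)]] by blast
  obtain M' where M': "\<And>v. v \<in> cball 0 R \<Longrightarrow> norm (A v - B v) \<le> M'"
    using bound [OF continuous_on_diff [OF cont(2,3)]] by blast
  have "cover \<inter> p -` U \<subseteq> cball 0 R \<times> cball 0 (M + 1) \<times> cball 0 (M' + 1)"
  proof
    fix x assume x: "x \<in> cover \<inter> p -` U"
    obtain v z z' where xv: "x = (v, z, z')" by (cases x)
    have "norm (v $ i) \<le> K + 1" for i
    proof (rule power_bound)
      have "norm (v $ i) ^ 6 = norm (p x $ i $ i)"
        by (simp add: p_def xv sextic_coords_def norm_mult norm_power eval_nat_numeral)
      also have "\<dots> \<le> norm (p x $ i)" by (rule Finite_Cartesian_Product.norm_nth_le)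
      also have "\<dots> \<le> norm (p x)" by (rule Finite_Cartesian_Product.norm_nth_le)
      also have "\<dots> \<le> K" using K x by simp
      finally show "norm (v $ i) ^ 6 \<le> K" .
    qed auto
    then have "(\<Sum>i\<in>UNIV. norm (v $ i)) \<le> (\<Sum>i\<in>(UNIV :: 3 set). K + 1)" by (intro sum_mono)
    then have v: "norm v \<le> R"
      unfolding R_def using L2_set_le_sum [of UNIV "\<lambda>i. norm (v $ i)"]
      by (simp add: norm_vec_def)
    have "norm z ^ n \<le> M" "norm z' ^ n \<le> M'"
      using x M [of v] M' [of v] v by (auto simp: xv cover_def simp flip: norm_power)
    then have "norm z \<le> M + 1" "norm z' \<le> M' + 1"
      using power_bound n_pos norm_ge_zero by metis+
    then show "x \<in> cball 0 R \<times> cball 0 (M + 1) \<times> cball 0 (M' + 1)" using v by (simp add: xv)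
  qed
  then have "bounded (cover \<inter> p -` U)"
    using bounded_subset bounded_Times bounded_cball by metis
  moreover have "closed (cover \<inter> p -` U)"
    using closed_cover assms continuous_p [of UNIV]
    by (intro closed_Int closed_vimage) (auto simp: compact_imp_closed continuous_on_eq_continuous_at)
  ultimately show ?thesis by (simp add: compact_eq_bounded_closed)
qed

lemma covering: "covering_space cover p base"
proof (rule covering_space_finite_action [where act = act and I = indices and e = "((0, False), 0)"])
  show "finite indices" by (simp add: carrier_D)
  show "closedin (top_of_set base) (p ` K)" if "closedin (top_of_set cover) K" for K
    using proper_map [OF that, of base p] compact_preimage by (auto simp: base_def)
  show "p x = p y \<longleftrightarrow> (\<exists>i\<in>indices. y = act i x)" if "x \<in> cover" "y \<in> cover" for x y
    using cover_fibre that p_act by metis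
  show "\<exists>j\<in>indices. \<forall>x\<in>cover. act j (act i x) = x \<and> act i (act j x) = x" if "i \<in> indices" for i
    using act_inverse [OF that] by blast
  show "i = j" if "i \<in> indices" "j \<in> indices" "x \<in> cover" "act i x = act j x" for i j x
    by (rule act_free [OF that(3,1,2,4)])
qed (use n_pos in \<open>auto simp: base_def continuous_p continuous_act act_in_cover act_one carrier_D\<close>)

end

section \<open>Monodromy\<close>

lemma rep_proj_proj:
  assumes "v \<noteq> 0"
  obtains c where "c \<noteq> 0" "rep_proj (proj v) = c *s v"
proof -
  let ?w = "rep_proj (proj v)"
  have w: "proj ?w = proj v" "?w \<noteq> 0"
    using Quotient_abs_rep [OF Quotient_proj_plane, of "proj v"]
      Quotient_rep_reflp [OF Quotient_proj_plane, of "proj v"] by auto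
  then obtain c where "?w = c *s v" using proj_eq_iff [OF assms w(2)] by auto
  then show ?thesis using that w(2) by auto
qed

lemma continuous_on_proj: "continuous_on (- {0}) proj"
proof -
  have "proj -` U \<inter> - {0} = {v. v \<noteq> 0 \<and> proj v \<in> U}" for U by auto
  then show ?thesis
    by (subst continuous_on_open_vimage) (auto simp: open_Compl open_proj_plane_def)
qed

context dihedral_cover
begin

section \<open>The complement of the curve and its map to the base\<close>

definition complement :: "proj_plane set" where
  "complement = {P. \<exists>v. v \<noteq> 0 \<and> P = proj v \<and> F v \<noteq> 0}"

text \<open>Numerator and denominator have degree 6, so the choice of \<open>rep_proj P\<close> does
  not matter; on a representative with \<open>F = 1\<close> this is \<open>sextic_coords\<close>.
  Loops of the complement are pushed to \<open>base\<close> by this map and lifted there.\<close>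

definition emb :: "proj_plane \<Rightarrow> complex ^ 3 ^ 3" where
  "emb P = (\<chi> i j. sextic_coords (rep_proj P) $ i $ j / F (rep_proj P))"

lemma emb_proj:
  assumes "v \<noteq> 0" shows "emb (proj v) = (\<chi> i j. sextic_coords v $ i $ j / F v)"
proof -
  obtain c where "c \<noteq> 0" "rep_proj (proj v) = c *s v" using rep_proj_proj [OF assms] .
  then show ?thesis by (simp add: emb_def sextic_coords_scale hom(1))
qed

lemma proj_in_complement_iff:
  assumes "v \<noteq> 0" shows "proj v \<in> complement \<longleftrightarrow> F v \<noteq> 0"
proof
  assume "proj v \<in> complement"
  then obtain w where w: "w \<noteq> 0" "proj w = proj v" "F w \<noteq> 0" by (auto simp: complement_def)
  then obtain c where "w = c *s v" using proj_eq_iff assms by metis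
  then show "F v \<noteq> 0" using w(3) by (auto simp: hom(1))
qed (use assms in \<open>auto simp: complement_def\<close>)

lemma emb_cover:
  assumes "x \<in> cover"
  shows "proj (fst x) \<in> complement" "emb (proj (fst x)) = p x"
proof -
  obtain v z z' where x: "x = (v, z, z')" by (cases x)
  have "v \<noteq> 0" "F v = 1" using assms cover_nonzero by (auto simp: x cover_def)
  then show "proj (fst x) \<in> complement" "emb (proj (fst x)) = p x"
    by (simp_all add: x proj_in_complement_iff emb_proj p_def vec_eq_iff)
qed

lemma cover_over_point:
  assumes "P \<in> complement"
  obtains x where "x \<in> cover" "proj (fst x) = P"
proof -
  obtain v where v: "v \<noteq> 0" "P = proj v" "F v \<noteq> 0" using assms by (auto simp: complement_def)
  obtain l where l: "1 / F v = l ^ 6" by (rule exists_complex_root [of 6]) simp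
  then have "F (l *s v) = 1" using v(3) by (simp add: hom(1) flip: l)
  then obtain z z' where x: "(l *s v, z, z') \<in> cover" using cover_over by blast
  then have "proj (l *s v) = proj v" using v(1) cover_nonzero(1) [OF x] by (auto simp: proj_eq_iff intro: exI [of _ "inverse l"])
  then show ?thesis using that [OF x] v(2) by simp
qed

lemma emb_in_base: "P \<in> complement \<Longrightarrow> emb P \<in> base"
  using cover_over_point emb_cover unfolding base_def by (metis image_eqI)

lemma open_complement: "open complement"
proof -
  have "{v. v \<noteq> 0 \<and> proj v \<in> complement} = {v. v \<noteq> 0} \<inter> {v. F v \<noteq> 0}"
    using proj_in_complement_iff by auto
  moreover have "open {v. F v \<noteq> 0}" using cont(1) by (intro open_Collect_neq) auto
  moreover have "open {v :: complex ^ 3. v \<noteq> 0}" by (intro open_Collect_neq) auto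
  ultimately show ?thesis by (simp add: open_proj_plane_def open_Int)
qed

lemma continuous_emb: "continuous_on complement emb"
proof (subst continuous_on_open_vimage [OF open_complement], intro allI impI)
  fix U :: "(complex ^ 3 ^ 3) set" assume U: "open U"
  let ?V = "{v. v \<noteq> 0 \<and> F v \<noteq> 0}"
  have V: "open ?V" using cont(1) by (intro open_Collect_conj open_Collect_neq) auto
  have "continuous_on ?V (\<lambda>v. \<chi> i j. sextic_coords v $ i $ j / F v)"
    by (intro continuous_intros continuous_on_sextic_coords continuous_on_subset [OF cont(1)]) auto
  then have "open ((\<lambda>v. \<chi> i j. sextic_coords v $ i $ j / F v) -` U \<inter> ?V)"
    using U continuous_on_open_vimage [OF V] by blast
  moreover have "(\<lambda>v. \<chi> i j. sextic_coords v $ i $ j / F v) -` U \<inter> ?V = {v. v \<noteq> 0 \<and> proj v \<in> emb -` U \<inter> complement}"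
    by (auto simp: emb_proj proj_in_complement_iff)
  ultimately show "open (emb -` U \<inter> complement)" by (simp add: open_proj_plane_def)
qed

lemma path_emb:
  assumes "path q" "path_image q \<subseteq> complement"
  shows "path (emb \<circ> q)" "path_image (emb \<circ> q) \<subseteq> base"
  using assms emb_in_base
  by (auto intro!: path_continuous_image continuous_on_subset [OF continuous_emb] simp: path_image_def)

text \<open>The end point of a lift determines an element of the product of \<open>D\<close> with
  the integers modulo 3. Quantifying over \<open>j\<close> is the projection to
  \<open>D\<close>.\<close>

definition lifts_to where
  "lifts_to x q d \<longleftrightarrow> (\<exists>h j. path h \<and> path_image h \<subseteq> cover \<and> pathstart h = x \<and>
     (\<forall>t\<in>{0..1}. p (h t) = emb (q t)) \<and> j \<in> {0..<3} \<and> pathfinish h = act (d, j) x)"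

lemma lifts_to_exists:
  assumes x: "x \<in> cover" "proj (fst x) = b" and q: "q \<in> loops_at complement b"
  shows "\<exists>d\<in>carrier D. lifts_to x q d"
proof -
  have q': "path q" "path_image q \<subseteq> complement" "q 0 = b" "q 1 = b"
    using q by (auto simp: loops_at_def pathstart_def pathfinish_def)
  have "pathstart (emb \<circ> q) = p x" using emb_cover(2) [OF x(1)] x(2) q' by (simp add: pathstart_def)
  then obtain h where h: "path h" "path_image h \<subseteq> cover" "pathstart h = x" "\<And>t. t \<in> {0..1} \<Longrightarrow> p (h t) = (emb \<circ> q) t"
    using covering_space_lift_path_strong [OF covering x(1) path_emb [OF q'(1,2)]] by blast
  have "h 1 \<in> cover" using h(2) by (auto simp: path_image_def)
  moreover have "p x = p (h 1)" using h(4) [of 1] emb_cover(2) [OF x(1)] x(2) q' by simp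
  ultimately obtain i where i: "i \<in> indices" "h 1 = act i x" using cover_fibre x(1) by blast
  then obtain d j where dj: "d \<in> carrier D" "j \<in> {0..<3}" "h 1 = act (d, j) x" by blast
  have "lifts_to x q d"
    unfolding lifts_to_def by (rule exI [of _ h], rule exI [of _ j]) (use h dj in \<open>auto simp: pathfinish_def\<close>)
  then show ?thesis using dj(1) by blast
qed

lemma lifts_to_unique:
  assumes x: "x \<in> cover" and q: "homotopic_paths complement q q'"
    and d: "lifts_to x q d" "lifts_to x q' d'" "d \<in> carrier D" "d' \<in> carrier D"
  shows "d = d'"
proof -
  obtain h j where h: "path h" "path_image h \<subseteq> cover" "pathstart h = x" "\<And>t. t \<in> {0..1} \<Longrightarrow> p (h t) = (emb \<circ> q) t"
    "j \<in> {0..<3}" "pathfinish h = act (d, j) x" using d(1) by (auto simp: lifts_to_def)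
  obtain h' j' where h': "path h'" "path_image h' \<subseteq> cover" "pathstart h' = x" "\<And>t. t \<in> {0..1} \<Longrightarrow> p (h' t) = (emb \<circ> q') t"
    "j' \<in> {0..<3}" "pathfinish h' = act (d', j') x" using d(2) by (auto simp: lifts_to_def)
  have qq: "path q" "path q'" "path_image q \<subseteq> complement" "path_image q' \<subseteq> complement"
    using q homotopic_paths_imp_path homotopic_paths_imp_subset by blast+
  have "homotopic_paths base (emb \<circ> q) (emb \<circ> q')"
    using emb_in_base by (intro homotopic_paths_continuous_image [OF q continuous_emb]) auto
  then have "pathfinish h = pathfinish h'"
    by (rule covering_space_monodromy [OF covering path_emb [OF qq(1,3)] path_emb [OF qq(2,4)] _ h(1,2,4) h'(1,2,4)])
      (simp_all add: h(3) h'(3))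
  then have "(d, j) = (d', j')"
    using act_free [OF x, of "(d, j)" "(d', j')"] h(5,6) h'(5,6) d(3,4) by simp
  then show ?thesis by simp
qed

text \<open>The lift of \<open>q'\<close> is translated by \<open>(d, j)\<close> to start where the
  lift of \<open>q\<close> ends. Its end point \<open>act (d, j) (act (d', j') x)\<close> shows the
  factors in the right order for a homomorphism.\<close>

lemma lifts_to_join:
  assumes x: "x \<in> cover" "proj (fst x) = b" and q: "q \<in> loops_at complement b" "q' \<in> loops_at complement b"
    and d: "lifts_to x q d" "lifts_to x q' d'"
  shows "lifts_to x (q +++ q') (d \<otimes>\<^bsub>D\<^esub> d')"
proof -
  obtain h j where h: "path h" "path_image h \<subseteq> cover" "pathstart h = x" "\<And>t. t \<in> {0..1} \<Longrightarrow> p (h t) = emb (q t)"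
    "j \<in> {0..<3}" "pathfinish h = act (d, j) x" using d(1) by (auto simp: lifts_to_def)
  obtain h' j' where h': "path h'" "path_image h' \<subseteq> cover" "pathstart h' = x" "\<And>t. t \<in> {0..1} \<Longrightarrow> p (h' t) = emb (q' t)"
    "j' \<in> {0..<3}" "pathfinish h' = act (d', j') x" using d(2) by (auto simp: lifts_to_def)
  define k where "k = h +++ (act (d, j) \<circ> h')"
  have a: "path (act (d, j) \<circ> h')" by (intro path_continuous_image h' continuous_act)
  have s: "pathfinish h = pathstart (act (d, j) \<circ> h')" using h h' by (simp add: pathstart_def)
  show ?thesis
    unfolding lifts_to_def
  proof (intro exI conjI ballI)
    show "path k" unfolding k_def using h(1) a s by simp
    show "path_image k \<subseteq> cover"
    proof -
      have "path_image (act (d, j) \<circ> h') \<subseteq> cover" using h'(2) act_in_cover unfolding path_image_compose by blast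
      then show ?thesis unfolding k_def using h(2) s by (simp add: path_image_join)
    qed
    show "pathstart k = x" by (simp add: k_def h)
    show "(j + j') mod 3 \<in> {0..<3}" by simp
    show "pathfinish k = act (d \<otimes>\<^bsub>D\<^esub> d', (j + j') mod 3) x"
      using h'(6) by (simp add: k_def act_act pathfinish_def joinpaths_def)
    fix t :: real assume "t \<in> {0..1}"
    then show "p (k t) = emb ((q +++ q') t)"
      by (auto simp: k_def joinpaths_def h(4) h'(4) p_act)
  qed
qed

text \<open>Surjectivity comes from paths in the cover: a path from \<open>x\<close> to
  \<open>act (d, j) x\<close> projects to a loop, and is itself the lift that shows the monodromy
  \<open>d\<close>.\<close>

lemma epi_fundamental_group:
  assumes x: "x \<in> cover" "proj (fst x) = b"
    and surj: "\<And>d. d \<in> carrier D \<Longrightarrow> \<exists>j\<in>{0..<3}. path_component cover x (act (d, j) x)"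
  shows "epi (fundamental_group complement b) D \<noteq> {}"
proof -
  let ?G = "fundamental_group complement b" and ?c = "\<lambda>q. loop_homotopy complement b `` {q}"
  define \<phi> where "\<phi> X = (THE d. d \<in> carrier D \<and> (\<exists>q\<in>X. lifts_to x q d))" for X
  have carrier: "carrier ?G = ?c ` loops_at complement b"
    by (auto simp: fundamental_group_def quotient_def)
  have \<phi>: "\<phi> (?c q) = d" if qd: "q \<in> loops_at complement b" "d \<in> carrier D" "lifts_to x q d" for q d
    unfolding \<phi>_def
  proof (rule the_equality)
    have "q \<in> ?c q" using equiv_class_self [OF equiv_loop_homotopy qd(1)] .
    then show "d \<in> carrier D \<and> (\<exists>q\<in>?c q. lifts_to x q d)" using qd by blast
    show "d' = d" if dd: "d' \<in> carrier D \<and> (\<exists>q\<in>?c q. lifts_to x q d')" for d'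
    proof -
      obtain q' where q': "(q, q') \<in> loop_homotopy complement b" "lifts_to x q' d'" using dd by auto
      then have "homotopic_paths complement q q'" by (simp add: loop_homotopy_def)
      then show ?thesis using lifts_to_unique x(1) q'(2) dd qd by metis
    qed
  qed
  have ex: "\<exists>d. d \<in> carrier D \<and> lifts_to x q d" if "q \<in> loops_at complement b" for q
    using lifts_to_exists [OF x that] by blast
  have "\<phi> \<in> hom ?G D"
  proof (rule homI)
    fix X assume "X \<in> carrier ?G"
    then obtain q where "q \<in> loops_at complement b" "X = ?c q" by (auto simp: carrier)
    then show "\<phi> X \<in> carrier D" using ex [of q] \<phi> [of q] by metis
  next
    fix X Y assume "X \<in> carrier ?G" "Y \<in> carrier ?G"
    then obtain q q' where q: "q \<in> loops_at complement b" "q' \<in> loops_at complement b" "X = ?c q" "Y = ?c q'"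
      by (auto simp: carrier)
    obtain d d' where d: "d \<in> carrier D" "lifts_to x q d" "d' \<in> carrier D" "lifts_to x q' d'" using ex q by blast
    have "d \<otimes>\<^bsub>D\<^esub> d' \<in> carrier D" using d group_D by (simp add: group.is_monoid monoid.m_closed)
    then show "\<phi> (X \<otimes>\<^bsub>?G\<^esub> Y) = \<phi> X \<otimes>\<^bsub>D\<^esub> \<phi> Y"
      using \<phi> q d lifts_to_join [OF x q(1,2) d(2,4)] joinpaths_in_loops_at [OF q(1,2)]
      by (simp add: fundamental_group_mult)
  qed
  moreover have "d \<in> \<phi> ` carrier ?G" if d: "d \<in> carrier D" for d
  proof -
    obtain j h where h: "j \<in> {0..<3}" "path h" "path_image h \<subseteq> cover" "pathstart h = x" "pathfinish h = act (d, j) x"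
      using surj [OF d] unfolding path_component_def by blast
    define q where "q = (\<lambda>t. proj (fst (h t)))"
    have "0 \<notin> fst ` cover" using cover_nonzero by force
    then have "path q"
      unfolding q_def path_def using h(2,3)
      by (intro continuous_on_compose2 [OF continuous_on_proj] continuous_intros)
        (auto simp: path_def path_image_def image_subset_iff)
    moreover have "path_image q \<subseteq> complement" using emb_cover(1) h(3) unfolding q_def path_image_def image_subset_iff by blast
    moreover have "pathstart q = b" using h(4) x by (simp add: q_def pathstart_def)
    moreover have "pathfinish q = b"
    proof -
      obtain v z z' where xv: "x = (v, z, z')" by (cases x)
      obtain a s where ds: "d = (a, s)" by (cases d)
      have nz: "v \<noteq> 0" using cover_nonzero x(1) by (simp add: xv)
      have "proj (u *s v) = proj v" if "u \<noteq> 0" for u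
        using nz that by (subst proj_eq_iff) (auto intro!: exI [of _ "inverse u"] simp: vector_smult_assoc)
      then have "proj (fst (act (d, j) x)) = proj (fst x)"
        by (simp add: xv ds dihedral_act_def Let_def)
      then show ?thesis using h(5) x by (simp add: q_def pathfinish_def)
    qed
    ultimately have ql: "q \<in> loops_at complement b" by (simp add: loops_at_def)
    have "p (h t) = emb (q t)" if "t \<in> {0..1}" for t
    proof -
      have "h t \<in> cover" using h(3) that unfolding path_image_def by blast
      then show ?thesis by (simp add: q_def emb_cover(2))
    qed
    then have "lifts_to x q d" using h by (auto simp: lifts_to_def)
    then have "\<phi> (?c q) = d" using \<phi> ql d by blast
    then show ?thesis using ql by (force simp: carrier)
  qed
  ultimately have "\<phi> \<in> epi ?G D" unfolding epi_iff_subset by blast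
  then show ?thesis by blast
qed

text \<open>Path connection modulo the central cube roots of unity, so that the index
  \<open>j\<close> can be ignored when paths are composed and translated.\<close>

definition conn where
  "conn x y \<longleftrightarrow> (\<exists>j\<in>{0..<3}. path_component cover x (act ((0, False), j) y))"

lemma act_comm:
  assumes "d \<in> carrier D"
  shows "act ((0, False), j) (act (d, k) x) = act (d, (j + k) mod 3) x"
    "act (d, k) (act ((0, False), j) x) = act (d, (j + k) mod 3) x"
  using group_D assms by (simp_all add: act_act one_D [symmetric] group.is_monoid add.commute)

lemma path_component_act:
  "path_component cover x y \<Longrightarrow> path_component cover (act i x) (act i y)"
  unfolding path_component_def
proof (elim exE conjE)
  fix g assume g: "path g" "path_image g \<subseteq> cover" "pathstart g = x" "pathfinish g = y"
  have "path_image (act i \<circ> g) \<subseteq> cover" using g(2) act_in_cover unfolding path_image_compose by blast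
  moreover have "path (act i \<circ> g)" by (intro path_continuous_image g continuous_act)
  ultimately show "\<exists>g. path g \<and> path_image g \<subseteq> cover \<and> pathstart g = act i x \<and> pathfinish g = act i y"
    using g(3,4) by (intro exI [of _ "act i \<circ> g"]) (simp add: pathstart_compose pathfinish_compose)
qed

lemma conn_sym: "conn x y \<Longrightarrow> conn y x"
  unfolding conn_def
proof (elim bexE)
  fix j assume j: "j \<in> {0..<3}" "path_component cover x (act ((0, False), j) y)"
  have "path_component cover (act ((0, False), (- j) mod 3) x) (act ((0, False), (- j) mod 3) (act ((0, False), j) y))"
    by (rule path_component_act [OF j(2)])
  moreover have "act ((0, False), (- j) mod 3) (act ((0, False), j) y) = y"
    using act_comm(1) [of "(0, False)" "(- j) mod 3" j y] n_pos by (simp add: carrier_D mod_simps act_one)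
  ultimately have "path_component cover y (act ((0, False), (- j) mod 3) x)"
    by (metis path_component_sym)
  then show "\<exists>j\<in>{0..<3}. path_component cover y (act ((0, False), j) x)"
    by (rule bexI) simp
qed

lemma conn_trans: "conn x y \<Longrightarrow> conn y z \<Longrightarrow> conn x z"
  unfolding conn_def
proof (elim bexE)
  fix j k assume j: "j \<in> {0..<3}" "path_component cover x (act ((0, False), j) y)"
    and k: "k \<in> {0..<3}" "path_component cover y (act ((0, False), k) z)"
  have "path_component cover (act ((0, False), j) y) (act ((0, False), (j + k) mod 3) z)"
    using path_component_act [OF k(2), of "((0, False), j)"] act_comm(1) [of "(0, False)" j k z] n_pos
    by (simp add: carrier_D)
  then show "\<exists>j\<in>{0..<3}. path_component cover x (act ((0, False), j) z)"
    using j(2) path_component_trans by (intro bexI [of _ "(j + k) mod 3"]) auto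
qed

lemma conn_act:
  assumes "d \<in> carrier D" "conn x y"
  shows "conn (act (d, 0) x) (act (d, 0) y)"
proof -
  obtain j where j: "j \<in> {0..<3}" "path_component cover x (act ((0, False), j) y)"
    using assms(2) by (auto simp: conn_def)
  have "act (d, 0) (act ((0, False), j) y) = act ((0, False), j) (act (d, 0) y)"
    using act_comm assms(1) by simp
  then show ?thesis using path_component_act [OF j(2), of "(d, 0)"] j(1) by (auto simp: conn_def)
qed

lemma conn_mult:
  assumes "conn x (act (d, 0) x)" "conn x (act (d', 0) x)" "d \<in> carrier D" "d' \<in> carrier D"
  shows "conn x (act (d \<otimes>\<^bsub>D\<^esub> d', 0) x)"
  using conn_trans [OF assms(1) conn_act [OF assms(3,2)]] by (simp add: act_act)

text \<open>A path in \<open>F \<noteq> 0\<close> projects to the complement, and its lift from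
  \<open>x\<close> ends in the fibre of \<open>y\<close>.\<close>

lemma connect_points:
  assumes pc: "path_connected {v. F v \<noteq> 0}" and xy: "x \<in> cover" "y \<in> cover"
  shows "\<exists>d\<in>carrier D. conn x (act (d, 0) y)"
proof -
  have F: "F (fst x) = 1" "F (fst y) = 1" using xy by (auto simp: cover_def)
  then obtain g where g: "path g" "path_image g \<subseteq> {v. F v \<noteq> 0}" "pathstart g = fst x" "pathfinish g = fst y"
  proof -
    have "fst x \<in> {v. F v \<noteq> 0}" "fst y \<in> {v. F v \<noteq> 0}" using F by auto
    then show thesis using pc that unfolding path_connected_def by blast
  qed
  have "F 0 = 0" using hom(1) [of 0 0] by simp
  then have g0: "path_image g \<subseteq> - {0}" using g(2) by auto
  define q where "q = proj \<circ> g"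
  have q: "path q" unfolding q_def by (intro path_continuous_image g continuous_on_subset [OF continuous_on_proj g0])
  have qc: "path_image q \<subseteq> complement"
    using g(2) g0 unfolding q_def path_image_compose by (auto simp: proj_in_complement_iff subset_iff)
  have "pathstart (emb \<circ> q) = p x"
    using emb_cover(2) [OF xy(1)] g(3) by (simp add: q_def pathstart_def)
  then obtain h where h: "path h" "path_image h \<subseteq> cover" "pathstart h = x" "\<And>t. t \<in> {0..1} \<Longrightarrow> p (h t) = (emb \<circ> q) t"
    using covering_space_lift_path_strong [OF covering xy(1) path_emb [OF q qc]] by blast
  have "p y = p (h 1)" using h(4) [of 1] emb_cover(2) [OF xy(2)] g(4) by (simp add: q_def pathfinish_def)
  moreover have "h 1 \<in> cover" using h(2) by (auto simp: path_image_def)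
  ultimately obtain d j where d: "d \<in> carrier D" "j \<in> {0..<3}" "h 1 = act (d, j) y" using cover_fibre xy(2) by blast
  have "act (d, j) y = act ((0, False), j) (act (d, 0) y)"
    using act_comm(1) [OF d(1), of j 0 y] d(2) by simp
  then have "conn x (act (d, 0) y)"
    using h d unfolding conn_def path_component_def pathfinish_def by auto
  then show ?thesis using d(1) by blast
qed

text \<open>
  The monodromy group is transported to another base point by a conjugation, which maps the rotation
  \<open>r\<close> to \<open>r\<close> or \<open>r\<^sup>-\<^sup>1\<close> and reflections to reflections.
\<close>

theorem epi_dihedral:
  assumes pc: "path_connected {v. F v \<noteq> 0}"
    and rot: "y \<in> cover" "conn y (act ((1, False), 0) y)"
    and refl: "z \<in> cover" "c \<in> {0..<int n}" "conn z (act ((c, True), 0) z)"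
    and b: "b \<in> complement"
  shows "epi (fundamental_group complement b) D \<noteq> {}"
proof -
  obtain x where x: "x \<in> cover" "proj (fst x) = b" using cover_over_point [OF b] .
  define K where "K = {d \<in> carrier D. conn x (act (d, 0) x)}"
  \<comment> \<open>The hypothesis \<open>d r = e d\<close> says that \<open>e\<close> is the
    conjugate of \<open>r\<close> by \<open>d\<close>: the chain runs from \<open>x\<close> to
    \<open>d w\<close>, to \<open>d r w = e d w\<close>, and back to \<open>e x\<close>.\<close>
  have conj: "e \<in> K" if w: "w \<in> cover" "conn w (act (r, 0) w)" "r \<in> carrier D" "e \<in> carrier D"
    "d \<in> carrier D" "conn x (act (d, 0) w)" "d \<otimes>\<^bsub>D\<^esub> r = e \<otimes>\<^bsub>D\<^esub> d" for w r e d
  proof -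
    have "conn (act (d, 0) w) (act (d, 0) (act (r, 0) w))" using conn_act w by blast
    moreover have "act (d, 0) (act (r, 0) w) = act (e, 0) (act (d, 0) w)" using w(7) by (simp add: act_act)
    moreover have "conn (act (e, 0) (act (d, 0) w)) (act (e, 0) x)" using conn_act [OF w(4) conn_sym [OF w(6)]] .
    ultimately have "conn x (act (e, 0) x)" using w(6) conn_trans by metis
    then show ?thesis using w(4) by (simp add: K_def)
  qed
  have K_mult: "d \<otimes>\<^bsub>D\<^esub> d' \<in> K" if "d \<in> K" "d' \<in> K" for d d'
    using that conn_mult group_D by (auto simp: K_def group.is_monoid monoid.m_closed)
  have one_lt: "1 < int n" using n3 by simp
  obtain d where d: "d \<in> carrier D" "conn x (act (d, 0) y)" using connect_points [OF pc x(1) rot(1)] by blast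
  obtain a s where as: "d = (a, s)" by (cases d)
  define \<epsilon> :: int where "\<epsilon> = (if s then - 1 else 1)"
  have eK: "(\<epsilon> mod int n, False) \<in> K"
    by (rule conj [OF rot _ _ d]) (use one_lt in \<open>auto simp: as mult_D carrier_D \<epsilon>_def mod_simps add.commute\<close>)
  have powK: "((int k * \<epsilon>) mod int n, False) \<in> K" if "k > 0" for k
    using that
  proof (induction k rule: nat_induct_non_zero)
    case 1
    then show ?case using eK by simp
  next
    case (Suc k)
    then show ?case using K_mult [OF eK Suc.IH] by (simp add: mult_D mod_simps algebra_simps)
  qed
  have rotK: "(k mod int n, False) \<in> K" for k
  proof -
    \<comment> \<open>Only positive powers are available from \<open>powK\<close>, hence the summand
      \<open>n\<close>; the factor \<open>\<epsilon>\<close> inverts itself.\<close>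
    define m where "m = nat ((k * \<epsilon>) mod int n) + n"
    have "m > 0" using n_pos by (simp add: m_def)
    moreover have "int m * \<epsilon> mod int n = k mod int n"
    proof -
      have "int m = (k * \<epsilon>) mod int n + int n" using n_pos by (simp add: m_def)
      then have "int m * \<epsilon> mod int n = (k * \<epsilon> * \<epsilon>) mod int n"
        by (metis mod_add_self2 mod_mult_left_eq mod_mod_trivial)
      then show ?thesis by (simp add: \<epsilon>_def split: if_splits)
    qed
    ultimately show ?thesis using powK [of m] by simp
  qed
  obtain d' where d': "d' \<in> carrier D" "conn x (act (d', 0) z)" using connect_points [OF pc x(1) refl(1)] by blast
  obtain a' s' where as': "d' = (a', s')" by (cases d')
  \<comment> \<open>The conjugate of the reflection with index \<open>c\<close> by
    \<open>d'\<close>, computed from \<open>mult_D\<close>.\<close>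
  define c' where "c' = (2 * a' + (if s' then - c else c)) mod int n"
  have c'K: "(c', True) \<in> K"
    by (rule conj [OF refl(1,3) _ _ d'])
      (use refl(2) n_pos in \<open>auto simp: as' mult_D carrier_D c'_def mod_simps algebra_simps\<close>)
  have "e \<in> K" if e: "e \<in> carrier D" for e
  proof -
    obtain k t where kt: "e = (k, t)" by (cases e)
    then have k: "k mod int n = k" using e by (simp add: carrier_D)
    show ?thesis
    proof (cases t)
      case True
      have "((k - c') mod int n, False) \<otimes>\<^bsub>D\<^esub> (c', True) = e"
        using k by (simp add: mult_D kt True mod_simps)
      then show ?thesis using K_mult [OF rotK c'K] by metis
    next
      case False
      then show ?thesis using rotK [of k] k kt by simp
    qed
  qed
  then have "\<exists>j\<in>{0..<3}. path_component cover x (act (e, j) x)" if e: "e \<in> carrier D" for e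
  proof -
    have "conn x (act (e, 0) x)" using \<open>\<And>e. e \<in> carrier D \<Longrightarrow> e \<in> K\<close> [OF e] by (simp add: K_def)
    then obtain j where j: "j \<in> {0..<3}" "path_component cover x (act ((0, False), j) (act (e, 0) x))"
      by (auto simp: conn_def)
    moreover have "act ((0, False), j) (act (e, 0) x) = act (e, j) x"
      using act_comm(1) [OF e, of j 0 x] j(1) by simp
    ultimately show ?thesis by auto
  qed
  then show ?thesis using epi_fundamental_group [OF x] by blast
qed

end

section \<open>Loops with prescribed monodromy\<close>

text \<open>On the complex line through two points with \<open>F \<noteq> 0\<close> only finitely
  many parameters are excluded, and the plane minus a finite set is path connected.\<close>

lemma path_connected_nonzero:
  fixes F :: "complex ^ 3 \<Rightarrow> complex"
  assumes "\<And>v w. \<exists>q. \<forall>t. F (v + t *s w) = poly q t"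
  shows "path_connected {v. F v \<noteq> 0}"
  unfolding path_connected_def
proof (intro ballI)
  fix v w assume vw: "v \<in> {v. F v \<noteq> 0}" "w \<in> {v. F v \<noteq> 0}"
  obtain q where q: "\<And>t. F (v + t *s (w - v)) = poly q t" using assms by metis
  have "poly q 0 = F v" "poly q 1 = F w" by (simp_all flip: q)
  then have ends: "0 \<in> - {t. poly q t = 0}" "1 \<in> - {t. poly q t = 0}" and "q \<noteq> 0" using vw by auto
  then have "path_connected (- {t. poly q t = 0})"
    by (intro path_connected_complement_countable countable_finite poly_roots_finite) simp_all
  then obtain g where g: "path g" "path_image g \<subseteq> - {t. poly q t = 0}" "pathstart g = 0" "pathfinish g = 1"
    using ends unfolding path_connected_def by blast
  show "\<exists>g. path g \<and> path_image g \<subseteq> {v. F v \<noteq> 0} \<and> pathstart g = v \<and> pathfinish g = w"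
  proof (intro exI conjI)
    show "path (\<lambda>t. v + g t *s (w - v))"
      using g(1) unfolding path_def by (intro continuous_intros)
    show "path_image (\<lambda>t. v + g t *s (w - v)) \<subseteq> {v. F v \<noteq> 0}"
      using g(2) unfolding path_image_def image_subset_iff mem_Collect_eq q by blast
  qed (use g in \<open>auto simp: pathstart_def pathfinish_def\<close>)
qed

text \<open>Near 0 the quotient \<open>g s / g 0\<close> stays in the right half plane, where
  \<open>Ln\<close> is continuous. The root is \<open>c\<close> times an exponential, hence nowhere
  zero.\<close>

lemma local_root:
  fixes g :: "complex \<Rightarrow> complex"
  assumes g: "continuous_on (cball 0 \<delta>) g" "\<delta> > 0" and k: "k > 0" "c ^ k = g 0" "g 0 \<noteq> 0"
  obtains \<epsilon> \<rho> where "0 < \<epsilon>" "\<epsilon> \<le> \<delta>" "continuous_on (cball 0 \<epsilon>) \<rho>" "\<rho> 0 = c"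
    "\<And>s. s \<in> cball 0 \<epsilon> \<Longrightarrow> \<rho> s ^ k = g s" "\<And>s. \<rho> s \<noteq> 0"
proof -
  define h where "h s = g s / g 0" for s
  have h: "continuous_on (cball 0 \<delta>) h" unfolding h_def using k by (intro continuous_intros g) auto
  have "h 0 = 1" using k by (simp add: h_def)
  have "0 \<in> cball 0 \<delta>" using g(2) by simp
  then obtain e where e: "e > 0" "\<And>s. s \<in> cball 0 \<delta> \<Longrightarrow> dist s 0 < e \<Longrightarrow> dist (h s) (h 0) < 1"
    using h unfolding continuous_on_iff by (metis zero_less_one)
  define \<epsilon> where "\<epsilon> = min \<delta> (e / 2)"
  have \<epsilon>: "0 < \<epsilon>" "\<epsilon> \<le> \<delta>" "\<epsilon> < e" using e g(2) by (auto simp: \<epsilon>_def)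
  have pos: "Re (h s) > 0" if "s \<in> cball 0 \<epsilon>" for s
  proof -
    have "norm (h s - 1) < 1" using e(2) [of s] that \<epsilon> \<open>h 0 = 1\<close> by (simp add: dist_norm)
    then have "\<bar>Re (h s) - 1\<bar> < 1" using abs_Re_le_cmod [of "h s - 1"] by simp
    then show ?thesis by linarith
  qed
  define \<rho> where "\<rho> s = c * exp (Ln (h s) / of_nat k)" for s
  have "c \<noteq> 0" using k by (auto simp: power_0_left)
  show ?thesis
  proof (rule that [of \<epsilon> \<rho>])
    have "h s \<notin> \<real>\<^sub>\<le>\<^sub>0" if "s \<in> cball 0 \<epsilon>" for s
      using pos [OF that] by (auto simp: complex_nonpos_Reals_iff)
    then show "continuous_on (cball 0 \<epsilon>) \<rho>"
      unfolding \<rho>_def using k \<epsilon> by (intro continuous_intros continuous_on_subset [OF h]) auto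
    show "\<rho> s ^ k = g s" if "s \<in> cball 0 \<epsilon>" for s
    proof -
      have "h s \<noteq> 0" using pos [OF that] by auto
      then have "exp (Ln (h s) / of_nat k) ^ k = h s"
        using k(1) by (simp flip: exp_of_nat_mult)
      then show ?thesis using k by (simp add: \<rho>_def power_mult_distrib h_def)
    qed
  qed (use \<epsilon> \<open>h 0 = 1\<close> \<open>c \<noteq> 0\<close> in \<open>auto simp: \<rho>_def\<close>)
qed

lemma real_root_complex:
  assumes "0 < (\<epsilon> :: real)" "k > 0"
  obtains e :: complex where "e ^ k = of_real \<epsilon>" "e \<noteq> 0"
proof (rule that [of "of_real (root k \<epsilon>)"])
  show "complex_of_real (root k \<epsilon>) ^ k = of_real \<epsilon>"
    using assms by (simp flip: of_real_power)
qed (use assms in auto)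

context dihedral_cover
begin

lemma cover_quotient:
  assumes "F v = 1" "z ^ n = A v + B v" "z \<noteq> 0"
  shows "(v, z, H v / z) \<in> cover"
proof -
  have "H v ^ n = (A v + B v) * (A v - B v)" using identity [of v] assms(1)
    by (simp add: algebra_simps power2_eq_square)
  then have "(H v / z) ^ n = A v - B v"
    using assms(2,3) by (metis nonzero_mult_div_cancel_left power_divide power_not_zero)
  then show ?thesis using assms by (simp add: cover_def)
qed

lemma continuous_on_F_A_B_H:
  assumes "continuous_on S g"
  shows "continuous_on S (\<lambda>x. F (g x))" "continuous_on S (\<lambda>x. A (g x))"
    "continuous_on S (\<lambda>x. B (g x))" "continuous_on S (\<lambda>x. H (g x))"
  using assms by (auto intro!: continuous_on_compose2 [OF cont(1)] continuous_on_compose2 [OF cont(2)]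
      continuous_on_compose2 [OF cont(3)] continuous_on_compose2 [OF cont(4)])

lemma power_n_minus_3:
  fixes x :: complex
  shows "x \<noteq> 0 \<Longrightarrow> x ^ (n - 3) = x ^ n * inverse x ^ 3"
  using n3 by (simp add: power_diff divide_inverse power_inverse)

text \<open>
  A small circle around a singular point where \<open>B \<noteq> 0\<close>, in a line on which \<open>F = s\<^sup>2 f(s)\<close>: both
  \<open>\<surd>F\<close> and \<open>A + B \<surd>F\<close> wind once around 0.
\<close>

lemma rotation_monodromy:
  assumes f: "continuous_on UNIV f" "f 0 \<noteq> 0" "\<And>s. F (v + s *s d) = s\<^sup>2 * f s"
    and a: "continuous_on UNIV a" "\<And>s. A (v + s *s d) = s * a s"
    and B: "B v \<noteq> 0" "(a 0)\<^sup>2 = (B v)\<^sup>2 * f 0"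
  shows "\<exists>y\<in>cover. conn y (act ((1, False), 0) y)"
proof -
  define V where "V s = v + s *s d" for s
  have V: "continuous_on S V" for S unfolding V_def by (intro continuous_intros)
  \<comment> \<open>This sixth root selects the branch \<open>s r^3\<close> of the square root of
    \<open>F\<close> for which the first order terms of \<open>A\<close> and
    \<open>B \<surd>F\<close> agree instead of cancelling, so that
    \<open>G 0 = 2 a 0\<close>.\<close>
  obtain c where c: "a 0 / B v = c ^ 3" by (rule exists_complex_root [of 3]) simp
  have "c ^ 6 = (c ^ 3)\<^sup>2" by (simp flip: power_mult)
  also have "\<dots> = f 0" using B by (simp add: power_divide flip: c)
  finally have c6: "c ^ 6 = f 0" .
  obtain \<epsilon>1 r where r: "0 < \<epsilon>1" "continuous_on (cball 0 \<epsilon>1) r" "r 0 = c"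
    "\<And>s. s \<in> cball 0 \<epsilon>1 \<Longrightarrow> r s ^ 6 = f s" "\<And>s. r s \<noteq> 0"
    using local_root [OF continuous_on_subset [OF f(1) subset_UNIV] zero_less_one zero_less_numeral c6 f(2)] by metis
  define G where "G s = a s + B (V s) * r s ^ 3" for s
  have G: "continuous_on (cball 0 \<epsilon>1) G"
    unfolding G_def by (intro continuous_intros continuous_on_subset [OF a(1)] continuous_on_F_A_B_H V r) auto
  have "a 0 \<noteq> 0" using B f by auto
  have "G 0 = 2 * a 0" using B(1) c by (simp add: G_def V_def r(3) field_simps)
  then have G0: "G 0 \<noteq> 0" using \<open>a 0 \<noteq> 0\<close> by simp
  obtain c' where c': "G 0 = c' ^ n" by (rule exists_complex_root [of n]) (use n_pos in simp)
  obtain \<epsilon> \<rho> where \<rho>: "0 < \<epsilon>" "\<epsilon> \<le> \<epsilon>1" "continuous_on (cball 0 \<epsilon>) \<rho>"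
    "\<And>s. s \<in> cball 0 \<epsilon> \<Longrightarrow> \<rho> s ^ n = G s" "\<And>s. \<rho> s \<noteq> 0"
    using local_root [OF G r(1) n_pos c' [symmetric] G0] by metis
  obtain e3 where e3: "e3 ^ 3 = complex_of_real \<epsilon>" "e3 \<noteq> 0" using real_root_complex [OF \<rho>(1), of 3] by auto
  obtain en where en: "en ^ n = complex_of_real \<epsilon>" "en \<noteq> 0" using real_root_complex [OF \<rho>(1) n_pos] by auto
  \<comment> \<open>While \<open>s\<close> runs once around the circle, \<open>l\<close> and
    \<open>m\<close> follow a cube root and an n-th root of it.\<close>
  define s where "s t = of_real \<epsilon> * cis (2 * pi * t)" for t
  define l where "l t = e3 * cis (2 * pi * t / 3)" for t
  define m where "m t = en * cis (2 * pi * t / n)" for t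
  have sl: "l t ^ 3 = s t" "m t ^ n = s t" "l t \<noteq> 0" "m t \<noteq> 0" "s t \<noteq> 0" for t
    using e3 en n_pos \<rho>(1) by (simp_all add: l_def m_def s_def power_mult_distrib Complex.DeMoivre mult.assoc)
  have s_ball: "s t \<in> cball 0 \<epsilon>" "s t \<in> cball 0 \<epsilon>1" for t
    using \<rho>(1,2) by (simp_all add: s_def norm_mult)
  have cts: "continuous_on {0..1} s" "continuous_on {0..1} l" "continuous_on {0..1} m"
    unfolding s_def l_def m_def using n_pos by (auto intro!: continuous_intros)
  have comp: "continuous_on {0..1} (\<lambda>t. r (s t))" "continuous_on {0..1} (\<lambda>t. \<rho> (s t))"
    using s_ball by (auto intro!: continuous_on_compose2 [OF r(2) cts(1)] continuous_on_compose2 [OF \<rho>(3) cts(1)])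
  \<comment> \<open>Since \<open>l^6 r^6 = s^2 f\<close> equals \<open>F\<close>, scaling by
    \<open>\<mu>\<close> moves the loop to \<open>F = 1\<close>.\<close>
  define \<mu> where "\<mu> t = inverse (l t * r (s t))" for t
  define z where "z t = \<mu> t * m t * \<rho> (s t)" for t
  have \<mu>: "continuous_on {0..1} \<mu>" "\<mu> t \<noteq> 0" for t
    unfolding \<mu>_def using sl r(5) by (auto intro!: continuous_intros cts comp)
  have z: "continuous_on {0..1} z" "z t \<noteq> 0" for t
    unfolding z_def using sl \<rho>(5) \<mu> by (auto intro!: continuous_intros cts comp)
  define w where "w t = \<mu> t *s V (s t)" for t
  have w: "continuous_on {0..1} w" 
    unfolding w_def by (intro continuous_intros \<mu> continuous_on_compose2 [OF V [of UNIV] cts(1)]) auto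
  define h where "h t = (w t, z t, H (w t) / z t)" for t
  have h: "h t \<in> cover" for t
    unfolding h_def
  proof (rule cover_quotient)
    have "\<mu> t ^ 6 = inverse ((l t ^ 3)\<^sup>2 * r (s t) ^ 6)"
      by (simp add: \<mu>_def power_inverse power_mult_distrib flip: power_mult)
    also have "\<dots> = inverse (F (V (s t)))"
      by (simp add: sl r(4) [OF s_ball(2)] f(3) V_def)
    finally have "\<mu> t ^ 6 * F (V (s t)) = inverse (F (V (s t))) * F (V (s t))" by simp
    moreover have "f (s t) \<noteq> 0" using r(4) [OF s_ball(2)] r(5) by (metis power_not_zero)
    then have "F (V (s t)) \<noteq> 0" using sl(5) by (simp add: f(3) V_def)
    ultimately show "F (w t) = 1" by (simp add: w_def hom(1))
    have "inverse (\<mu> t) ^ 3 = s t * r (s t) ^ 3" by (simp add: \<mu>_def power_mult_distrib sl)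
    moreover have "A (w t) = \<mu> t ^ n * (s t * a (s t))" "B (w t) = \<mu> t ^ n * inverse (\<mu> t) ^ 3 * B (V (s t))"
      by (simp_all only: w_def hom power_n_minus_3 \<mu>(2) V_def a(2) not_False_eq_True simp_thms)
    ultimately have "A (w t) + B (w t) = \<mu> t ^ n * (s t * G (s t))"
      by (simp add: G_def algebra_simps)
    also have "\<dots> = z t ^ n"
      by (simp add: z_def power_mult_distrib sl \<rho>(4) [OF s_ball(1)])
    finally show "z t ^ n = A (w t) + B (w t)" ..
  qed (rule z)
  have s1: "s 1 = s 0" by (simp add: s_def)
  \<comment> \<open>Along the loop \<open>l\<close> gains a primitive cube root of unity, so
    \<open>\<mu>\<close> gains its inverse, which has index 2.\<close>
  have u: "unit_root 3 2 = inverse (cis (2 * pi / 3))"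
  proof -
    have "unit_root 3 1 * unit_root 3 2 = 1" using unit_root_period [of 3 1] by (simp flip: unit_root_add)
    moreover have "unit_root 3 1 = cis (2 * pi / 3)" by (simp add: unit_root_def)
    ultimately have "cis (2 * pi / 3) * unit_root 3 2 = 1" by simp
    then show ?thesis by (rule inverse_unique [symmetric])
  qed
  have l1: "\<mu> 1 = unit_root 3 2 * \<mu> 0"
    by (simp add: \<mu>_def l_def s1 u inverse_mult_distrib)
  have m1: "m 1 = unit_root n 1 * m 0" by (simp add: m_def unit_root_def)
  have w1: "w 1 = unit_root 3 2 *s w 0" by (simp add: w_def l1 s1 vector_smult_assoc)
  have z1: "z 1 = unit_root 3 2 * unit_root n 1 * z 0" by (simp add: z_def l1 m1 s1)
  have "unit_root n (- 1) = inverse (unit_root n 1)"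
    by (rule inverse_unique [symmetric]) simp
  then have "H (w 1) / z 1 = unit_root 3 2 * unit_root n (- 1) * (H (w 0) / z 0)"
    by (simp add: w1 z1 hom(4) power2_eq_square field_simps z)
  then have h1: "h 1 = act ((0, False), 2) (act ((1, False), 0) (h 0))"
    using n3 by (simp add: act_act mult_D, simp add: h_def dihedral_act_def Let_def w1 z1)
  have "path h" unfolding path_def h_def
    by (intro continuous_intros w z continuous_on_F_A_B_H) (use z in auto)
  moreover have "path_image h \<subseteq> cover" using h by (auto simp: path_image_def)
  ultimately have "path_component cover (h 0) (h 1)"
    unfolding path_component_def by (auto simp: pathstart_def pathfinish_def)
  then have "conn (h 0) (act ((1, False), 0) (h 0))"
    unfolding conn_def h1 by (rule bexI) simp
  then show ?thesis using h by blast
qed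

text \<open>A small circle around a simple zero of \<open>F\<close> on a line: \<open>\<surd>F\<close> changes its sign.\<close>

lemma reflection_monodromy:
  assumes f: "continuous_on UNIV f" "f 0 \<noteq> 0" "\<And>s. F (v + s *s d) = s * f s"
    and A: "A v \<noteq> 0"
  shows "\<exists>y\<in>cover. \<exists>c\<in>{0..<int n}. conn y (act ((c, True), 0) y)"
proof -
  define V where "V s = v + s *s d" for s
  have V: "continuous_on S V" for S unfolding V_def by (intro continuous_intros)
  obtain c where c: "f 0 = c ^ 6" by (rule exists_complex_root [of 6]) simp
  obtain \<epsilon>1 r where r: "0 < \<epsilon>1" "\<epsilon>1 \<le> 1" "continuous_on (cball 0 \<epsilon>1) r" "r 0 = c"
    "\<And>s. s \<in> cball 0 \<epsilon>1 \<Longrightarrow> r s ^ 6 = f s" "\<And>s. r s \<noteq> 0"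
    using local_root [OF continuous_on_subset [OF f(1) subset_UNIV] zero_less_one zero_less_numeral c [symmetric] f(2)]
    by metis
  have sq: "\<sigma>\<^sup>2 \<in> cball 0 \<epsilon>1" if "\<sigma> \<in> cball 0 \<epsilon>1" for \<sigma> :: complex
  proof -
    have "norm \<sigma> * norm \<sigma> \<le> 1 * \<epsilon>1" using that r(1,2) by (intro mult_mono) auto
    then show ?thesis by (simp add: norm_mult power2_eq_square)
  qed
  have r2: "continuous_on (cball 0 \<epsilon>1) (\<lambda>\<sigma>. r (\<sigma>\<^sup>2))"
    using sq by (intro continuous_on_compose2 [OF r(3)] continuous_intros) auto
  \<comment> \<open>With \<open>s = \<sigma>^2\<close> the square root of \<open>F\<close> becomes
    the function \<open>\<sigma> r^3\<close>, which vanishes at 0, so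
    \<open>G 0 = A v\<close>.\<close>
  define G where "G \<sigma> = A (V (\<sigma>\<^sup>2)) + B (V (\<sigma>\<^sup>2)) * (\<sigma> * r (\<sigma>\<^sup>2) ^ 3)" for \<sigma>
  have V2: "continuous_on S (\<lambda>\<sigma>. V (\<sigma>\<^sup>2))" for S unfolding V_def by (intro continuous_intros)
  have G: "continuous_on (cball 0 \<epsilon>1) G"
    unfolding G_def by (intro continuous_intros continuous_on_F_A_B_H V2 r2)
  have G0: "G 0 \<noteq> 0" using A by (simp add: G_def V_def)
  obtain c' where c': "G 0 = c' ^ n" by (rule exists_complex_root [of n]) (use n_pos in simp)
  obtain \<epsilon> \<rho> where \<rho>: "0 < \<epsilon>" "\<epsilon> \<le> \<epsilon>1" "continuous_on (cball 0 \<epsilon>) \<rho>"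
    "\<And>s. s \<in> cball 0 \<epsilon> \<Longrightarrow> \<rho> s ^ n = G s" "\<And>s. \<rho> s \<noteq> 0"
    using local_root [OF G r(1) n_pos c' [symmetric] G0] by metis
  obtain e3 where e3: "e3 ^ 3 = complex_of_real \<epsilon>" "e3 \<noteq> 0" using real_root_complex [OF \<rho>(1), of 3] by auto
  \<comment> \<open>Half a turn of \<open>\<sigma>\<close> is a full turn of
    \<open>s = \<sigma>^2\<close>.\<close>
  define \<sigma> where "\<sigma> t = of_real \<epsilon> * cis (pi * t)" for t
  define s where "s t = (\<sigma> t)\<^sup>2" for t
  define l where "l t = e3 * cis (pi * t / 3)" for t
  have sl: "l t ^ 3 = \<sigma> t" "l t \<noteq> 0" "\<sigma> t \<noteq> 0" for t
    using e3 \<rho>(1) by (simp_all add: l_def \<sigma>_def power_mult_distrib Complex.DeMoivre)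
  have \<sigma>_ball: "\<sigma> t \<in> cball 0 \<epsilon>" "\<sigma> t \<in> cball 0 \<epsilon>1" for t
    using \<rho>(1,2) by (simp_all add: \<sigma>_def norm_mult)
  have s_ball: "s t \<in> cball 0 \<epsilon>1" for t
    unfolding s_def by (rule sq [OF \<sigma>_ball(2)])
  have cts: "continuous_on {0..1} \<sigma>" "continuous_on {0..1} l"
    unfolding \<sigma>_def l_def by (intro continuous_intros; simp)+
  then have cs: "continuous_on {0..1} s" unfolding s_def by (intro continuous_intros)
  have comp: "continuous_on {0..1} (\<lambda>t. r (s t))" "continuous_on {0..1} (\<lambda>t. \<rho> (\<sigma> t))"
    using s_ball \<sigma>_ball by (auto intro!: continuous_on_compose2 [OF r(3) cs] continuous_on_compose2 [OF \<rho>(3) cts(1)])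
  define \<mu> where "\<mu> t = inverse (l t * r (s t))" for t
  define z where "z t = \<mu> t * \<rho> (\<sigma> t)" for t
  have \<mu>: "continuous_on {0..1} \<mu>" "\<mu> t \<noteq> 0" for t
    unfolding \<mu>_def using sl r(6) by (auto intro!: continuous_intros cts comp)
  have z: "continuous_on {0..1} z" "z t \<noteq> 0" for t
    unfolding z_def using sl \<rho>(5) \<mu> by (auto intro!: continuous_intros cts comp)
  define w where "w t = \<mu> t *s V (s t)" for t
  have w: "continuous_on {0..1} w" 
    unfolding w_def by (intro continuous_intros \<mu> continuous_on_compose2 [OF V [of UNIV] cs]) auto
  define h where "h t = (w t, z t, H (w t) / z t)" for t
  have h: "h t \<in> cover" for t
    unfolding h_def
  proof (rule cover_quotient)
    have "\<mu> t ^ 6 = inverse ((l t ^ 3)\<^sup>2 * r (s t) ^ 6)"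
      by (simp add: \<mu>_def power_inverse power_mult_distrib flip: power_mult)
    also have "\<dots> = inverse (F (V (s t)))"
      by (simp add: sl r(5) [OF s_ball] f(3) V_def flip: s_def)
    finally have "\<mu> t ^ 6 * F (V (s t)) = inverse (F (V (s t))) * F (V (s t))" by simp
    moreover have "f (s t) \<noteq> 0" using r(5) [OF s_ball] r(6) by (metis power_not_zero)
    then have "F (V (s t)) \<noteq> 0" using sl(3) by (simp add: f(3) V_def s_def)
    ultimately show "F (w t) = 1" by (simp add: w_def hom(1))
    have "inverse (\<mu> t) ^ 3 = \<sigma> t * r (s t) ^ 3" by (simp add: \<mu>_def power_mult_distrib sl)
    then have "A (w t) + B (w t) = \<mu> t ^ n * G (\<sigma> t)"
      by (simp add: w_def hom power_n_minus_3 \<mu>(2) G_def algebra_simps flip: s_def)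
    also have "\<dots> = z t ^ n"
      by (simp add: z_def power_mult_distrib \<rho>(4) [OF \<sigma>_ball(1)])
    finally show "z t ^ n = A (w t) + B (w t)" ..
  qed (rule z)
  define u where "u = inverse (cis (pi / 3))"
  have u3: "u ^ 3 = - 1" by (simp add: u_def power_inverse Complex.DeMoivre) (simp add: complex_eq_iff)
  have "s 1 = s 0" by (simp add: s_def \<sigma>_def)
  then have w1: "w 1 = u *s w 0"
    by (simp add: w_def \<mu>_def l_def u_def vector_smult_assoc inverse_mult_distrib)
  have "u ^ 6 = 1" using u3 by (intro power_6_eq_1) simp
  then have "p (h 0) = p (h 1)" by (simp add: p_def h_def w1 sextic_coords_scale)
  \<comment> \<open>Which reflection occurs is left open: the fibre yields some index, and
    \<open>u^3 = - 1\<close> excludes the rotations.\<close>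
  then obtain i where "i \<in> indices" "h 1 = act i (h 0)" using cover_fibre h by blast
  then obtain c t j where i: "c \<in> {0..<int n}" "j \<in> {0..<3}" "h 1 = act ((c, t), j) (h 0)"
    by (auto simp: carrier_D)
  have "w 0 \<noteq> 0" using cover_nonzero(1) [OF h [of 0, unfolded h_def]] .
  moreover have "w 1 = (if t then - unit_root 3 j else unit_root 3 j) *s w 0"
    using i(3) by (simp add: h_def dihedral_act_def Let_def)
  ultimately have "u = (if t then - unit_root 3 j else unit_root 3 j)" unfolding w1 by simp
  then have "t" using u3 unit_root_3(1) [of j] by (auto split: if_splits)
  have "path h" unfolding path_def h_def
    by (intro continuous_intros w z continuous_on_F_A_B_H) (use z in auto)
  moreover have "path_image h \<subseteq> cover" using h by (auto simp: path_image_def)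
  ultimately have "path_component cover (h 0) (h 1)"
    unfolding path_component_def by (auto simp: pathstart_def pathfinish_def)
  moreover have "h 1 = act ((0, False), j) (act ((c, True), 0) (h 0))"
    using i \<open>t\<close> by (simp add: act_act mult_D)
  ultimately have "conn (h 0) (act ((c, True), 0) (h 0))"
    unfolding conn_def using i(2) by auto
  then show ?thesis using h i(1) by blast
qed

end

section \<open>Sextics with dihedral coverings\<close>

lemma poly_eval_line: "poly_eval F (v + t *s w) = poly (insertion (\<lambda>c. [:c:]) (\<lambda>i. [:v $ i, w $ i:]) F) t"
  unfolding poly_insertion by (rule arg_cong [of _ _ "poly_eval F"]) (simp add: vec_eq_iff)

text \<open>Three lines carry the checks for a given sextic: \<open>P + s d\<close> is tangent to
  order at least 4 and serves irreducibility, \<open>v + s e\<close> has a double zero at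
  \<open>v\<close> and yields the rotation, \<open>v' + s e'\<close> has a simple zero at
  \<open>v'\<close> and yields a reflection.\<close>

lemma dihedral_sextic:
  fixes F A B H :: ternary_poly
  assumes n: "n = 5 \<or> n = 7"
    and degs: "homogeneous 6 F" "homogeneous n A" "homogeneous (n - 3) B" "homogeneous 2 H"
    and identity: "\<And>v. (poly_eval A v)\<^sup>2 - (poly_eval B v)\<^sup>2 * poly_eval F v = poly_eval H v ^ n"
    and no_common_zero: "\<And>v. poly_eval B v = 0 \<Longrightarrow> poly_eval H v = 0 \<Longrightarrow> poly_eval F v = 0"
    and sing: "\<And>v. v \<noteq> 0 \<Longrightarrow> poly_eval F v = 0 \<Longrightarrow> (poly_eval F has_derivative (\<lambda>_. 0)) (at v) \<Longrightarrow>
      cuspidal_at n F v \<and> has_singularity_type F (proj v) (A_type (n - 1))"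
    and P: "cuspidal_at n F P" "\<And>s. poly_eval F (P + s *s d) = s ^ 4 * poly g s" "g \<noteq> 0"
    and rot: "\<And>s. poly_eval F (v + s *s e) = s\<^sup>2 * poly f s" "poly f 0 \<noteq> 0"
      "\<And>s. poly_eval A (v + s *s e) = s * poly a s" "poly_eval B v \<noteq> 0"
      "(poly a 0)\<^sup>2 = (poly_eval B v)\<^sup>2 * poly f 0"
    and refl: "\<And>s. poly_eval F (v' + s *s e') = s * poly f' s" "poly f' 0 \<noteq> 0" "poly_eval A v' \<noteq> 0"
  shows "plane_sextic F \<and> irreducible F \<and> simple_singularities F \<and>
    (\<forall>b \<in> - curve F. epi (fundamental_group (- curve F) b) (dihedral_group n) \<noteq> {}) \<and> \<not> torus_type F"
proof (intro conjI ballI)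
  have "F \<noteq> 0"
  proof
    assume "F = 0"
    then have "poly g s = 0" if "s \<noteq> 0" for s using P(2) [of s] that by (simp add: poly_eval_insertion)
    then have "- {0} \<subseteq> {s. poly g s = 0}" by auto
    moreover have "infinite (- {0 :: complex})"
      by (simp add: Compl_eq_Diff_UNIV infinite_UNIV_char_0)
    ultimately show False using P(3) poly_roots_finite infinite_super by blast
  qed
  then show "plane_sextic F" using degs(1) by (simp add: plane_sextic_def)
  show "irreducible F"
    using irreducible_sexticI [OF degs(1) \<open>F \<noteq> 0\<close> _ _ P] n sing by force
  show "simple_singularities F"
    unfolding simple_singularities_def singular_point_def
  proof (intro allI impI)
    fix P assume "\<exists>v. v \<noteq> 0 \<and> P = proj v \<and> poly_eval F v = 0 \<and> (poly_eval F has_derivative (\<lambda>_. 0)) (at v)"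
    then show "\<exists>T. valid_type T \<and> has_singularity_type F P T"
      using sing n by (intro exI [of _ "A_type (n - 1)"]) auto
  qed
  show "\<not> torus_type F"
    using not_torus_typeI [OF _ n] sing by blast
  fix b assume b: "b \<in> - curve F"
  interpret dihedral_cover n "poly_eval F" "poly_eval A" "poly_eval B" "poly_eval H"
    by unfold_locales
      (use n identity no_common_zero in \<open>auto simp: continuous_on_poly_eval poly_eval_scale [OF degs(1)]
        poly_eval_scale [OF degs(2)] poly_eval_scale [OF degs(3)] poly_eval_scale [OF degs(4)]\<close>)
  have compl: "complement = - curve F"
  proof (rule Set.set_eqI)
    fix P
    obtain v where "v \<noteq> 0" "P = proj v" by (rule proj_cases)
    then show "P \<in> complement \<longleftrightarrow> P \<in> - curve F"
      using proj_in_complement_iff proj_in_curve_iff [OF degs(1)] by simp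
  qed
  have pc: "path_connected {v. poly_eval F v \<noteq> 0}"
    by (rule path_connected_nonzero) (use poly_eval_line in blast)
  have cp: "continuous_on UNIV (poly q)" for q :: "complex poly"
    by (rule continuous_on_poly [OF continuous_on_id])
  obtain y where y: "y \<in> cover" "conn y (act ((1, False), 0) y)"
    using rotation_monodromy [of "poly f" v e "poly a", OF cp rot(2,1) cp rot(3-5)] by blast
  obtain z c where z: "z \<in> cover" "c \<in> {0..<int n}" "conn z (act ((c, True), 0) z)"
    using reflection_monodromy [of "poly f'" v' e', OF cp refl(2,1,3)] by blast
  show "epi (fundamental_group (- curve F) b) (dihedral_group n) \<noteq> {}"
    using epi_dihedral [OF pc y z] b compl by simp
qed

section \<open>Explicit singular points\<close>

abbreviation vec3 :: "complex \<Rightarrow> complex \<Rightarrow> complex \<Rightarrow> complex ^ 3" where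
  "vec3 x y z \<equiv> vector [x, y, z]"

lemma vec3_eqI: "v $ 1 = x \<Longrightarrow> v $ 2 = y \<Longrightarrow> v $ 3 = z \<Longrightarrow> v = vec3 x y z"
  by (simp add: vec_eq_iff forall_3)

lemma vec3_lin: "vec3 x y z + c *s vec3 a b d = vec3 (x + c * a) (y + c * b) (z + c * d)"
  "c *s vec3 a b d = vec3 (c * a) (c * b) (c * d)"
  "vec3 x y z + vec3 a b d = vec3 (x + a) (y + b) (z + d)"
  by (simp_all add: vec_eq_iff forall_3)

lemma vec3_eq_0_iff: "vec3 x y z = 0 \<longleftrightarrow> x = 0 \<and> y = 0 \<and> z = 0"
  by (simp add: vec_eq_iff forall_3)

lemma span_eq_UNIV_iff:
  "vec.span {v, a, b} = UNIV \<longleftrightarrow> (\<forall>w :: complex ^ 3. \<exists>k l m. w = k *s v + l *s a + m *s b)"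
proof -
  have "w \<in> vec.span {v, a, b} \<longleftrightarrow> (\<exists>k l m. w = k *s v + l *s a + m *s b)" for w :: "complex ^ 3"
    unfolding vec.span_breakdown_eq vec.span_empty
    by (auto simp: algebra_simps eq_diff_eq)
  then show ?thesis by auto
qed

text \<open>A linear symmetry carries an affine chart at \<open>v\<close> to one at
  \<open>r v\<close> with the same germ, so one point of each orbit suffices.\<close>

lemma has_singularity_type_symmetry:
  fixes r :: "complex ^ 3 \<Rightarrow> complex ^ 3"
  assumes lin: "\<And>u w. r (u + w) = r u + r w" "\<And>c w. r (c *s w) = c *s r w" and "inj r" "surj r"
    and F: "\<And>w. poly_eval F (r w) = poly_eval F w"
    and T: "has_singularity_type F (proj v) T" "v \<noteq> 0"
  shows "has_singularity_type F (proj (r v)) T"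
proof -
  obtain w a b where w: "w \<noteq> 0" "proj v = proj w" "vec.span {w, a, b} = UNIV"
    "equivalent_germs (\<lambda>z. poly_eval F (w + z $ 1 *s a + z $ 2 *s b)) (normal_form T)"
    using T(1) unfolding has_singularity_type_def by blast
  have r0: "r 0 = 0" using lin(2) [of 0 0] by simp
  have nz: "r u \<noteq> 0" if "u \<noteq> 0" for u using that \<open>inj r\<close> r0 by (metis injD)
  obtain c where "w = c *s v" using proj_eq_iff [OF T(2) w(1)] w(2) by auto
  then have "proj (r v) = proj (r w)" using proj_eq_iff nz T(2) w(1) lin(2) by metis
  moreover have "vec.span {r w, r a, r b} = UNIV"
    unfolding span_eq_UNIV_iff
  proof
    fix u
    obtain u' where "u = r u'" using \<open>surj r\<close> by (metis surjD)
    moreover obtain k l m where "u' = k *s w + l *s a + m *s b" using w(3) span_eq_UNIV_iff by blast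
    ultimately show "\<exists>k l m. u = k *s r w + l *s r a + m *s r b" using lin by metis
  qed
  moreover have "(\<lambda>z :: complex ^ 2. poly_eval F (r w + z $ 1 *s r a + z $ 2 *s r b)) = (\<lambda>z. poly_eval F (w + z $ 1 *s a + z $ 2 *s b))"
    by (simp flip: lin add: F)
  ultimately show ?thesis
    unfolding has_singularity_type_def using w nz
    by - (rule exI [of _ "r w"], rule exI [of _ "r a"], rule exI [of _ "r b"], simp)
qed

lemma poly_poly_eqI:
  fixes f g :: "complex poly poly"
  assumes "\<And>x t. poly (poly f [:x:]) t = poly (poly g [:x:]) t"
  shows "f = g"
proof -
  have "coeff f i = coeff g i" for i
  proof -
    have "poly (coeff f i) t = poly (coeff g i) t" for t
    proof -
      have e: "poly (poly h [:x:]) t = poly (map_poly (\<lambda>c. poly c t) h) x" for h :: "complex poly poly" and x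
        by (induction h) (auto simp: map_poly_pCons)
      have "map_poly (\<lambda>c. poly c t) f = map_poly (\<lambda>c. poly c t) g"
        using assms [of _ t] unfolding e by (simp add: fun_eq_iff flip: poly_eq_poly_eq_iff)
      then have "coeff (map_poly (\<lambda>c. poly c t) f) i = coeff (map_poly (\<lambda>c. poly c t) g) i" by simp
      then show ?thesis by (simp add: coeff_map_poly)
    qed
    then show ?thesis by (simp add: fun_eq_iff flip: poly_eq_poly_eq_iff)
  qed
  then show ?thesis by (simp add: poly_eq_iff)
qed

text \<open>A nested polynomial is determined by its values at \<open>x\<close> and
  \<open>t\<close>, so the local equation can be verified as one identity of complex numbers. The
  outer variable is \<open>x\<close>, the inner one \<open>t\<close>.\<close>

lemma cuspidal_atI:
  assumes F: "\<And>x t. poly_eval F (\<chi> i. poly (poly (\<Gamma> i) [:x:]) t) =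
      t ^ n * poly W t + x * (t ^ ((n + 1) div 2) * poly V t) + x\<^sup>2 * poly (poly U [:x:]) t"
    and "\<And>i. poly (poly (\<Gamma> i) 0) 0 = v $ i" "poly W 0 \<noteq> 0" "poly (poly U 0) 0 \<noteq> 0"
  shows "cuspidal_at n F v"
proof -
  have "insertion bivariate \<Gamma> F = pCons (monom 1 n * W) (pCons (monom 1 ((n + 1) div 2) * V) U)"
  proof (rule poly_poly_eqI)
    fix x t
    have "poly (poly (insertion bivariate \<Gamma> F) [:x:]) t = insertion (\<lambda>c. c) (\<lambda>i. poly (poly (\<Gamma> i) [:x:]) t) F"
      by (rule insertion_hom_comp) (auto simp: coeff_hom_bivariate coeff_hom_id)
    also have "\<dots> = poly_eval F (\<chi> i. poly (poly (\<Gamma> i) [:x:]) t)" by (simp add: poly_eval_insertion)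
    also have "\<dots> = poly (poly (pCons (monom 1 n * W) (pCons (monom 1 ((n + 1) div 2) * V) U)) [:x:]) t"
      unfolding F by (simp add: poly_monom power2_eq_square algebra_simps)
    finally show "poly (poly (insertion bivariate \<Gamma> F) [:x:]) t = \<dots>" .
  qed
  then show ?thesis
    unfolding cuspidal_at_def using assms
    by (intro exI [of _ \<Gamma>] exI [of _ W] exI [of _ V]) (simp add: poly_0_coeff_0 numeral_2_eq_2)
qed

lemma directional_derivative_0:
  assumes "(poly_eval F has_derivative (\<lambda>_. 0)) (at v)"
  shows "((\<lambda>t. poly_eval F (v + t *s w)) has_field_derivative 0) (at 0)"
proof -
  have "((\<lambda>t. \<chi> i. v $ i + t * w $ i) has_derivative (\<lambda>t. \<chi> i. t * w $ i)) (at 0)"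
    by (rule has_derivative_vec_lambda) (auto intro!: derivative_eq_intros)
  moreover have "(\<lambda>t. v + t *s w) = (\<lambda>t. \<chi> i. v $ i + t * w $ i)" by (simp add: fun_eq_iff vec_eq_iff)
  ultimately have 1: "((\<lambda>t. v + t *s w) has_derivative (\<lambda>t. \<chi> i. t * w $ i)) (at 0)" by simp
  have "(poly_eval F has_derivative (\<lambda>_. 0)) (at (v + 0 *s w))" using assms by simp
  from has_derivative_compose [OF 1 this] show ?thesis
    by (simp add: has_field_derivative_def lambda_zero [symmetric])
qed

lemma proj_scale: "c \<noteq> 0 \<Longrightarrow> v \<noteq> 0 \<Longrightarrow> proj (c *s v) = proj v"
  by (subst proj_eq_iff) (auto intro!: exI [of _ "inverse c"] simp: vector_smult_assoc)

subsection \<open>A sextic with four points of type A4\<close>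

abbreviation "X \<equiv> var3 1"
abbreviation "Y \<equiv> var3 2"
abbreviation "Z \<equiv> var3 3"

text \<open>
  With \<open>H' = Z\<^sup>2 - (X + Y)\<^sup>2\<close> one has \<open>H5 - H' = 4 X Y\<close>, so that \<open>F5 = A'\<^sup>2 - H5\<^sup>2 H' = A''\<^sup>2 - H'\<^sup>2 H5\<close>
  for \<open>A' = H5 X + H' Y\<close> and \<open>A'' = H' Y - H5 X\<close>. The form \<open>A5 + B5 \<surd>F5\<close> is
  \<open>(A' + \<surd>F5)\<^sup>2 (A'' + \<surd>F5) / H'\<^sup>2\<close>.
\<close>

definition H5 :: ternary_poly where "H5 = Z ^ 2 - (X - Y) ^ 2"
definition B5 :: ternary_poly where "B5 = 4 * Y ^ 2 - H5"
definition A5 :: ternary_poly where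
  "A5 = B5 * (H5 * X + (Z ^ 2 - (X + Y) ^ 2) * Y) - 2 * (Y * H5 ^ 2)"
definition F5 :: ternary_poly where
  "F5 = (H5 * X + (Z ^ 2 - (X + Y) ^ 2) * Y) ^ 2 - H5 ^ 2 * (Z ^ 2 - (X + Y) ^ 2)"

definition f5 :: "complex \<Rightarrow> complex \<Rightarrow> complex \<Rightarrow> complex" where
  "f5 x y z = ((z\<^sup>2 - (x - y)\<^sup>2) * x + (z\<^sup>2 - (x + y)\<^sup>2) * y)\<^sup>2 - (z\<^sup>2 - (x - y)\<^sup>2)\<^sup>2 * (z\<^sup>2 - (x + y)\<^sup>2)"

lemmas homogeneous_intros = homogeneous_add homogeneous_diff homogeneous_numeral_mult homogeneous_mult
  homogeneous_power homogeneous_var3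

lemma homogeneous_5: "homogeneous 2 H5" "homogeneous 2 B5" "homogeneous 5 A5" "homogeneous 6 F5"
proof -
  show H: "homogeneous 2 H5" unfolding H5_def by (rule homogeneous_intros refl | simp)+
  show B: "homogeneous 2 B5" unfolding B5_def by (rule H homogeneous_intros refl | simp)+
  show "homogeneous 5 A5" unfolding A5_def by (rule H B homogeneous_intros refl | simp)+
  show "homogeneous 6 F5" unfolding F5_def by (rule H homogeneous_intros refl | simp)+
qed

lemma eval_F5: "poly_eval F5 v = f5 (v $ 1) (v $ 2) (v $ 3)"
  by (simp add: F5_def H5_def f5_def poly_eval_simps)

lemma eval_F5_vec3: "poly_eval F5 (vec3 x y z) = f5 x y z"
  by (simp add: eval_F5)

text \<open>The symmetry of order 4 that permutes the four singular points cyclically.\<close>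

lemma f5_rotate: "f5 (- y) x z = f5 x y z"
  unfolding f5_def by algebra

lemma f5_reflect: "f5 (- x) (- y) z = f5 x y z"
  using f5_rotate [of x "- y" z] f5_rotate [of y x z] by simp

lemma identity_5: "(poly_eval A5 v)\<^sup>2 - (poly_eval B5 v)\<^sup>2 * poly_eval F5 v = poly_eval H5 v ^ 5"
proof -
  \<comment> \<open>The two conics enter only through their difference \<open>h - k = 4 x y\<close>,
    so they can be replaced by variables.\<close>
  have *: "(b * (h * x + k * y) - 2 * (y * h\<^sup>2))\<^sup>2 - b\<^sup>2 * ((h * x + k * y)\<^sup>2 - h\<^sup>2 * k) = h ^ 5"
    if "k = h - 4 * x * y" "b = 4 * y\<^sup>2 - h" for b h k x y :: complex
    unfolding that by algebra
  show ?thesis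
    by (simp add: A5_def B5_def F5_def poly_eval_simps, rule *)
      (simp_all add: H5_def poly_eval_simps power2_eq_square algebra_simps)
qed

text \<open>The curve \<open>t \<mapsto> (t, 1, 1 + t + 2 t\<^sup>2)\<close> approximates the branch at \<open>(0, 1, 1)\<close>.\<close>

lemma f5_expansion:
  "f5 t 1 (1 + t + 2 * t\<^sup>2 + x) =
    t ^ 5 * poly [:-64, -192, -384, -512, -512, -368, -192, -64:] t +
    x * (t ^ 3 * poly [:-64, -224, -560, -864, -1008, -832, -480, -192:] t) +
    x\<^sup>2 * poly (poly [:[:4, -16, -72, -272, -524, -744, -744, -480, -240:], [:-4, -44, -132, -244, -328, -240, -160:],
      [:-11, -30, -71, -60, -60:], [:-6, -6, -12:], [:-1:]:] [:x:]) t"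
  unfolding f5_def by (simp add: power2_eq_square) algebra

text \<open>The polynomials \<open>a\<close>, \<open>b\<close> stand for the images of
  \<open>t\<close> and 1 under a symmetry, so that one expansion serves all four points.\<close>

lemma cuspidal_5I:
  assumes "\<And>t z. f5 (poly a t) (poly b t) z = f5 t 1 z"
  shows "cuspidal_at 5 F5 (vec3 (poly a 0) (poly b 0) 1)"
proof (rule cuspidal_atI)
  let ?\<Gamma> = "\<lambda>i :: 3. if i = 1 then [:a:] else if i = 2 then [:b:] else [:[:1, 1, 2:], 1:]"
  show "poly_eval F5 (\<chi> i. poly (poly (?\<Gamma> i) [:x:]) t) =
    t ^ 5 * poly [:-64, -192, -384, -512, -512, -368, -192, -64:] t +
    x * (t ^ ((5 + 1) div 2) * poly [:-64, -224, -560, -864, -1008, -832, -480, -192:] t) +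
    x\<^sup>2 * poly (poly [:[:4, -16, -72, -272, -524, -744, -744, -480, -240:], [:-4, -44, -132, -244, -328, -240, -160:],
      [:-11, -30, -71, -60, -60:], [:-6, -6, -12:], [:-1:]:] [:x:]) t" for x t
  proof -
    have "poly_eval F5 (\<chi> i. poly (poly (?\<Gamma> i) [:x:]) t) = f5 t 1 (1 + t + 2 * t\<^sup>2 + x)"
      by (simp add: eval_F5 assms power2_eq_square algebra_simps)
    then show ?thesis by (simp only: f5_expansion) simp
  qed
  show "poly (poly (?\<Gamma> i) 0) 0 = vec3 (poly a 0) (poly b 0) 1 $ i" for i
    using exhaust_3 [of i] by auto
qed simp_all

lemma DERIV_f5:
  "((\<lambda>t. f5 (x + t) y z) has_field_derivative
    12*x^5 - 20*x^4*y + 24*x^3*y^2 - 20*x^3*z^2 + 12*x^2*y*z^2 + 12*x*y^4 - 12*x*y^2*z^2 + 8*x*z^4 + 4*y^5 - 4*y^3*z^2) (at 0)"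
  "((\<lambda>t. f5 x (y + t) z) has_field_derivative
    -4*x^5 + 12*x^4*y + 4*x^3*z^2 + 24*x^2*y^3 - 12*x^2*y*z^2 + 20*x*y^4 - 12*x*y^2*z^2 + 12*y^5 - 20*y^3*z^2 + 8*y*z^4) (at 0)"
  "((\<lambda>t. f5 x y (z + t)) has_field_derivative
    -10*x^4*z + 8*x^3*y*z - 12*x^2*y^2*z + 16*x^2*z^3 - 8*x*y^3*z - 10*y^4*z + 16*y^2*z^3 - 6*z^5) (at 0)"
  unfolding f5_def by (auto intro!: derivative_eq_intros) algebra+

text \<open>The singular points are confined to the lines \<open>x = 0\<close> and
  \<open>y = 0\<close>. On each of them the transversal partial derivative is a constant times a
  cube times a difference of squares.\<close>

lemma singular_points_5:
  assumes "v \<noteq> 0" "poly_eval F5 v = 0" "(poly_eval F5 has_derivative (\<lambda>_. 0)) (at v)"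
  obtains c w where "c \<noteq> 0" "v = c *s w" "w \<in> {vec3 0 1 1, vec3 0 (-1) 1, vec3 1 0 1, vec3 (-1) 0 1}"
proof -
  define x y z where "x = v $ 1" and "y = v $ 2" and "z = v $ 3"
  have v: "v = vec3 x y z" by (rule vec3_eqI) (simp_all add: x_def y_def z_def)
  have d: "((\<lambda>t. poly_eval F5 (vec3 x y z + t *s w)) has_field_derivative 0) (at 0)" for w
    using directional_derivative_0 [OF assms(3)] by (simp add: v)
  have 1: "12*x^5 - 20*x^4*y + 24*x^3*y^2 - 20*x^3*z^2 + 12*x^2*y*z^2 + 12*x*y^4 - 12*x*y^2*z^2 + 8*x*z^4 + 4*y^5 - 4*y^3*z^2 = 0"
    (is "?fx = 0")
    using DERIV_unique [OF DERIV_f5(1) [of x y z]] d [of "vec3 1 0 0"] by (simp add: vec3_lin eval_F5_vec3)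
  have 2: "-4*x^5 + 12*x^4*y + 4*x^3*z^2 + 24*x^2*y^3 - 12*x^2*y*z^2 + 20*x*y^4 - 12*x*y^2*z^2 + 12*y^5 - 20*y^3*z^2 + 8*y*z^4 = 0"
    (is "?fy = 0")
    using DERIV_unique [OF DERIV_f5(2) [of x y z]] d [of "vec3 0 1 0"] by (simp add: vec3_lin eval_F5_vec3)
  have 3: "-10*x^4*z + 8*x^3*y*z - 12*x^2*y^2*z + 16*x^2*z^3 - 8*x*y^3*z - 10*y^4*z + 16*y^2*z^3 - 6*z^5 = 0"
    (is "?fz = 0")
    using DERIV_unique [OF DERIV_f5(3) [of x y z]] d [of "vec3 0 0 1"] by (simp add: vec3_lin eval_F5_vec3)
  \<comment> \<open>The coefficients were found by linear algebra: \<open>x\<^sup>5 y\<^sup>4\<close> lies in the Jacobian ideal.\<close>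
  have "2880 * x^5 * y^4 =
    (5*x^4 + 15*x^3*y - 55*x^2*y^2 - 12*x^2*z^2 - 115*x*y^3 - 30*x*y*z^2 - 60*y^4 + 60*y^2*z^2) * ?fx +
    (15*x^4 + 65*x^3*y - 15*x^2*y^2 - 6*x^2*z^2 + 65*x*y^3 + 20*y^4 + 60*y^2*z^2) * ?fy +
    (-16*x^3*z - 48*x^2*y*z + 80*x*y^2*z + 80*y^3*z) * ?fz"
    by algebra
  then have xy: "x = 0 \<or> y = 0" unfolding 1 2 3 by simp
  have f: "f5 x y z = 0" using assms(2) by (simp add: v eval_F5_vec3)
  have nz: "x \<noteq> 0 \<or> y \<noteq> 0 \<or> z \<noteq> 0" using assms(1) by (auto simp: v vec3_eq_0_iff)
  have sq: "b = c \<or> b = - c" if "b ^ 3 * (b\<^sup>2 - c\<^sup>2) = 0" "b = 0 \<Longrightarrow> c = 0" for b c :: complex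
    using that by (auto simp: power2_eq_iff)
  \<comment> \<open>Here \<open>f5 0 0 z = - z^6\<close>, so the intersection point of the two lines
    is not on the curve.\<close>
  have z0: "z = 0" if "x = 0" "y = 0" using f that by (simp add: f5_def)
  show ?thesis
  proof (cases "x = 0")
    case True
    have "4 * (y ^ 3 * (y\<^sup>2 - z\<^sup>2)) = ?fx" unfolding True by (simp add: algebra_simps eval_nat_numeral)
    then have "y = z \<or> y = - z" using sq z0 True 1 by simp
    then have "v = z *s vec3 0 1 1 \<or> v = z *s vec3 0 (-1) 1" by (auto simp: v vec3_lin True)
    moreover have "z \<noteq> 0" using nz True \<open>y = z \<or> y = - z\<close> by auto
    ultimately show ?thesis using that by blast
  next
    case False
    then have y: "y = 0" using xy by simp
    have "- 4 * (x ^ 3 * (x\<^sup>2 - z\<^sup>2)) = ?fy" unfolding y by (simp add: algebra_simps eval_nat_numeral)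
    then have "x = z \<or> x = - z" using sq [of x z] False 2 by simp
    then have "v = z *s vec3 1 0 1 \<or> v = z *s vec3 (-1) 0 1" by (auto simp: v vec3_lin y)
    moreover have "z \<noteq> 0" using False \<open>x = z \<or> x = - z\<close> by auto
    ultimately show ?thesis using that by blast
  qed
qed

lemma cuspidal_5:
  "cuspidal_at 5 F5 (vec3 0 1 1)" "cuspidal_at 5 F5 (vec3 0 (-1) 1)"
  "cuspidal_at 5 F5 (vec3 1 0 1)" "cuspidal_at 5 F5 (vec3 (-1) 0 1)"
  using cuspidal_5I [of "[:0, 1:]" "[:1:]"] cuspidal_5I [of "[:0, -1:]" "[:-1:]"]
    cuspidal_5I [of "[:1:]" "[:0, -1:]"] cuspidal_5I [of "[:-1:]" "[:0, 1:]"]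
    f5_reflect [of _ 1] f5_rotate [of 1] f5_reflect [of "-1"] f5_rotate [of "- 1"]
  by (simp_all add: f5_rotate [of "-1", simplified] f5_rotate f5_reflect)

lemma A4_point: "has_singularity_type F5 (proj (vec3 0 1 1)) (A_type 4)"
proof -
  have "has_singularity_type F5 (proj (vec3 0 1 1)) (A_type (5 - 1))"
  proof (rule has_singularity_type_A [OF identity_5])
    show "vec.span {vec3 0 1 1, vec3 1 0 0, vec3 0 0 1} = UNIV"
      unfolding span_eq_UNIV_iff
    proof
      fix w
      show "\<exists>k l m. w = k *s vec3 0 1 1 + l *s vec3 1 0 0 + m *s vec3 0 0 1"
        by (rule exI [of _ "w $ 2"], rule exI [of _ "w $ 1"], rule exI [of _ "w $ 3 - w $ 2"])
          (simp add: vec_eq_iff forall_3)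
    qed
    \<comment> \<open>The determinant of these derivatives is -32, so \<open>A5\<close> and
      \<open>H5\<close> have independent differentials in this chart.\<close>
    show "((\<lambda>t. poly_eval A5 (vec3 0 1 1 + t *s vec3 1 0 0)) has_field_derivative (-8)) (at 0)"
      "((\<lambda>t. poly_eval A5 (vec3 0 1 1 + t *s vec3 0 0 1)) has_field_derivative 8) (at 0)"
      "((\<lambda>t. poly_eval H5 (vec3 0 1 1 + t *s vec3 1 0 0)) has_field_derivative 2) (at 0)"
      "((\<lambda>t. poly_eval H5 (vec3 0 1 1 + t *s vec3 0 0 1)) has_field_derivative 2) (at 0)"
      by (auto simp: vec3_lin A5_def B5_def H5_def poly_eval_simps intro!: derivative_eq_intros)
  qed (auto simp: vec3_eq_0_iff A5_def B5_def H5_def poly_eval_simps)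
  then show ?thesis by simp
qed

lemma A4_points:
  assumes "w \<in> {vec3 0 1 1, vec3 0 (-1) 1, vec3 1 0 1, vec3 (-1) 0 1}"
  shows "has_singularity_type F5 (proj w) (A_type 4)"
proof -
  define r where "r w = vec3 (- (w $ 2)) (w $ 1) (w $ 3)" for w :: "complex ^ 3"
  have r: "has_singularity_type F5 (proj (r w)) (A_type 4)"
    if "has_singularity_type F5 (proj w) (A_type 4)" "w \<noteq> 0" for w
  proof (rule has_singularity_type_symmetry [OF _ _ _ _ _ that])
    show "inj r" by (rule injI) (auto simp: r_def vec_eq_iff forall_3)
    show "surj r"
      by (rule surjI [of r "\<lambda>u. vec3 (u $ 2) (- (u $ 1)) (u $ 3)"]) (simp add: r_def vec_eq_iff forall_3)
    show "poly_eval F5 (r w) = poly_eval F5 w" for w by (simp add: eval_F5 r_def f5_rotate)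
  qed (simp_all add: r_def vec_eq_iff forall_3)
  have rv: "r (vec3 x y z) = vec3 (- y) x z" for x y z by (simp add: r_def)
  have "has_singularity_type F5 (proj (vec3 (-1) 0 1)) (A_type 4)"
    using r [OF A4_point] by (simp add: rv vec3_eq_0_iff)
  moreover from r [OF this] have "has_singularity_type F5 (proj (vec3 0 (-1) 1)) (A_type 4)"
    by (simp add: rv vec3_eq_0_iff)
  moreover from r [OF this] have "has_singularity_type F5 (proj (vec3 1 0 1)) (A_type 4)"
    by (simp add: rv vec3_eq_0_iff)
  ultimately show ?thesis using assms A4_point by blast
qed

theorem dihedral_sextic_5:
  "plane_sextic F5 \<and> irreducible F5 \<and> simple_singularities F5 \<and>
    (\<forall>b \<in> - curve F5. epi (fundamental_group (- curve F5) b) (dihedral_group 5) \<noteq> {}) \<and> \<not> torus_type F5"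
proof (rule dihedral_sextic [where A = A5 and B = B5 and H = H5])
  fix v assume v: "v \<noteq> 0" "poly_eval F5 v = 0" "(poly_eval F5 has_derivative (\<lambda>_. 0)) (at v)"
  obtain c w where c: "c \<noteq> 0" "v = c *s w" "w \<in> {vec3 0 1 1, vec3 0 (-1) 1, vec3 1 0 1, vec3 (-1) 0 1}"
    using singular_points_5 [OF v] by blast
  have "w \<noteq> 0" using v(1) c(2) by auto
  then show "cuspidal_at 5 F5 v \<and> has_singularity_type F5 (proj v) (A_type (5 - 1))"
    using cuspidal_5 A4_points [OF c(3)] c cuspidal_at_scale [OF _ homogeneous_5(4) c(1)] by (auto simp: proj_scale)
next
  fix v assume "poly_eval B5 v = 0" "poly_eval H5 v = 0"
  then show "poly_eval F5 v = 0"
    by (simp add: F5_def B5_def H5_def poly_eval_simps)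
next
  show "cuspidal_at 5 F5 (vec3 0 1 1)" by (rule cuspidal_5)
  \<comment> \<open>The direction is the velocity at \<open>t = 0\<close> of the curve approximating
    the branch.\<close>
  show "poly_eval F5 (vec3 0 1 1 + s *s vec3 1 0 1) = s ^ 4 * poly [:16:] s" for s
    by (simp add: vec3_lin eval_F5_vec3 f5_def) algebra
  \<comment> \<open>At \<open>x = 0\<close>, \<open>y = 1\<close> the sextic is
    \<open>(z^2 - 1)^2 (2 - z^2)\<close>: the double zero \<open>z = 1\<close> gives the rotation,
    the simple zero \<open>z = \<surd>2\<close> the reflection.\<close>
  show "poly_eval F5 (vec3 0 1 1 + s *s vec3 0 0 1) = s\<^sup>2 * poly ([:2, 1:]\<^sup>2 * (2 - [:1, 1:]\<^sup>2)) s" for s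
    by (simp add: vec3_lin eval_F5_vec3 f5_def) algebra
  show "poly_eval A5 (vec3 0 1 1 + s *s vec3 0 0 1) = s * poly ([:2, 1:] * [:4, -6, -3:]) s" for s
    by (simp add: vec3_lin A5_def B5_def H5_def poly_eval_simps) algebra
  define q :: complex where "q = of_real (sqrt 2)"
  have q: "q\<^sup>2 = 2" by (simp add: q_def flip: of_real_power)
  then have q0: "q \<noteq> 0" by auto
  show "poly_eval F5 (vec3 0 1 q + s *s vec3 0 0 1) = s * poly (- ([:q, 1:]\<^sup>2 - 1)\<^sup>2 * [:2 * q, 1:]) s" for s
  proof -
    have 1: "2 - (q + s)\<^sup>2 = - (s * (2 * q + s))" using q by (simp add: power2_eq_square algebra_simps)
    have 2: "f5 0 1 t = (t\<^sup>2 - 1)\<^sup>2 * (2 - t\<^sup>2)" for t by (simp add: f5_def) algebra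
    have "f5 0 1 (q + s) = ((q + s)\<^sup>2 - 1)\<^sup>2 * - (s * (2 * q + s))" unfolding 2 1 ..
    then show ?thesis by (simp add: vec3_lin eval_F5_vec3 algebra_simps)
  qed
  show "poly (- ([:q, 1:]\<^sup>2 - 1)\<^sup>2 * [:2 * q, 1:]) 0 \<noteq> 0" using q q0 by (simp add: power2_eq_square)
  show "poly_eval A5 (vec3 0 1 q) \<noteq> 0" using q by (simp add: A5_def B5_def H5_def poly_eval_simps)
  show "poly_eval B5 (vec3 0 1 1) \<noteq> 0"
    "(poly ([:2, 1:] * [:4, -6, -3:]) 0)\<^sup>2 = (poly_eval B5 (vec3 0 1 1))\<^sup>2 * poly ([:2, 1:]\<^sup>2 * (2 - [:1, 1:]\<^sup>2)) 0"
    by (simp_all add: B5_def H5_def poly_eval_simps)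
qed (simp_all add: homogeneous_5 identity_5)

subsection \<open>A sextic with three points of type A6\<close>

text \<open>
  The conics \<open>M7, L7, K7\<close> pass through the coordinate points and are permuted cyclically by
  \<open>(x, y, z) \<mapsto> (y, z, x)\<close>. For \<open>w = \<surd>F7\<close> and \<open>a\<^sub>1 = L7 (Z - X) - M7 Y + w\<close> with its cyclic images
  \<open>a\<^sub>2, a\<^sub>3\<close>, whose norms are \<open>2 M7\<^sup>2 L7\<close>, \<open>2 L7\<^sup>2 K7\<close> and \<open>2 K7\<^sup>2 M7\<close>, the form \<open>A7 + B7 w\<close> is
  \<open>a\<^sub>1\<^sup>4 a\<^sub>2\<^sup>2 a\<^sub>3 / (M7 L7\<^sup>4 K7\<^sup>2)\<close>.
\<close>

definition K7 :: ternary_poly where "K7 = Y * Z + Z * X - X * Y"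
definition L7 :: ternary_poly where "L7 = X * Y + Y * Z - Z * X"
definition M7 :: ternary_poly where "M7 = Z * X + X * Y - Y * Z"
definition F7 :: ternary_poly where
  "F7 = (M7 * Y + L7 * (Z - X)) ^ 2 - 2 * (M7 * L7 * K7)"
definition C7 :: ternary_poly where
  "C7 = 2 * (X ^ 2 * (Z - X)) - X * Y * Z - X * Z ^ 2 + Y * Z ^ 2"
definition B7' :: ternary_poly where
  "B7' = M7 * (K7 - 2 * X ^ 2) - 2 * (C7 * (Z - X))"
definition B7 :: ternary_poly where "B7 = 8 * B7'"
definition A7 :: ternary_poly where
  "A7 = 8 * (B7' * (L7 * (Z - X) - M7 * Y) + 2 * (M7 ^ 2 * C7))"
definition H7 :: ternary_poly where "H7 = 2 * M7"

definition f7 :: "complex \<Rightarrow> complex \<Rightarrow> complex \<Rightarrow> complex" where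
  "f7 x y z = ((z * x + x * y - y * z) * y + (x * y + y * z - z * x) * (z - x))\<^sup>2
    - 2 * ((z * x + x * y - y * z) * (x * y + y * z - z * x) * (y * z + z * x - x * y))"

lemma homogeneous_7: "homogeneous 2 H7" "homogeneous 4 B7" "homogeneous 7 A7" "homogeneous 6 F7"
proof -
  have M: "homogeneous 2 M7" unfolding M7_def by (rule homogeneous_intros refl | simp)+
  have L: "homogeneous 2 L7" unfolding L7_def by (rule homogeneous_intros refl | simp)+
  have K: "homogeneous 2 K7" unfolding K7_def by (rule homogeneous_intros refl | simp)+
  have C: "homogeneous 3 C7" unfolding C7_def by (rule homogeneous_intros refl | simp)+
  have B: "homogeneous 4 B7'" unfolding B7'_def by (rule M K C homogeneous_intros refl | simp)+
  show "homogeneous 2 H7" unfolding H7_def by (rule M homogeneous_intros refl | simp)+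
  show "homogeneous 4 B7" unfolding B7_def by (rule B homogeneous_intros refl | simp)+
  show "homogeneous 7 A7" unfolding A7_def by (rule M L B C homogeneous_intros refl | simp)+
  show "homogeneous 6 F7" unfolding F7_def by (rule M L K homogeneous_intros refl | simp)+
qed

lemma eval_F7: "poly_eval F7 v = f7 (v $ 1) (v $ 2) (v $ 3)"
  by (simp add: F7_def K7_def L7_def M7_def f7_def poly_eval_simps)

lemma eval_F7_vec3: "poly_eval F7 (vec3 x y z) = f7 x y z"
  by (simp add: eval_F7)

lemma f7_rotate: "f7 z x y = f7 x y z"
  unfolding f7_def by algebra

lemma identity_7: "(poly_eval A7 v)\<^sup>2 - (poly_eval B7 v)\<^sup>2 * poly_eval F7 v = poly_eval H7 v ^ 7"
proof -
  \<comment> \<open>The relations \<open>1\<close>, \<open>2\<close>, \<open>3\<close> between the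
    conics, the cubic \<open>c\<close> and the quartic \<open>b\<close> imply the identity; only
    they are verified by expansion in the coordinates.\<close>
  have *: "(8 * (b * (l * w - m * y) + 2 * (m\<^sup>2 * c)))\<^sup>2 - (8 * b)\<^sup>2 * ((m * y + l * w)\<^sup>2 - 2 * (m * l * k)) = (2 * m) ^ 7"
    if b: "b = m * (k - 2 * x\<^sup>2) - 2 * (c * w)" and 1: "2 * c * y - (k - 2 * x\<^sup>2) * l = m * (m - 2 * x\<^sup>2)"
      and 2: "2 * c\<^sup>2 - (m - 2 * x\<^sup>2) * b = m ^ 3" and 3: "k = m + 2 * y * w"
    for b c k l m w x y :: complex
  proof -
    have "(8 * (b * (l * w - m * y) + 2 * (m\<^sup>2 * c)))\<^sup>2 - (8 * b)\<^sup>2 * ((m * y + l * w)\<^sup>2 - 2 * (m * l * k)) =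
      128 * m\<^sup>2 * (b\<^sup>2 * l + 2 * b * c * (l * w - m * y) + 2 * m\<^sup>2 * c\<^sup>2)"
      unfolding 3 by algebra
    also have "b\<^sup>2 * l + 2 * b * c * (l * w - m * y) = b * (l * (b + 2 * (c * w)) - 2 * c * m * y)" by algebra
    also have "\<dots> = - b * m * (2 * c * y - (k - 2 * x\<^sup>2) * l)" unfolding b by algebra
    also have "\<dots> + 2 * m\<^sup>2 * c\<^sup>2 = m\<^sup>2 * (2 * c\<^sup>2 - (m - 2 * x\<^sup>2) * b)" unfolding 1 by algebra
    also have "\<dots> = m ^ 5" unfolding 2 by algebra
    finally show ?thesis by algebra
  qed
  define x y z where "x = v $ 1" and "y = v $ 2" and "z = v $ 3"
  show ?thesis
    unfolding A7_def B7_def F7_def H7_def poly_eval_simps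
    by (rule * [where x = x])
      (simp_all add: B7'_def C7_def K7_def L7_def M7_def poly_eval_simps flip: x_def y_def z_def; algebra)+
qed

text \<open>The curve with third coordinate \<open>t - t^2 + 3 t^3\<close> follows the branch at
  \<open>(1, 0, 0)\<close> closely enough for the orders 7 and 4 in the constant and linear
  coefficients.\<close>

lemma f7_expansion:
  "f7 1 t (t - t\<^sup>2 + 3 * t ^ 3 + x) =
    t ^ 7 * poly [:-16, 89, -240, 394, -498, 459, -270, 81:] t +
    x * (t ^ 4 * poly [:6, 22, -120, 260, -418, 468, -324, 108:] t) +
    x\<^sup>2 * poly (poly [:[:1, 2, -1, -14, 49, -114, 168, -144, 54:], [:0, 2, -10, 24, -28, 12:], [:1, -2, 1:]:] [:x:]) t"
  unfolding f7_def by (simp add: power2_eq_square) algebra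

lemma cuspidal_7:
  assumes "v \<in> {vec3 1 0 0, vec3 0 1 0, vec3 0 0 1}"
  shows "cuspidal_at 7 F7 v"
proof -
  let ?T = "[:[:0, 1:]:] :: complex poly poly" and ?Z = "[:[:0, 1, -1, 3:], 1:] :: complex poly poly"
  \<comment> \<open>The three cyclic images of \<open>(1, T, Z)\<close>, among which
    \<open>f7\<close> does not distinguish.\<close>
  define \<Gamma> where "\<Gamma> i = (if v = vec3 1 0 0 then (if i = 1 then 1 else if i = 2 then ?T else ?Z)
     else if v = vec3 0 1 0 then (if i = 1 then ?Z else if i = 2 then 1 else ?T)
     else (if i = 1 then ?T else if i = 2 then ?Z else 1))" for i :: 3
  show ?thesis
  proof (rule cuspidal_atI [of _ \<Gamma>])
    show "poly_eval F7 (\<chi> i. poly (poly (\<Gamma> i) [:x:]) t) =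
      t ^ 7 * poly [:-16, 89, -240, 394, -498, 459, -270, 81:] t +
      x * (t ^ ((7 + 1) div 2) * poly [:6, 22, -120, 260, -418, 468, -324, 108:] t) +
      x\<^sup>2 * poly (poly [:[:1, 2, -1, -14, 49, -114, 168, -144, 54:], [:0, 2, -10, 24, -28, 12:], [:1, -2, 1:]:] [:x:]) t" for x t
    proof -
      have Z: "poly (poly ?Z [:x:]) t = t - t\<^sup>2 + 3 * t ^ 3 + x"
        by (simp add: power2_eq_square power3_eq_cube algebra_simps)
      have T: "poly (poly ?T [:x:]) t = t" by simp
      let ?z = "poly (poly ?Z [:x:]) t"
      have "poly_eval F7 (\<chi> i. poly (poly (\<Gamma> i) [:x:]) t) \<in> {f7 1 t ?z, f7 ?z 1 t, f7 t ?z 1}"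
        by (simp add: eval_F7 \<Gamma>_def T del: poly_pCons)
      then have "poly_eval F7 (\<chi> i. poly (poly (\<Gamma> i) [:x:]) t) = f7 1 t ?z"
        using f7_rotate [of ?z 1 t] f7_rotate [of 1 t ?z] by (simp del: poly_pCons)
      then show ?thesis unfolding Z by (simp only: f7_expansion) simp
    qed
    show "poly (poly (\<Gamma> i) 0) 0 = v $ i" for i
      using exhaust_3 [of i] assms by (auto simp: \<Gamma>_def vec_eq_iff forall_3)
  qed simp_all
qed

text \<open>The cyclic symmetry yields the other two partial derivatives by permuting the
  arguments.\<close>

lemma DERIV_f7:
  "((\<lambda>t. f7 (x + t) y z) has_field_derivative
    4*x^3*y^2 - 8*x^3*y*z + 4*x^3*z^2 - 6*x^2*y^2*z + 6*x^2*y*z^2 + 2*x*y^4 + 4*x*y^3*z - 2*x*y^2*z^2 - 4*x*y*z^3 + 2*x*z^4 - 2*y^4*z - 2*y^3*z^2 + 2*y^2*z^3 - 2*y*z^4) (at 0)"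
  unfolding f7_def by (auto intro!: derivative_eq_intros) algebra

lemma singular_points_7:
  assumes "v \<noteq> 0" "poly_eval F7 v = 0" "(poly_eval F7 has_derivative (\<lambda>_. 0)) (at v)"
  obtains c w where "c \<noteq> 0" "v = c *s w" "w \<in> {vec3 1 0 0, vec3 0 1 0, vec3 0 0 1}"
proof -
  define x y z where "x = v $ 1" and "y = v $ 2" and "z = v $ 3"
  have v: "v = vec3 x y z" by (rule vec3_eqI) (simp_all add: x_def y_def z_def)
  define g where "g x y z = 4*x^3*y^2 - 8*x^3*y*z + 4*x^3*z^2 - 6*x^2*y^2*z + 6*x^2*y*z^2 + 2*x*y^4 + 4*x*y^3*z -
    2*x*y^2*z^2 - 4*x*y*z^3 + 2*x*z^4 - 2*y^4*z - 2*y^3*z^2 + 2*y^2*z^3 - 2*y*z^4" for x y z :: complex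
  have d: "((\<lambda>t. poly_eval F7 (vec3 x y z + t *s w)) has_field_derivative 0) (at 0)" for w
    using directional_derivative_0 [OF assms(3)] by (simp add: v)
  have g1: "((\<lambda>t. f7 (x + t) y z) has_field_derivative g x y z) (at 0)" for x y z
    unfolding g_def by (rule DERIV_f7)
  have 1: "g x y z = 0"
    using DERIV_unique [OF g1 [of x y z]] d [of "vec3 1 0 0"] by (simp add: vec3_lin eval_F7_vec3)
  have 2: "g y z x = 0"
    using DERIV_unique [OF g1 [of y z x]] d [of "vec3 0 1 0"]
    by (simp add: vec3_lin eval_F7_vec3 f7_rotate [of x] del: f7_rotate)
  have 3: "g z x y = 0"
    using DERIV_unique [OF g1 [of z x y]] d [of "vec3 0 0 1"]
    by (simp add: vec3_lin eval_F7_vec3 f7_rotate [of _ x y])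
  define a where "a x y z = -36*x^4 - 15*x^3*y + 87*x^3*z - 144*x^2*y^2 - 110*x^2*y*z - 6*x^2*z^2 - 39*x*y^2*z -
    123*x*y*z^2 - 39*y^4 - 33*y^3*z - 120*y^2*z^2 - 111*y*z^3 - 39*z^4" for x y z :: complex
  \<comment> \<open>Again the coefficients were found by linear algebra.\<close>
  have "4368 * (x * y * z) ^ 3 = a x y z * g x y z + a y z x * g y z x + a z x y * g z x y"
    unfolding a_def g_def by algebra
  then have xyz: "x = 0 \<or> y = 0 \<or> z = 0" unfolding 1 2 3 by simp
  \<comment> \<open>On a coordinate line the sextic is \<open>q^2 r^2 (q^2 + r^2)\<close>. These are
    its two partial derivatives, which vanish together only where \<open>q\<close> or
    \<open>r\<close> does.\<close>
  have *: "q = 0 \<or> r = 0" if "g q r 0 = 0" "g r 0 q = 0" for q r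
  proof (rule ccontr)
    assume "\<not> (q = 0 \<or> r = 0)"
    moreover have "g q r 0 = 2 * q * r\<^sup>2 * (2 * q\<^sup>2 + r\<^sup>2)" "g r 0 q = 2 * r * q\<^sup>2 * (2 * r\<^sup>2 + q\<^sup>2)"
      by (simp_all add: g_def algebra_simps eval_nat_numeral)
    ultimately have "2 * q\<^sup>2 + r\<^sup>2 = 0" "2 * r\<^sup>2 + q\<^sup>2 = 0" using that by auto
    then have "3 * q\<^sup>2 = 0" by algebra
    then show False using \<open>\<not> (q = 0 \<or> r = 0)\<close> by simp
  qed
  have "(x = 0 \<and> y = 0) \<or> (y = 0 \<and> z = 0) \<or> (z = 0 \<and> x = 0)"
    using xyz * [of x y] * [of y z] * [of z x] 1 2 3 by auto
  then have "v = x *s vec3 1 0 0 \<or> v = y *s vec3 0 1 0 \<or> v = z *s vec3 0 0 1"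
    by (auto simp: v vec3_lin)
  then show ?thesis using that assms(1) by (metis insert_iff vector_smult_lzero)
qed

lemma A6_points:
  assumes "w \<in> {vec3 1 0 0, vec3 0 1 0, vec3 0 0 1}"
  shows "has_singularity_type F7 (proj w) (A_type 6)"
proof -
  have "has_singularity_type F7 (proj (vec3 1 0 0)) (A_type (7 - 1))"
  proof (rule has_singularity_type_A [OF identity_7])
    show "vec.span {vec3 1 0 0, vec3 0 1 0, vec3 0 0 1} = UNIV"
      unfolding span_eq_UNIV_iff
    proof
      fix w
      show "\<exists>k l m. w = k *s vec3 1 0 0 + l *s vec3 0 1 0 + m *s vec3 0 0 1"
        by (rule exI [of _ "w $ 1"], rule exI [of _ "w $ 2"], rule exI [of _ "w $ 3"])
          (simp add: vec_eq_iff forall_3)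
    qed
    show "((\<lambda>t. poly_eval A7 (vec3 1 0 0 + t *s vec3 0 1 0)) has_field_derivative 32) (at 0)"
      "((\<lambda>t. poly_eval A7 (vec3 1 0 0 + t *s vec3 0 0 1)) has_field_derivative (-32)) (at 0)"
      "((\<lambda>t. poly_eval H7 (vec3 1 0 0 + t *s vec3 0 1 0)) has_field_derivative 2) (at 0)"
      "((\<lambda>t. poly_eval H7 (vec3 1 0 0 + t *s vec3 0 0 1)) has_field_derivative 2) (at 0)"
      by (auto simp: vec3_lin A7_def B7'_def C7_def H7_def K7_def L7_def M7_def poly_eval_simps
          intro!: derivative_eq_intros)
  qed (auto simp: vec3_eq_0_iff A7_def B7_def B7'_def C7_def H7_def K7_def L7_def M7_def poly_eval_simps)
  then have P: "has_singularity_type F7 (proj (vec3 1 0 0)) (A_type 6)" by simp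
  define r where "r w = vec3 (w $ 3) (w $ 1) (w $ 2)" for w :: "complex ^ 3"
  have r: "has_singularity_type F7 (proj (r w)) (A_type 6)"
    if "has_singularity_type F7 (proj w) (A_type 6)" "w \<noteq> 0" for w
  proof (rule has_singularity_type_symmetry [OF _ _ _ _ _ that])
    show "inj r" by (rule injI) (auto simp: r_def vec_eq_iff forall_3)
    show "surj r"
      by (rule surjI [of r "\<lambda>u. vec3 (u $ 2) (u $ 3) (u $ 1)"]) (simp add: r_def vec_eq_iff forall_3)
    show "poly_eval F7 (r w) = poly_eval F7 w" for w by (simp add: eval_F7 r_def f7_rotate [of "w $ 3"])
  qed (simp_all add: r_def vec_eq_iff forall_3)
  have rv: "r (vec3 x y z) = vec3 z x y" for x y z by (simp add: r_def)
  have "has_singularity_type F7 (proj (vec3 0 1 0)) (A_type 6)"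
    using r [OF P] by (simp add: rv vec3_eq_0_iff)
  moreover from r [OF this] have "has_singularity_type F7 (proj (vec3 0 0 1)) (A_type 6)"
    by (simp add: rv vec3_eq_0_iff)
  ultimately show ?thesis using assms P by blast
qed

theorem dihedral_sextic_7:
  "plane_sextic F7 \<and> irreducible F7 \<and> simple_singularities F7 \<and>
    (\<forall>b \<in> - curve F7. epi (fundamental_group (- curve F7) b) (dihedral_group 7) \<noteq> {}) \<and> \<not> torus_type F7"
proof (rule dihedral_sextic [where A = A7 and B = B7 and H = H7])
  fix v assume v: "v \<noteq> 0" "poly_eval F7 v = 0" "(poly_eval F7 has_derivative (\<lambda>_. 0)) (at v)"
  obtain c w where c: "c \<noteq> 0" "v = c *s w" "w \<in> {vec3 1 0 0, vec3 0 1 0, vec3 0 0 1}"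
    using singular_points_7 [OF v] by blast
  have "w \<noteq> 0" using v(1) c(2) by auto
  then show "cuspidal_at 7 F7 v \<and> has_singularity_type F7 (proj v) (A_type (7 - 1))"
    using cuspidal_7 [OF c(3)] A6_points [OF c(3)] c cuspidal_at_scale [OF _ homogeneous_7(4) c(1)]
    by (auto simp: proj_scale)
next
  fix v assume BH: "poly_eval B7 v = 0" "poly_eval H7 v = 0"
  define x y z where "x = v $ 1" and "y = v $ 2" and "z = v $ 3"
  have m: "z * x + x * y - y * z = 0"
  proof -
    have "poly_eval M7 v = 0" using BH(2) by (simp add: H7_def poly_eval_simps)
    then show ?thesis by (simp add: M7_def poly_eval_simps x_def y_def z_def)
  qed
  \<comment> \<open>Modulo \<open>M7\<close> the cubic \<open>C7\<close> is
    \<open>2 x^2 (z - x)\<close>, so \<open>B7\<close> becomes a constant times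
    \<open>x^2 (z - x)^2\<close>.\<close>
  then have "(2 * (x\<^sup>2 * (z - x)) - x * y * z - x * z\<^sup>2 + y * z\<^sup>2) * (z - x) = 0"
    using BH(1) by (simp add: B7_def B7'_def C7_def M7_def K7_def poly_eval_simps flip: x_def y_def z_def)
  moreover have "2 * (x\<^sup>2 * (z - x)) - x * y * z - x * z\<^sup>2 + y * z\<^sup>2 = 2 * (x\<^sup>2 * (z - x))"
    using m by algebra
  ultimately have "x = 0 \<or> z = x" by auto
  then have "x = 0 \<or> x\<^sup>2 = 0" using m by (auto simp: power2_eq_square)
  then have "x = 0" by simp
  then have "y * z = 0" using m by simp
  then show "poly_eval F7 v = 0"
    using \<open>x = 0\<close> by (auto simp: eval_F7 f7_def simp flip: x_def y_def z_def)
next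
  show "cuspidal_at 7 F7 (vec3 1 0 0)" by (rule cuspidal_7) simp
  \<comment> \<open>The tangent of the branch, whose second and third coordinates agree to first
    order.\<close>
  show "poly_eval F7 (vec3 1 0 0 + s *s vec3 0 1 1) = s ^ 4 * poly [:1, -4, 2:] s" for s
    by (simp add: vec3_lin eval_F7_vec3 f7_def) algebra
  \<comment> \<open>At \<open>x = 1\<close>, \<open>z = 0\<close> the sextic is
    \<open>y^2 (1 + y^2)\<close>: the double zero \<open>y = 0\<close> gives the rotation, the
    simple zero \<open>y = \<i>\<close> the reflection.\<close>
  show "poly_eval F7 (vec3 1 0 0 + s *s vec3 0 1 0) = s\<^sup>2 * poly [:1, 0, 1:] s" for s
    by (simp add: vec3_lin eval_F7_vec3 f7_def) algebra
  have A: "poly_eval A7 (vec3 1 s 0) = s * poly [:32, 16, 24, 8:] s" for s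
    by (simp add: A7_def B7'_def C7_def K7_def L7_def M7_def poly_eval_simps) algebra
  then show "poly_eval A7 (vec3 1 0 0 + s *s vec3 0 1 0) = s * poly [:32, 16, 24, 8:] s" for s
    by (simp add: vec3_lin)
  show "poly_eval F7 (vec3 1 \<i> 0 + s *s vec3 0 1 0) = s * poly ([:\<i>, 1:]\<^sup>2 * [:2 * \<i>, 1:]) s" for s
  proof -
    have 1: "1 + (\<i> + s)\<^sup>2 = s * (2 * \<i> + s)" by (simp add: power2_eq_square algebra_simps)
    have 2: "f7 1 t 0 = t\<^sup>2 * (1 + t\<^sup>2)" for t by (simp add: f7_def) algebra
    have "f7 1 (\<i> + s) 0 = (\<i> + s)\<^sup>2 * (s * (2 * \<i> + s))" unfolding 2 1 ..
    then show ?thesis by (simp add: vec3_lin eval_F7_vec3 algebra_simps)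
  qed
  show "poly_eval A7 (vec3 1 \<i> 0) \<noteq> 0"
    unfolding A by (simp add: complex_eq_iff)
  show "poly_eval B7 (vec3 1 0 0) \<noteq> 0"
    "(poly [:32, 16, 24, 8:] 0)\<^sup>2 = (poly_eval B7 (vec3 1 0 0))\<^sup>2 * poly [:1, 0, 1:] 0"
    by (simp_all add: B7_def B7'_def C7_def K7_def M7_def poly_eval_simps)
qed (simp_all add: homogeneous_7 identity_7)

theorem theorem1p1p3:
  shows "\<exists>F\<^sub>1 F\<^sub>2.
    (plane_sextic F\<^sub>1 \<and> irreducible F\<^sub>1 \<and> simple_singularities F\<^sub>1 \<and>
     (\<forall>b \<in> - curve F\<^sub>1. epi (fundamental_group (- curve F\<^sub>1) b) (dihedral_group 5) \<noteq> {}) \<and>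
     \<not> torus_type F\<^sub>1) \<and>
    (plane_sextic F\<^sub>2 \<and> irreducible F\<^sub>2 \<and> simple_singularities F\<^sub>2 \<and>
     (\<forall>b \<in> - curve F\<^sub>2. epi (fundamental_group (- curve F\<^sub>2) b) (dihedral_group 7) \<noteq> {}) \<and>
     \<not> torus_type F\<^sub>2)"
  using dihedral_sextic_5 dihedral_sextic_7 by blast

end
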